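(* Let $\nu\in(0,1)$ and let $A_{\nu,\infty}$ be the minimal operator generated by $\tau_\nu=-\frac{d^2}{dx^2}+\frac{\nu^2-1/4}{x^2}$ in $L^2(\mathbb R_+)$. (i) All self-adjoint extensions of $A_{\nu,\infty}$ are described by $$(A_{\nu,\infty})_h=A_{\nu,\infty}^*\upharpoonright\operatorname{dom}((A_{\nu,\infty})_h),\qquad h\in\mathbb R\cup\{\infty\},$$ $$\operatorname{dom}((A_{\nu,\infty})_h)=\{f\in\operatorname{dom}(A_{\nu,\infty}^* ): [f,\;x^{1/2-\nu}+2\nu h\,x^{1/2+\nu}]_0=0\},$$ where for $h=\infty$ the condition is understood as $[f,x^{1/2+\nu}]_0=0$. (ii) The extension $(A_{\nu,\infty})_h$ is non-negative if and only if $h\ge0$ (with $h=\infty$ counted as $h\geq 0$).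
   Context: $\mathbb R_+=(0,\infty)$. The maximal operator generated by $\tau_\nu$ in $L^2(\mathbb R_+)$ acts as $\tau_\nu$ on all $f\in L^2(\mathbb R_+)$ with $f,f'$ locally absolutely continuous on $(0,\infty)$ and $\tau_\nu f\in L^2(\mathbb R_+)$; the minimal operator $A_{\nu,\infty}$ is the closure of its restriction to functions with compact support in $(0,\infty)$, and $A_{\nu,\infty}^*$ is the maximal operator. $[f,g]_x=f(x)\overline{g'(x)}-f'(x)\overline{g(x)}$ and $[f,g]_0=\lim_{x\to0^+}[f,g]_x$. *)

theory Defs
  imports "HOL-Analysis.Analysis"
begin

section \<open>The Hilbert space \<open>L\<^sup>2(0,\<infinity>)\<close>\<close>

abbreviation half_line :: "real measure"
  where "half_line \<equiv> lebesgue_on {0<..}"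

definition square_integrable :: "(real \<Rightarrow> complex) \<Rightarrow> bool"
  where "square_integrable F \<longleftrightarrow>
    F \<in> borel_measurable half_line \<and> integrable half_line (\<lambda>x. (cmod (F x))\<^sup>2)"

lemma square_integrableD:
  assumes "square_integrable F"
  shows "F \<in> borel_measurable half_line" "integrable half_line (\<lambda>x. (cmod (F x))\<^sup>2)"
  using assms by (auto simp: square_integrable_def)

lemma square_integrable_zero: "square_integrable (\<lambda>x. 0)"
  by (simp add: square_integrable_def)

lemma square_integrable_scale:
  assumes "square_integrable F"
  shows "square_integrable (\<lambda>x. c * F x)"
  using square_integrableD[OF assms]
  by (auto simp: square_integrable_def norm_mult power_mult_distrib)

lemma square_integrable_add:
  assumes "square_integrable F" "square_integrable G"
  shows "square_integrable (\<lambda>x. F x + G x)"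
proof -
  have bound: "(cmod (F x + G x))\<^sup>2 \<le> 2 * (cmod (F x))\<^sup>2 + 2 * (cmod (G x))\<^sup>2" for x
  proof -
    have "(cmod (F x + G x))\<^sup>2 \<le> (cmod (F x) + cmod (G x))\<^sup>2"
      by (simp add: norm_triangle_ineq power_mono)
    also have "\<dots> \<le> 2 * (cmod (F x))\<^sup>2 + 2 * (cmod (G x))\<^sup>2"
      using sum_squares_bound[of "cmod (F x)" "cmod (G x)"] by (simp add: power2_sum)
    finally show ?thesis .
  qed
  have dom: "integrable half_line (\<lambda>x. 2 * (cmod (F x))\<^sup>2 + 2 * (cmod (G x))\<^sup>2)"
    using square_integrableD(2)[OF assms(1)] square_integrableD(2)[OF assms(2)] by auto
  have meas: "(\<lambda>x. F x + G x) \<in> borel_measurable half_line"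
    using assms by (intro borel_measurable_add square_integrableD)
  have meas2: "(\<lambda>x. (cmod (F x + G x))\<^sup>2) \<in> borel_measurable half_line"
    by (rule borel_measurable_power[OF measurable_compose[OF meas borel_measurable_norm]])
  have "integrable half_line (\<lambda>x. (cmod (F x + G x))\<^sup>2)"
    by (rule Bochner_Integration.integrable_bound[OF dom meas2]) (simp add: bound)
  with meas show ?thesis unfolding square_integrable_def by (rule conjI)
qed

lemma square_integrable_mult_cnj:
  assumes "square_integrable F" "square_integrable G"
  shows "integrable half_line (\<lambda>x. F x * cnj (G x))"
proof -
  have meas: "(\<lambda>x. F x * cnj (G x)) \<in> borel_measurable half_line"
    by (intro borel_measurable_times measurable_compose[OF square_integrableD(1)[OF assms(2)]]
        square_integrableD(1)[OF assms(1)] borel_measurable_continuous_onI continuous_intros)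
  have "cmod (F x * cnj (G x)) \<le> (cmod (F x))\<^sup>2 + (cmod (G x))\<^sup>2" for x
  proof -
    have "0 \<le> cmod (F x) * cmod (G x)" by simp
    then show ?thesis
      using sum_squares_bound[of "cmod (F x)" "cmod (G x)"]
      unfolding norm_mult complex_mod_cnj by linarith
  qed
  moreover have "integrable half_line (\<lambda>x. (cmod (F x))\<^sup>2 + (cmod (G x))\<^sup>2)"
    using square_integrableD(2)[OF assms(1)] square_integrableD(2)[OF assms(2)] by auto
  ultimately show ?thesis
    by (intro Bochner_Integration.integrable_bound[of half_line
          "\<lambda>x. (cmod (F x))\<^sup>2 + (cmod (G x))\<^sup>2", OF _ meas] AE_I2) simp_all
qed

text \<open>Square-integrable functions modulo equality almost everywhere on the half-line; the values
  of a representative outside \<open>(0,\<infinity>)\<close> are irrelevant.\<close>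

quotient_type l2 = "real \<Rightarrow> complex" / partial:
  "\<lambda>F G. square_integrable F \<and> square_integrable G \<and> (AE x in half_line. F x = G x)"
proof (rule part_equivpI)
  show "\<exists>F. square_integrable F \<and> square_integrable F \<and> (AE x in half_line. F x = F x)"
    using square_integrable_zero by auto
  show "symp (\<lambda>F G. square_integrable F \<and> square_integrable G \<and> (AE x in half_line. F x = G x))"
    by (rule sympI) (simp add: eq_commute)
  show "transp (\<lambda>F G. square_integrable F \<and> square_integrable G \<and> (AE x in half_line. F x = G x))"
  proof (rule transpI, elim conjE, intro conjI)
    fix F G H :: "real \<Rightarrow> complex"
    assume "AE x in half_line. F x = G x" "AE x in half_line. G x = H x"
    then show "AE x in half_line. F x = H x" by eventually_elim simp
  qed auto
qed

lift_definition represents :: "(real \<Rightarrow> complex) \<Rightarrow> l2 \<Rightarrow> bool"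
  is "\<lambda>F G. square_integrable F \<and> (AE x in half_line. F x = G x)"
proof -
  fix F G H :: "real \<Rightarrow> complex"
  assume "square_integrable G \<and> square_integrable H \<and> (AE x in half_line. G x = H x)"
  then have *: "AE x in half_line. G x = H x" by simp
  have "(AE x in half_line. F x = G x) \<longleftrightarrow> (AE x in half_line. F x = H x)"
  proof
    assume "AE x in half_line. F x = G x"
    with * show "AE x in half_line. F x = H x" by eventually_elim simp
  next
    assume "AE x in half_line. F x = H x"
    with * show "AE x in half_line. F x = G x" by eventually_elim simp
  qed
  then show "(square_integrable F \<and> (AE x in half_line. F x = G x)) =
      (square_integrable F \<and> (AE x in half_line. F x = H x))" by simp
qed

lift_definition scaleC :: "complex \<Rightarrow> l2 \<Rightarrow> l2" is "\<lambda>c F x. c * F x"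
proof (elim conjE, intro conjI)
  fix c and F F' :: "real \<Rightarrow> complex"
  assume "AE x in half_line. F x = F' x"
  then show "AE x in half_line. c * F x = c * F' x" by eventually_elim simp
qed (simp_all add: square_integrable_scale)

lift_definition cinner :: "l2 \<Rightarrow> l2 \<Rightarrow> complex"
  is "\<lambda>F G. LINT x|half_line. F x * cnj (G x)"
proof -
  fix F F' G G' :: "real \<Rightarrow> complex"
  assume F: "square_integrable F \<and> square_integrable F' \<and> (AE x in half_line. F x = F' x)"
    and G: "square_integrable G \<and> square_integrable G' \<and> (AE x in half_line. G x = G' x)"
  have "AE x in half_line. F x * cnj (G x) = F' x * cnj (G' x)"
    using conjunct2[OF conjunct2[OF F]] conjunct2[OF conjunct2[OF G]] by eventually_elim simp
  moreover have "integrable half_line (\<lambda>x. F x * cnj (G x))"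
    using F G by (blast intro: square_integrable_mult_cnj)
  moreover have "integrable half_line (\<lambda>x. F' x * cnj (G' x))"
    using F G by (blast intro: square_integrable_mult_cnj)
  ultimately show "(LINT x|half_line. F x * cnj (G x)) = (LINT x|half_line. F' x * cnj (G' x))"
    by (intro integral_cong_AE borel_measurable_integrable)
qed

instantiation l2 :: ab_group_add
begin

lift_definition zero_l2 :: l2 is "\<lambda>x. 0" by (simp add: square_integrable_zero)

lift_definition plus_l2 :: "l2 \<Rightarrow> l2 \<Rightarrow> l2" is "\<lambda>F G x. F x + G x"
proof (elim conjE, intro conjI)
  fix F F' G G' :: "real \<Rightarrow> complex"
  assume "AE x in half_line. F x = F' x" "AE x in half_line. G x = G' x"
  then show "AE x in half_line. F x + G x = F' x + G' x" by eventually_elim simp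
qed (simp_all add: square_integrable_add)

definition uminus_l2 :: "l2 \<Rightarrow> l2" where "uminus_l2 f = scaleC (- 1) f"

definition minus_l2 :: "l2 \<Rightarrow> l2 \<Rightarrow> l2" where "minus_l2 f g = f + (- g)"

instance
proof
  fix f g h :: l2
  show "f + g + h = f + (g + h)"
    by transfer (simp add: add.assoc square_integrable_add)
  show "f + g = g + f"
    by transfer (simp add: add.commute square_integrable_add)
  show "0 + f = f"
    by transfer auto
  show "- f + f = 0"
    unfolding uminus_l2_def
    by transfer (simp add: square_integrable_zero square_integrable_scale square_integrable_add)
  show "f - g = f + - g" by (rule minus_l2_def)
qed

end

instantiation l2 :: real_inner
begin

definition scaleR_l2 :: "real \<Rightarrow> l2 \<Rightarrow> l2" where "scaleR_l2 r f = scaleC (complex_of_real r) f"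

definition inner_l2 :: "l2 \<Rightarrow> l2 \<Rightarrow> real" where "inner_l2 f g = Re (cinner f g)"

definition norm_l2 :: "l2 \<Rightarrow> real" where "norm_l2 f = sqrt (inner f f)"

definition sgn_l2 :: "l2 \<Rightarrow> l2" where "sgn_l2 f = inverse (norm f) *\<^sub>R f"

definition dist_l2 :: "l2 \<Rightarrow> l2 \<Rightarrow> real" where "dist_l2 f g = norm (f - g)"

definition uniformity_l2 :: "(l2 \<times> l2) filter"
  where "uniformity_l2 = (INF e\<in>{0<..}. principal {(f, g). dist f g < e})"

definition open_l2 :: "l2 set \<Rightarrow> bool"
  where "open_l2 U \<longleftrightarrow> (\<forall>f\<in>U. \<forall>\<^sub>F (f', g) in uniformity. f' = f \<longrightarrow> g \<in> U)"

lemma cinner_self_aux: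
  "cinner f f = complex_of_real (Re (cinner f f)) \<and> 0 \<le> Re (cinner f f) \<and>
    (Re (cinner f f) = 0 \<longleftrightarrow> f = 0)"
proof transfer
  fix F :: "real \<Rightarrow> complex"
  assume F: "square_integrable F \<and> square_integrable F \<and> (AE x in half_line. F x = F x)"
  have int: "integrable half_line (\<lambda>x. (cmod (F x))\<^sup>2)"
    using F square_integrableD(2) by blast
  have eq: "(LINT x|half_line. F x * cnj (F x))
      = complex_of_real (LINT x|half_line. (cmod (F x))\<^sup>2)"
    by (simp add: complex_norm_square[symmetric] del: of_real_power)
  have "(LINT x|half_line. (cmod (F x))\<^sup>2) = 0 \<longleftrightarrow> (AE x in half_line. F x = 0)"
    using integral_nonneg_eq_0_iff_AE[OF int] by simp
  then show "(LINT x|half_line. F x * cnj (F x)) =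
         complex_of_real (Re (LINT x|half_line. F x * cnj (F x))) \<and>
         0 \<le> Re (LINT x|half_line. F x * cnj (F x)) \<and>
         (Re (LINT x|half_line. F x * cnj (F x)) = 0) =
         (square_integrable F \<and> square_integrable (\<lambda>x. 0) \<and> (AE x in half_line. F x = 0))"
    using F unfolding eq by (simp add: square_integrable_zero)
qed

instance
proof
  fix f g h :: l2 and a b :: real
  show "a *\<^sub>R (f + g) = a *\<^sub>R f + a *\<^sub>R g"
    unfolding scaleR_l2_def
    by transfer (simp add: distrib_left distrib_right square_integrable_add square_integrable_scale)
  show "(a + b) *\<^sub>R f = a *\<^sub>R f + b *\<^sub>R f"
    unfolding scaleR_l2_def
    by transfer (simp add: distrib_left distrib_right square_integrable_add square_integrable_scale)
  show "a *\<^sub>R b *\<^sub>R f = (a * b) *\<^sub>R f"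
    unfolding scaleR_l2_def
    by transfer (auto simp: mult.assoc intro!: square_integrable_scale)
  show "1 *\<^sub>R f = f"
    unfolding scaleR_l2_def by transfer auto
  show "inner f g = inner g f"
    unfolding inner_l2_def
  proof transfer
    fix F G :: "real \<Rightarrow> complex"
    have "(LINT x|half_line. F x * cnj (G x)) = (LINT x|half_line. cnj (G x * cnj (F x)))"
      by (simp add: mult.commute)
    also have "\<dots> = cnj (LINT x|half_line. G x * cnj (F x))"
      by (rule Bochner_Integration.integral_cnj)
    finally show "Re (LINT x|half_line. F x * cnj (G x)) = Re (LINT x|half_line. G x * cnj (F x))"
      by simp
  qed
  show "inner (f + g) h = inner f h + inner g h"
    unfolding inner_l2_def
  proof transfer
    fix F G H :: "real \<Rightarrow> complex"
    assume "square_integrable F \<and> square_integrable F \<and> (AE x in half_line. F x = F x)"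
      "square_integrable G \<and> square_integrable G \<and> (AE x in half_line. G x = G x)"
      "square_integrable H \<and> square_integrable H \<and> (AE x in half_line. H x = H x)"
    then show "Re (LINT x|half_line. (F x + G x) * cnj (H x)) =
        Re (LINT x|half_line. F x * cnj (H x)) + Re (LINT x|half_line. G x * cnj (H x))"
      by (simp add: distrib_right square_integrable_mult_cnj)
  qed
  show "inner (a *\<^sub>R f) g = a * inner f g"
    unfolding inner_l2_def scaleR_l2_def
    by transfer (simp add: mult.assoc)
  show "0 \<le> inner f f"
    using cinner_self_aux by (simp add: inner_l2_def)
  show "inner f f = 0 \<longleftrightarrow> f = 0"
    using cinner_self_aux by (simp add: inner_l2_def)
qed (rule norm_l2_def sgn_l2_def dist_l2_def uniformity_l2_def open_l2_def)+

end

section \<open>Unbounded operators, identified with their graphs\<close>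

text \<open>Graphs live in \<open>L\<^sup>2 \<times> L\<^sup>2\<close>, so extension of operators is inclusion, closure of an operator is
  the topological \<^const>\<open>closure\<close> of its graph, and \<^const>\<open>Domain\<close> is its domain.\<close>

definition linear_operator :: "(l2 \<times> l2) set \<Rightarrow> bool"
  where "linear_operator A \<longleftrightarrow> (0, 0) \<in> A \<and>
    (\<forall>f f' g g'. (f, f') \<in> A \<longrightarrow> (g, g') \<in> A \<longrightarrow> (f + g, f' + g') \<in> A) \<and>
    (\<forall>c f f'. (f, f') \<in> A \<longrightarrow> (scaleC c f, scaleC c f') \<in> A) \<and>
    single_valued A"

definition adjoint_op :: "(l2 \<times> l2) set \<Rightarrow> (l2 \<times> l2) set"
  where "adjoint_op A = {(g, g'). \<forall>(f, f') \<in> A. cinner f' g = cinner f g'}"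

definition self_adjoint :: "(l2 \<times> l2) set \<Rightarrow> bool"
  where "self_adjoint A \<longleftrightarrow>
    linear_operator A \<and> closure (Domain A) = UNIV \<and> adjoint_op A = A"

definition nonneg_operator :: "(l2 \<times> l2) set \<Rightarrow> bool"
  where "nonneg_operator A \<longleftrightarrow> (\<forall>(f, f') \<in> A. cinner f' f \<in> \<real>\<^sub>\<ge>\<^sub>0)"

definition restrict_op :: "(l2 \<times> l2) set \<Rightarrow> l2 set \<Rightarrow> (l2 \<times> l2) set"
  where "restrict_op A D = {(f, f') \<in> A. f \<in> D}"

section \<open>The differential expression and its operators\<close>

text \<open>A finite family of non-overlapping compact subintervals of \<open>[a,b]\<close> is rendered as a division
  \<open>\<D>\<close> of its union; its members are nondegenerate or single points.\<close>

definition absolutely_continuous_on :: "real \<Rightarrow> real \<Rightarrow> (real \<Rightarrow> complex) \<Rightarrow> bool"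
  where "absolutely_continuous_on a b F \<longleftrightarrow>
    (\<forall>\<epsilon>>0. \<exists>\<delta>>0. \<forall>\<D>. \<D> division_of \<Union>\<D> \<and> \<Union>\<D> \<subseteq> {a..b} \<and> (\<Sum>K\<in>\<D>. Sup K - Inf K) < \<delta> \<longrightarrow>
      (\<Sum>K\<in>\<D>. cmod (F (Sup K) - F (Inf K))) < \<epsilon>)"

definition locally_absolutely_continuous :: "(real \<Rightarrow> complex) \<Rightarrow> bool"
  where "locally_absolutely_continuous F \<longleftrightarrow>
    (\<forall>a b. 0 < a \<and> a \<le> b \<longrightarrow> absolutely_continuous_on a b F)"

abbreviation D1 :: "(real \<Rightarrow> complex) \<Rightarrow> real \<Rightarrow> complex"
  where "D1 F \<equiv> \<lambda>x. vector_derivative F (at x)"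

text \<open>\<open>F\<close> and \<open>F'\<close> are locally absolutely continuous on \<open>(0,\<infinity>)\<close>. Since \<^const>\<open>vector_derivative\<close> is
  total, existence of \<open>F'\<close> everywhere and of \<open>F''\<close> almost everywhere is spelled out; the latter is
  automatic by Lebesgue's theorem.\<close>

definition regular :: "(real \<Rightarrow> complex) \<Rightarrow> bool"
  where "regular F \<longleftrightarrow>
    locally_absolutely_continuous F \<and>
    (\<forall>x>0. F differentiable (at x)) \<and> locally_absolutely_continuous (D1 F) \<and>
    (AE x in half_line. D1 F differentiable (at x))"

definition tau :: "real \<Rightarrow> (real \<Rightarrow> complex) \<Rightarrow> real \<Rightarrow> complex"
  where "tau \<nu> F x = - D1 (D1 F) x + complex_of_real ((\<nu>\<^sup>2 - 1/4) / x\<^sup>2) * F x"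

definition maximal_op :: "real \<Rightarrow> (l2 \<times> l2) set"
  where "maximal_op \<nu> = {(f, g). \<exists>F. represents F f \<and> regular F \<and> represents (tau \<nu> F) g}"

definition compactly_supported :: "l2 set"
  where "compactly_supported =
    {f. \<exists>F a b. represents F f \<and> 0 < a \<and> (\<forall>x>0. x \<notin> {a..b} \<longrightarrow> F x = 0)}"

definition minimal_op :: "real \<Rightarrow> (l2 \<times> l2) set"
  where "minimal_op \<nu> = closure (restrict_op (maximal_op \<nu>) compactly_supported)"

definition lagrange_bracket :: "(real \<Rightarrow> complex) \<Rightarrow> (real \<Rightarrow> complex) \<Rightarrow> real \<Rightarrow> complex"
  where "lagrange_bracket F G x = F x * cnj (D1 G x) - D1 F x * cnj (G x)"

text \<open>The parameter \<open>h \<in> \<real> \<union> {\<infinity>}\<close> is an extended real different from \<open>-\<infinity>\<close>.\<close>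

definition boundary_function :: "real \<Rightarrow> ereal \<Rightarrow> real \<Rightarrow> complex"
  where "boundary_function \<nu> h x = complex_of_real
    (if h = \<infinity> then x powr (1/2 + \<nu>)
     else x powr (1/2 - \<nu>) + 2 * \<nu> * real_of_ereal h * x powr (1/2 + \<nu>))"

text \<open>The bracket of \<open>f \<in> dom A\<^sup>*\<close> is formed with the representative of \<open>f\<close> that is regular; on
  \<open>(0,\<infinity>)\<close> it is unique, by continuity.\<close>

definition extension_op :: "real \<Rightarrow> ereal \<Rightarrow> (l2 \<times> l2) set"
  where "extension_op \<nu> h = restrict_op (adjoint_op (minimal_op \<nu>))
    {f \<in> Domain (adjoint_op (minimal_op \<nu>)). \<exists>F. represents F f \<and> regular F \<and>
      (lagrange_bracket F (boundary_function \<nu> h) \<longlongrightarrow> 0) (at_right 0)}"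

end

theory Submission
  imports Defs
begin

text \<open>The equation \<open>\<tau> f = 0\<close> has the solutions \<open>u = x powr (1/2 - \<nu>)\<close> and \<open>v = x powr (1/2 + \<nu>)\<close>, with constant
Wronskian \<open>2\<nu>\<close>. Both are square-integrable near \<open>0\<close> exactly because \<open>\<nu> < 1\<close>. Writing an element of the
maximal domain as \<open>f = a u + b v\<close> by variation of constants, one has \<open>a' = (\<tau> f) v / 2\<nu>\<close> and
\<open>b' = - (\<tau> f) u / 2\<nu>\<close>, which are integrable near \<open>0\<close>; so \<open>a\<close> and \<open>b\<close> have limits \<open>\<alpha> f\<close>, \<open>\<beta> f\<close> at \<open>0\<close>. In these
coordinates the Lagrange bracket is \<open>2\<nu> (a cnj b\<^sub>1 - b cnj a\<^sub>1)\<close>. At infinity brackets vanish, so that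
Green's formula reads
\<open>\<langle>\<tau> f, g\<rangle> - \<langle>f, \<tau> g\<rangle> = - 2\<nu> (\<alpha> f cnj (\<beta> g) - \<beta> f cnj (\<alpha> g))\<close> (\<open>bracket_limits\<close>).

The boundary map \<open>f \<mapsto> (\<alpha> f, \<beta> f)\<close> is onto \<open>\<complex>\<^sup>2\<close> (\<open>boundary_values_surjective\<close>), and the adjoint of the minimal
operator is the maximal one (\<open>adjoint_minimal\<close>). Hence a self-adjoint extension is the preimage of a
subspace of \<open>\<complex>\<^sup>2\<close> equal to its own orthogonal complement for the form \<open>a cnj d - b cnj c\<close>. Such a plane is
either \<open>a = 0\<close>, which is \<open>h = \<infinity>\<close>, or \<open>b = 2\<nu>h a\<close> with \<open>h\<close> real (\<open>lagrangian_plane\<close>), and these are the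
conditions that \<open>[f, \<cdot>]\<^sub>0\<close> vanishes against the prescribed boundary functions.

For the sign, factor \<open>\<tau> = - (d/dx + c/x) (d/dx - c/x)\<close> with \<open>c = 1/2 - \<nu>\<close>, so that \<open>u\<close> is in the kernel of the
right-hand factor. Integrating by parts, the real part of \<open>\<langle>\<tau> f, f\<rangle>\<close> is the squared norm of \<open>f' - (c/x) f\<close> plus the
boundary term \<open>2\<nu> Re (\<beta> f cnj (\<alpha> f))\<close>, which is \<open>4\<nu>\<^sup>2h |\<alpha> f|\<^sup>2\<close> for finite \<open>h\<close> and \<open>0\<close> for \<open>h = \<infinity>\<close>; this is
non-negative when \<open>h \<ge> 0\<close>. For \<open>h < 0\<close>, \<open>negative_energy\<close> exhibits a
trial function of bounded support on which \<open>\<tau>\<close> acts with a negative density.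

Elements of the maximal domain are only twice differentiable almost everywhere, so all of this rests on
the fundamental theorem of calculus for absolutely continuous functions
(\<open>ftc_absolutely_continuous\<close>) and Lebesgue's differentiation theorem (\<open>lebesgue_differentiation\<close>).\<close>

section \<open>Absolutely continuous functions and indefinite integrals\<close>

text \<open>The integral is computed with a gauge. At a point of differentiability the usual estimate applies.
The exceptional points are enclosed in an open set of measure below the \<open>\<delta>\<close> of absolute
continuity; intervals tagged there stay inside that set, so their increments of \<open>F\<close> sum to little.\<close>

lemma ftc_absolutely_continuous:
  fixes F :: "real \<Rightarrow> complex"
  assumes "a \<le> b" and ac: "absolutely_continuous_on a b F"
    and N: "negligible N"
    and der: "\<And>x. x \<in> {a..b} - N \<Longrightarrow> (F has_vector_derivative f x) (at x within {a..b})"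
  shows "(f has_integral (F b - F a)) {a..b}"
proof -
  define g where "g x = (if x \<in> N then 0 else f x)" for x
  have "(g has_integral (F b - F a)) (cbox a b)"
    unfolding has_integral
  proof (intro allI impI)
    fix e :: real assume "e > 0"
    obtain \<delta> where "\<delta> > 0" and \<delta>: "\<And>\<D>. \<D> division_of \<Union>\<D> \<Longrightarrow> \<Union>\<D> \<subseteq> {a..b} \<Longrightarrow>
        (\<Sum>K\<in>\<D>. Sup K - Inf K) < \<delta> \<Longrightarrow> (\<Sum>K\<in>\<D>. cmod (F (Sup K) - F (Inf K))) < e / 2"
      using ac[unfolded absolutely_continuous_on_def, rule_format, of "e / 2"] \<open>e > 0\<close> by auto
    have "N \<in> sets lebesgue" using N by (simp add: negligible_imp_sets)
    from sets_lebesgue_outer_open[OF this \<open>\<delta> > 0\<close>]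
    obtain T where T: "open T" "N \<subseteq> T" "T - N \<in> lmeasurable" "emeasure lebesgue (T - N) < ennreal \<delta>" .
    have NM: "N \<in> lmeasurable" "measure lebesgue N = 0"
      using N by (auto simp: negligible_imp_measurable negligible_imp_measure0)
    have TN: "T = (T - N) \<union> N" using T(2) by blast
    have Tm: "T \<in> lmeasurable" using fmeasurable.Un[OF T(3) NM(1)] TN by simp
    have "measure lebesgue (T - N) < \<delta>"
      using T(3,4) \<open>\<delta> > 0\<close> by (simp add: emeasure_eq_measure2 ennreal_less_iff)
    moreover have "measure lebesgue T \<le> measure lebesgue (T - N) + measure lebesgue N"
      using measure_Un_le[of "T - N" lebesgue N] TN NM(1) T(3) by (simp add: fmeasurableD)
    ultimately have Tlt: "measure lebesgue T < \<delta>" using NM(2) by simp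
    \<comment> \<open>the summand \<open>1\<close> keeps the denominator positive when \<open>a = b\<close>\<close>
    define e' where "e' = e / (2 * (b - a + 1))"
    have e': "e' > 0" "e' * (b - a) < e / 2"
      using \<open>e > 0\<close> \<open>a \<le> b\<close> by (auto simp: e'_def field_simps)
    have "\<forall>x. \<exists>d>0. x \<in> {a..b} - N \<longrightarrow>
         (\<forall>y\<in>{a..b}. norm (y-x) < d \<longrightarrow> norm (F y - F x - (y-x) *\<^sub>R f x) \<le> e' * norm (y-x))"
      using der[unfolded has_vector_derivative_def has_derivative_within_alt] e' by (metis zero_less_one)
    then obtain d where d: "\<And>x. 0 < d x"
                   "\<And>x y. \<lbrakk>x \<in> {a..b} - N; y \<in> {a..b}; norm (y-x) < d x\<rbrakk>
                          \<Longrightarrow> norm (F y - F x - (y-x) *\<^sub>R f x) \<le> e' * norm (y-x)"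
      by metis
    define \<gamma> where "\<gamma> x = (if x \<in> N then T else ball x (d x))" for x
    have gauge: "gauge \<gamma>"
      using d(1) T(1,2) by (auto simp: gauge_def \<gamma>_def)
    show "\<exists>\<gamma>. gauge \<gamma> \<and> (\<forall>\<D>. \<D> tagged_division_of cbox a b \<and> \<gamma> fine \<D> \<longrightarrow>
            norm ((\<Sum>(x, k)\<in>\<D>. measure lborel k *\<^sub>R g x) - (F b - F a)) < e)"
    proof (intro exI[of _ \<gamma>] conjI gauge allI impI, elim conjE)
      fix p assume ptag: "p tagged_division_of cbox a b" and finep: "\<gamma> fine p"
      have fin: "finite p" using ptag by (rule tagged_division_of_finite)
      have ba: "b - a = (\<Sum>(x,K)\<in>p. Sup K - Inf K)" "F b - F a = (\<Sum>(x,K)\<in>p. F(Sup K) - F(Inf K))"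
        using additive_tagged_division_1[where f= "\<lambda>x. x"] additive_tagged_division_1[where f= F]
              \<open>a \<le> b\<close> ptag by auto
      define pN where "pN = {(x,K) \<in> p. x \<in> N}"
      define pG where "pG = {(x,K) \<in> p. x \<notin> N}"
      have p_split: "p = pN \<union> pG" "pN \<inter> pG = {}" "finite pN" "finite pG" "pN \<subseteq> p" "pG \<subseteq> p"
        using fin by (auto simp: pN_def pG_def intro: finite_subset[OF _ fin])
      let ?D = "\<lambda>(x::real,K). measure lborel K *\<^sub>R g x - (F (Sup K) - F (Inf K))"
      have interval: "\<exists>u v. K = {u..v} \<and> u \<le> v \<and> x \<in> {u..v} \<and> {u..v} \<subseteq> {a..b}" if xK: "(x,K) \<in> p" for x K
        using tagged_division_ofD(2,3,4)[OF ptag xK] by auto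
      have good: "norm (\<Sum>q\<in>pG. ?D q) \<le> e' * (b - a)"
      proof -
        have "norm (\<Sum>q\<in>pG. ?D q) \<le> (\<Sum>q\<in>pG. e' * (case q of (x,K) \<Rightarrow> Sup K - Inf K))"
        proof (rule sum_norm_le, clarify)
          fix x K assume xK: "(x,K) \<in> pG"
          then obtain u v where uv: "K = {u..v}" "u \<le> v" "x \<in> {u..v}" "{u..v} \<subseteq> {a..b}" and xN: "x \<notin> N"
            using interval p_split(6) unfolding pG_def by blast
          have ball: "K \<subseteq> ball x (d x)"
            using finep xK xN p_split(6) unfolding fine_def \<gamma>_def by fastforce
          have x: "x \<in> {a..b} - N" using uv xN by auto
          have "norm ((v - u) *\<^sub>R f x - (F v - F u)) = norm (F u - F x - (u - x) *\<^sub>R f x - (F v - F x - (v - x) *\<^sub>R f x))"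
            by (simp add: algebra_simps)
          also have "\<dots> \<le> norm (F u - F x - (u - x) *\<^sub>R f x) + norm (F v - F x - (v - x) *\<^sub>R f x)"
            by (rule norm_triangle_ineq4)
          also have "\<dots> \<le> e' * norm (u - x) + e' * norm (v - x)"
          proof (rule add_mono; rule d(2)[OF x])
            show "u \<in> {a..b}" "v \<in> {a..b}" using uv by auto
            have "u \<in> ball x (d x)" "v \<in> ball x (d x)" using ball uv(1,2) by (simp_all add: subset_eq del: mem_ball)
            then show "norm (u - x) < d x" "norm (v - x) < d x"
              by (auto simp: dist_real_def)
          qed
          also have "\<dots> = e' * (Sup K - Inf K)"
            using uv by (auto simp: algebra_simps)
          finally show "norm (measure lborel K *\<^sub>R g x - (F (Sup K) - F (Inf K))) \<le> e' * (Sup K - Inf K)"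
            using uv xN by (simp add: g_def)
        qed
        also have "\<dots> = e' * (\<Sum>(x,K)\<in>pG. Sup K - Inf K)" by (simp add: sum_distrib_left)
        also have "\<dots> \<le> e' * (\<Sum>(x,K)\<in>p. Sup K - Inf K)"
          using e'(1) interval by (intro mult_left_mono sum_mono2 fin p_split(6)) fastforce+
        finally show ?thesis using ba(1) by simp
      qed
      have bad: "norm (\<Sum>q\<in>pN. ?D q) < e / 2"
      proof -
        have "pN tagged_partial_division_of cbox a b"
          using ptag p_split(5) unfolding tagged_division_of_def by (meson tagged_partial_division_subset)
        then have pN: "pN tagged_division_of \<Union> (snd ` pN)"
          by (rule tagged_partial_division_of_Union_self)
        define \<D> where "\<D> = snd ` pN"
        have div: "\<D> division_of \<Union>\<D>" unfolding \<D>_def by (rule division_of_tagged_division[OF pN])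
        have ab: "\<Union>\<D> \<subseteq> {a..b}" using interval p_split(5) unfolding \<D>_def by fastforce
        have sub: "\<Union>\<D> \<subseteq> T"
          using finep unfolding \<D>_def pN_def fine_def \<gamma>_def by fastforce
        have "(\<Sum>K\<in>\<D>. Sup K - Inf K) = (\<Sum>K\<in>\<D>. measure lborel K)"
        proof (rule sum.cong[OF refl])
          fix K assume "K \<in> \<D>"
          then obtain x where "(x,K) \<in> p" using p_split(5) unfolding \<D>_def by auto
          then obtain u v where "K = {u..v}" "u \<le> v" using interval by blast
          then show "Sup K - Inf K = measure lborel K" by simp
        qed
        also have "\<dots> = measure lebesgue (\<Union>\<D>)"
          using content_division[OF div] by (metis (no_types, lifting) cbox_borel div division_ofD(4) measure_completion sets_lborel sum.cong)
        also have "\<dots> \<le> measure lebesgue T"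
          using sub Tm div by (intro measure_mono_fmeasurable) (auto simp: lmeasurable_division fmeasurableD)
        finally have len: "(\<Sum>K\<in>\<D>. Sup K - Inf K) < \<delta>" using Tlt by simp
        \<comment> \<open>\<open>Sup\<close> and \<open>Inf\<close> of the empty interval are unspecified, and regrouping by intervals needs a function that vanishes on it\<close>
        define \<phi> where "\<phi> K = (if K = {} then 0 else cmod (F (Sup K) - F (Inf K)))" for K
        have ne: "K \<noteq> {}" if "K \<in> \<D>" for K using division_ofD(3)[OF div that] .
        have "norm (\<Sum>q\<in>pN. ?D q) \<le> (\<Sum>q\<in>pN. case q of (x,K) \<Rightarrow> cmod (F (Sup K) - F (Inf K)))"
        proof (rule sum_norm_le, clarify)
          fix x K assume "(x,K) \<in> pN"
          then show "norm (measure lborel K *\<^sub>R g x - (F (Sup K) - F (Inf K))) \<le> cmod (F (Sup K) - F (Inf K))"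
            by (simp add: pN_def g_def norm_minus_commute)
        qed
        also have "\<dots> = (\<Sum>(x,K)\<in>pN. \<phi> K)"
          using ne unfolding \<phi>_def \<D>_def by (intro sum.cong) force+
        also have "\<dots> = (\<Sum>K\<in>\<D>. \<phi> K)"
          unfolding \<D>_def
          by (rule sum.over_tagged_division_lemma[OF pN]) (auto simp: \<phi>_def box_eq_empty not_less le_less)
        also have "\<dots> = (\<Sum>K\<in>\<D>. cmod (F (Sup K) - F (Inf K)))"
          using ne unfolding \<phi>_def by (intro sum.cong) auto
        also have "\<dots> < e / 2" by (rule \<delta>[OF div ab len])
        finally show ?thesis .
      qed
      have "(\<Sum>(x, k)\<in>p. measure lborel k *\<^sub>R g x) - (F b - F a) = (\<Sum>q\<in>p. ?D q)"
        unfolding ba(2) by (simp add: sum_subtractf split_def)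
      also have "\<dots> = (\<Sum>q\<in>pN. ?D q) + (\<Sum>q\<in>pG. ?D q)"
        using sum.union_disjoint[OF p_split(3,4,2), of ?D] p_split(1) by simp
      finally show "norm ((\<Sum>(x, k)\<in>p. measure lborel k *\<^sub>R g x) - (F b - F a)) < e"
        using good bad e'(2) norm_triangle_ineq[of "\<Sum>q\<in>pN. ?D q" "\<Sum>q\<in>pG. ?D q"] by simp
    qed
  qed
  then show ?thesis
    using has_integral_spike[OF N, of "cbox a b" f g] by (auto simp: g_def)
qed

text \<open>If the derivative fails at \<open>x\<close>, arbitrarily short intervals with endpoint \<open>x\<close> have a deviation of at
least a fixed fraction of their length. By Vitali's theorem disjoint ones cover almost all such \<open>x\<close>, and
Henstock's lemma bounds the sum of their deviations, hence of their lengths, by any given \<open>e\<close>.\<close>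

lemma lebesgue_differentiation:
  fixes f :: "real \<Rightarrow> complex"
  assumes f: "f integrable_on {a..b}"
  shows "negligible {x \<in> {a<..<b}. \<not> ((\<lambda>x. integral {a..x} f) has_vector_derivative f x) (at x)}"
proof -
  define P where "P x = integral {a..x} f" for x
  define J where "J x y = {min x y..max x y}" for x y :: real
  define dev where "dev x y = norm (\<bar>y - x\<bar> *\<^sub>R f x - integral (J x y) f)" for x y
  have dev_P: "norm (P y - P x - (y - x) *\<^sub>R f x) = dev x y" if "x \<in> {a..b}" "y \<in> {a..b}" for x y
  proof (cases "x \<le> y")
    case True
    have "P x + integral {x..y} f = P y"
      unfolding P_def using that True f
      by (intro Henstock_Kurzweil_Integration.integral_combine) (auto intro: integrable_subinterval_real)
    then have e: "P y = P x + integral {x..y} f" by simp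
    show ?thesis using True unfolding e
      by (simp add: dev_def J_def norm_minus_commute[of "(y - x) *\<^sub>R f x"])
  next
    case False
    have "P y + integral {y..x} f = P x"
      unfolding P_def using that False f
      by (intro Henstock_Kurzweil_Integration.integral_combine) (auto intro: integrable_subinterval_real)
    then have e: "P x = P y + integral {y..x} f" by simp
    have "(y - x) *\<^sub>R f x = - ((x - y) *\<^sub>R f x)" by (simp flip: scaleR_minus_left)
    then show ?thesis using False unfolding e by (simp add: dev_def J_def norm_minus_commute algebra_simps)
  qed
  define E where "E m = {x \<in> {a<..<b}. \<forall>\<delta>>0. \<exists>y\<in>{a<..<b}. y \<noteq> x \<and> \<bar>y - x\<bar> < \<delta> \<and> dev x y > \<bar>y - x\<bar> / Suc m}" for m
  have negE: "negligible (E m)" for m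
    unfolding negligible_outer_le
  proof (intro allI impI)
    fix e :: real assume "e > 0"
    then have "e / Suc m > 0" by simp
    then obtain \<gamma> where \<gamma>: "gauge \<gamma>" and Hen: "\<And>p. \<lbrakk>p tagged_partial_division_of (cbox a b); \<gamma> fine p\<rbrakk> \<Longrightarrow>
             sum (\<lambda>(x,k). norm(measure lborel k *\<^sub>R f x - integral k f)) p < e / Suc m"
      using Henstock_lemma[OF f[folded box_real(2)]] by blast
    define K where "K = {(x,y). x \<in> {a<..<b} \<and> y \<in> {a<..<b} \<and> y \<noteq> x \<and> J x y \<subseteq> \<gamma> x \<and> dev x y > \<bar>y - x\<bar> / Suc m}"
    define c where "c = (\<lambda>(x,y). (x + y) / 2 :: real)"
    define r where "r = (\<lambda>(x,y). \<bar>y - x\<bar> / 2 :: real)"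
    have cb: "cball (c i) (r i) = (case i of (x,y) \<Rightarrow> J x y)" for i
      by (auto simp: c_def r_def J_def cball_eq_atLeastAtMost min_def max_def abs_if field_simps split: prod.splits if_splits)
    have r: "0 < r i" if "i \<in> K" for i using that by (auto simp: K_def r_def)
    have cov: "\<exists>i. i \<in> K \<and> x \<in> cball (c i) (r i) \<and> r i < d" if "x \<in> E m" "0 < d" for x d
    proof -
      obtain d' where d': "d' > 0" "ball x d' \<subseteq> \<gamma> x"
        using \<gamma> unfolding gauge_def by (meson open_contains_ball)
      have xE: "x \<in> E m" and dd: "0 < min d d'" using that d'(1) by auto
      obtain y where y: "y \<in> {a<..<b}" "y \<noteq> x" "\<bar>y - x\<bar> < min d d'" "dev x y > \<bar>y - x\<bar> / Suc m"
        using dd xE unfolding E_def by blast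
      have "J x y \<subseteq> ball x d'" using y(3) by (auto simp: J_def dist_real_def)
      then have "(x,y) \<in> K" using y d' that(1) by (auto simp: K_def E_def)
      moreover have "x \<in> cball (c (x,y)) (r (x,y))" unfolding cb by (simp add: J_def)
      moreover have "r (x,y) < d" using y(3) \<open>0 < d\<close> by (simp add: r_def)
      ultimately show ?thesis by blast
    qed
    obtain C where C: "countable C" "C \<subseteq> K"
      and pw: "pairwise (\<lambda>i j. disjnt (cball (c i) (r i)) (cball (c j) (r j))) C"
      and neg: "negligible (E m - (\<Union>i \<in> C. cball (c i) (r i)))"
      by (rule Vitali_covering_theorem_cballs[of K r "E m" c, OF r cov])
    have fin_bound: "(\<Sum>i\<in>D. measure lebesgue (cball (c i) (r i))) \<le> e" if D: "D \<subseteq> C" "finite D" for D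
    proof -
      define T where "T = (\<lambda>(x,y). (x, J x y))"
      have inj: "inj_on T D" unfolding T_def J_def
        by (rule inj_onI) (auto simp: Icc_eq_Icc min_def max_def split: if_splits)
      have meas: "measure lebesgue (J x y) = \<bar>y - x\<bar>" for x y by (simp add: J_def min_def max_def)
      have "T ` D tagged_partial_division_of cbox a b"
        unfolding tagged_partial_division_of_def
      proof (intro conjI allI impI)
        show "finite (T ` D)" using D by simp
        fix x k assume "(x,k) \<in> T ` D"
        then obtain y where xy: "(x,y) \<in> D" "k = J x y" by (auto simp: T_def)
        then have "(x,y) \<in> K" using D C by auto
        then show "x \<in> k" "k \<subseteq> cbox a b" "\<exists>a b. k = cbox a b"
          unfolding xy(2) by (auto simp: J_def K_def box_real min_def max_def split: if_splits)
      next
        fix x1 K1 x2 K2 assume *: "(x1, K1) \<in> T ` D \<and> (x2, K2) \<in> T ` D \<and> (x1, K1) \<noteq> (x2, K2)"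
        then obtain y1 y2 where xy: "(x1,y1) \<in> D" "K1 = J x1 y1" "(x2,y2) \<in> D" "K2 = J x2 y2" by (auto simp: T_def)
        with * have ne: "(x1,y1) \<noteq> (x2,y2)" by auto
        then have "disjnt K1 K2"
          using pairwiseD[OF pw, of "(x1,y1)" "(x2,y2)"] xy D(1) unfolding cb by auto
        then show "interior K1 \<inter> interior K2 = {}"
          using interior_subset by (fastforce simp: disjnt_def)
      qed
      moreover have "\<gamma> fine (T ` D)"
        using D(1) C(2) by (fastforce simp: fine_def T_def K_def)
      ultimately have "(\<Sum>(x,k)\<in>T ` D. norm (measure lborel k *\<^sub>R f x - integral k f)) < e / Suc m"
        by (rule Hen)
      also have "(\<Sum>(x,k)\<in>T ` D. norm (measure lborel k *\<^sub>R f x - integral k f)) = (\<Sum>(x,y)\<in>D. dev x y)"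
        unfolding sum.reindex[OF inj]
        by (rule sum.cong[OF refl]) (auto simp: T_def dev_def J_def min_def max_def)
      finally have lt: "(\<Sum>(x,y)\<in>D. dev x y) < e / Suc m" .
      have "(\<Sum>i\<in>D. measure lebesgue (cball (c i) (r i))) = (\<Sum>(x,y)\<in>D. \<bar>y - x\<bar>)"
        unfolding cb by (rule sum.cong[OF refl]) (auto simp: meas)
      also have "\<dots> \<le> (\<Sum>i\<in>D. Suc m * (case i of (x,y) \<Rightarrow> dev x y))"
      proof (rule sum_mono, clarify)
        fix x y assume "(x,y) \<in> D"
        then have "dev x y > \<bar>y - x\<bar> / Suc m" using D C by (auto simp: K_def)
        then show "\<bar>y - x\<bar> \<le> Suc m * dev x y" by (simp add: divide_less_eq mult.commute)
      qed
      also have "\<dots> = Suc m * (\<Sum>(x,y)\<in>D. dev x y)" by (simp add: sum_distrib_left)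
      also have "\<dots> \<le> e" using lt by (simp add: field_simps)
      finally show ?thesis .
    qed
    have U: "(\<Union>i\<in>C. cball (c i) (r i)) \<in> lmeasurable" "measure lebesgue (\<Union>i\<in>C. cball (c i) (r i)) \<le> e"
    proof -
      have *: "\<And>I'. finite I' \<Longrightarrow> I' \<subseteq> C \<Longrightarrow> measure lebesgue (\<Union>i\<in>I'. cball (c i) (r i)) \<le> e"
      proof -
        fix D assume "finite D" "D \<subseteq> C"
        then have "measure lebesgue (\<Union>i\<in>D. cball (c i) (r i)) \<le> (\<Sum>i\<in>D. measure lebesgue (cball (c i) (r i)))"
          by (intro measure_UNION_le) auto
        with fin_bound[OF \<open>D \<subseteq> C\<close> \<open>finite D\<close>] show "measure lebesgue (\<Union>i\<in>D. cball (c i) (r i)) \<le> e" by linarith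
      qed
      show "(\<Union>i\<in>C. cball (c i) (r i)) \<in> lmeasurable" "measure lebesgue (\<Union>i\<in>C. cball (c i) (r i)) \<le> e"
        using fmeasurable_UN_bound[OF C(1) _ *] measure_UN_bound[OF C(1) _ *] \<open>e > 0\<close> by auto
    qed
    let ?T = "(E m - (\<Union>i \<in> C. cball (c i) (r i))) \<union> (\<Union>i\<in>C. cball (c i) (r i))"
    show "\<exists>T. E m \<subseteq> T \<and> T \<in> lmeasurable \<and> measure lebesgue T \<le> e"
    proof (intro exI[of _ ?T] conjI)
      have n: "E m - (\<Union>i \<in> C. cball (c i) (r i)) \<in> lmeasurable" "measure lebesgue (E m - (\<Union>i \<in> C. cball (c i) (r i))) = 0"
        using neg by (auto simp: negligible_imp_measurable negligible_imp_measure0)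
      show "?T \<in> lmeasurable" using n U by (intro fmeasurable.Un)
      show "measure lebesgue ?T \<le> e"
        using measure_Un_le[of "E m - (\<Union>i \<in> C. cball (c i) (r i))" lebesgue "\<Union>i\<in>C. cball (c i) (r i)"] n U
        by (simp add: fmeasurableD del: Un_Diff_cancel2)
    qed auto
  qed
  have "{x \<in> {a<..<b}. \<not> (P has_vector_derivative f x) (at x)} \<subseteq> (\<Union>m. E m)"
  proof clarify
    fix x assume x: "x \<in> {a<..<b}" and nd: "\<not> (P has_vector_derivative f x) (at x)" 
    have "\<exists>m. x \<in> E m"
    proof (rule ccontr)
      assume "\<nexists>m. x \<in> E m"
      then have ex: "\<exists>\<delta>>0. \<forall>y\<in>{a<..<b}. y \<noteq> x \<longrightarrow> \<bar>y - x\<bar> < \<delta> \<longrightarrow> dev x y \<le> \<bar>y - x\<bar> / Suc m" for m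
        using x unfolding E_def by (force simp: not_less)
      have "(P has_vector_derivative f x) (at x within {a<..<b})"
        unfolding has_vector_derivative_def has_derivative_within_alt
      proof (intro conjI allI impI bounded_linear_scaleR_left)
        fix e :: real assume "e > 0"
        then obtain m where m: "1 / Suc m < e" using nat_approx_posE by blast
        obtain \<delta> where \<delta>: "\<delta> > 0" "\<forall>y\<in>{a<..<b}. y \<noteq> x \<longrightarrow> \<bar>y - x\<bar> < \<delta> \<longrightarrow> dev x y \<le> \<bar>y - x\<bar> / Suc m"
          using ex[of m] by blast
        show "\<exists>d>0. \<forall>y\<in>{a<..<b}. norm (y - x) < d \<longrightarrow> norm (P y - P x - (y - x) *\<^sub>R f x) \<le> e * norm (y - x)"
        proof (intro exI[of _ \<delta>] conjI \<delta>(1) ballI impI)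
          fix y assume y: "y \<in> {a<..<b}" "norm (y - x) < \<delta>"
          have eq: "norm (P y - P x - (y - x) *\<^sub>R f x) = dev x y" using x y by (intro dev_P) auto
          show "norm (P y - P x - (y - x) *\<^sub>R f x) \<le> e * norm (y - x)"
          proof (cases "y = x")
            case False
            then have "dev x y \<le> \<bar>y - x\<bar> / Suc m" using \<delta>(2) y by auto
            also have "\<dots> \<le> e * \<bar>y - x\<bar>" using mult_right_mono[of "1 / Suc m" e "\<bar>y - x\<bar>"] m by simp
            finally show ?thesis unfolding eq by simp
          qed simp
        qed
      qed
      then show False using nd has_vector_derivative_within_open[OF x open_greaterThanLessThan] by blast
    qed
    then show "x \<in> (\<Union>m. E m)" by blast
  qed
  moreover have "negligible (\<Union>m. E m)"
    by (intro negligible_countable_Union) (auto simp: negE)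
  ultimately show ?thesis unfolding P_def by (rule negligible_subset[rotated])
qed

text \<open>The part of \<open>|f|\<close> where \<open>|f| > n\<close> has small integral for large \<open>n\<close>; the rest is at most \<open>n\<close>, so it
contributes at most \<open>n\<close> times the total length.\<close>

lemma absolutely_continuous_indefinite_integral:
  fixes f :: "real \<Rightarrow> complex"
  assumes f: "f absolutely_integrable_on {a..b}"
  shows "absolutely_continuous_on a b (\<lambda>x. integral {a..x} f)"
  unfolding absolutely_continuous_on_def
proof (intro allI impI)
  fix e :: real assume "e > 0"
  define h where "h n x = (if norm (f x) > real n then norm (f x) else 0)" for n x
  have fi: "integrable (lebesgue_on {a..b}) f" using f by (simp add: absolutely_integrable_imp_integrable)
  have [measurable]: "f \<in> borel_measurable (lebesgue_on {a..b})" using fi by auto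
  have hm: "h n \<in> borel_measurable (lebesgue_on {a..b})" for n
    unfolding h_def
    by (rule measurable_compose[of "\<lambda>x. norm (f x)" _ borel "\<lambda>y. if y > real n then y else 0"]) measurable
  have hi: "integrable (lebesgue_on {a..b}) (h n)" for n
    by (rule Bochner_Integration.integrable_bound[OF fi hm]) (auto simp: h_def)
  have "(\<lambda>n. LINT x|lebesgue_on {a..b}. h n x) \<longlonglongrightarrow> (LINT x|lebesgue_on {a..b}. (0::real))"
  proof (rule integral_dominated_convergence[where w="\<lambda>x. norm (f x)"])
    show "AE x in lebesgue_on {a..b}. (\<lambda>n. h n x) \<longlonglongrightarrow> 0"
    proof (rule AE_I2)
      fix x
      obtain n0 where "norm (f x) < real n0" using reals_Archimedean2 by blast
      then have "eventually (\<lambda>n. h n x = 0) sequentially"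
        unfolding eventually_sequentially h_def by (intro exI[of _ n0]) auto
      then show "(\<lambda>n. h n x) \<longlonglongrightarrow> 0" by (rule tendsto_eventually)
    qed
  qed (use fi hi in \<open>auto simp: h_def\<close>)
  then have "eventually (\<lambda>n. (LINT x|lebesgue_on {a..b}. h n x) < e / 2) sequentially"
    using \<open>e > 0\<close> by (intro order_tendstoD(2)) auto
  then obtain n where n: "(LINT x|lebesgue_on {a..b}. h n x) < e / 2"
    by (auto simp: eventually_sequentially)
  have hI: "h n integrable_on {a..b}" "integral {a..b} (h n) < e / 2"
    using n hi[of n] by (simp_all add: lebesgue_integral_eq_integral integrable_on_lebesgue_on)
  define \<delta> where "\<delta> = e / (2 * (real n + 1))"
  have "\<delta> > 0" using \<open>e > 0\<close> by (simp add: \<delta>_def)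
  show "\<exists>\<delta>>0. \<forall>\<D>. \<D> division_of \<Union>\<D> \<and> \<Union>\<D> \<subseteq> {a..b} \<and> (\<Sum>K\<in>\<D>. Sup K - Inf K) < \<delta> \<longrightarrow>
      (\<Sum>K\<in>\<D>. cmod (integral {a..Sup K} f - integral {a..Inf K} f)) < e"
  proof (intro exI[of _ \<delta>] conjI \<open>\<delta> > 0\<close> allI impI, elim conjE)
    fix \<D> assume div: "\<D> division_of \<Union>\<D>" and sub: "\<Union>\<D> \<subseteq> {a..b}" and len: "(\<Sum>K\<in>\<D>. Sup K - Inf K) < \<delta>"
    have hK: "h n integrable_on K" if "K \<in> \<D>" for K
      using division_ofD(4)[OF div that] sub that hI(1) by (metis Union_upper box_real(2) integrable_subinterval_real order_trans)
    have le: "cmod (integral {a..Sup K} f - integral {a..Inf K} f) \<le> integral K (h n) + n * (Sup K - Inf K)"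
      if K: "K \<in> \<D>" for K
    proof -
      obtain u v where uv: "K = {u..v}" "u \<le> v" "{u..v} \<subseteq> {a..b}"
        using division_ofD(2,3,4)[OF div K] sub K by (metis Union_upper atLeastatMost_empty_iff box_real(2) order_trans)
      have fab: "f integrable_on {a..b}" using f by (simp add: absolutely_integrable_on_def)
      have fuv: "f integrable_on {u..v}" using fab uv integrable_subinterval_real by blast
      have "f integrable_on {a..v}" using fab uv integrable_subinterval_real[of f a b a v] by auto
      then have "integral {a..u} f + integral {u..v} f = integral {a..v} f"
        using uv by (intro Henstock_Kurzweil_Integration.integral_combine) auto
      then have "integral {a..Sup K} f - integral {a..Inf K} f = integral {u..v} f"
        using uv by (simp add: diff_eq_eq add.commute)
      also have "norm (integral {u..v} f) \<le> integral {u..v} (\<lambda>x. h n x + n)"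
      proof (rule integral_norm_bound_integral[OF fuv])
        show "(\<lambda>x. h n x + n) integrable_on {u..v}"
          using hK[OF K] uv(1) by (intro integrable_add) auto
      qed (auto simp: h_def)
      also have "\<dots> = integral K (h n) + n * (Sup K - Inf K)"
        using hK[OF K] uv by (subst Henstock_Kurzweil_Integration.integral_add) (auto simp: mult.commute)
      finally show ?thesis .
    qed
    have "(\<Sum>K\<in>\<D>. cmod (integral {a..Sup K} f - integral {a..Inf K} f)) \<le> (\<Sum>K\<in>\<D>. integral K (h n) + n * (Sup K - Inf K))"
      by (rule sum_mono) (rule le)
    also have "\<dots> = (\<Sum>K\<in>\<D>. integral K (h n)) + n * (\<Sum>K\<in>\<D>. Sup K - Inf K)"
      by (simp add: sum.distrib sum_distrib_left)
    also have "(\<Sum>K\<in>\<D>. integral K (h n)) = integral (\<Union>\<D>) (h n)"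
      using integral_combine_division_bottomup[OF div] hK by metis
    also have "\<dots> \<le> integral {a..b} (h n)"
    proof (rule integral_subset_le[OF sub _ hI(1)])
      show "h n integrable_on \<Union>\<D>" using div hK by (rule integrable_combine_division)
    qed (auto simp: h_def)
    also have "integral {a..b} (h n) + n * (\<Sum>K\<in>\<D>. Sup K - Inf K) \<le> integral {a..b} (h n) + n * \<delta>"
      using len by (intro add_left_mono mult_left_mono) auto
    also have "\<dots> < e / 2 + e / 2"
    proof (rule add_less_le_mono[OF hI(2)])
      have "real n * e \<le> (real n + 1) * e" using \<open>e > 0\<close> by simp
      then show "real n * \<delta> \<le> e / 2" by (simp add: \<delta>_def field_simps)
    qed
    finally show "(\<Sum>K\<in>\<D>. cmod (integral {a..Sup K} f - integral {a..Inf K} f)) < e" by simp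
  qed
qed

lemma AE_half_line_iff: "(AE x in half_line. Q x) \<longleftrightarrow> negligible {x. 0 < x \<and> \<not> Q x}"
proof -
  have "(AE x in half_line. Q x) \<longleftrightarrow> (AE x in lebesgue. x \<in> {0<..} \<longrightarrow> Q x)"
    by (subst AE_restrict_space_iff) auto
  also have "\<dots> \<longleftrightarrow> negligible {x. 0 < x \<and> \<not> Q x}"
    by (simp add: AE_iff_null_sets negligible_iff_null_sets completion.AE_iff_null_sets)
  finally show ?thesis .
qed

text \<open>The common source of the closure properties below: sums, products, conjugates and Lipschitz
  functions all satisfy such an estimate.\<close>

lemma absolutely_continuous_on_bound:
  assumes G: "absolutely_continuous_on a b G" and H: "absolutely_continuous_on a b H"
    and le: "\<And>u v. u \<in> {a..b} \<Longrightarrow> v \<in> {a..b} \<Longrightarrow> u \<le> v \<Longrightarrow>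
      cmod (F v - F u) \<le> C * cmod (G v - G u) + C * cmod (H v - H u) + C * (v - u)"
  shows "absolutely_continuous_on a b F"
  unfolding absolutely_continuous_on_def
proof (intro allI impI)
  fix e :: real assume "e > 0"
  define C' where "C' = \<bar>C\<bar> + 1"
  have C': "C' > 0" "C \<le> C'" by (auto simp: C'_def)
  have e': "e / (3 * C') > 0" using \<open>e > 0\<close> C' by simp
  obtain \<delta>1 where \<delta>1: "\<delta>1 > 0" "\<And>\<D>. \<D> division_of \<Union>\<D> \<Longrightarrow> \<Union>\<D> \<subseteq> {a..b} \<Longrightarrow>
      (\<Sum>K\<in>\<D>. Sup K - Inf K) < \<delta>1 \<Longrightarrow> (\<Sum>K\<in>\<D>. cmod (G (Sup K) - G (Inf K))) < e / (3 * C')"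
    using G[unfolded absolutely_continuous_on_def, rule_format, OF e'] by auto
  obtain \<delta>2 where \<delta>2: "\<delta>2 > 0" "\<And>\<D>. \<D> division_of \<Union>\<D> \<Longrightarrow> \<Union>\<D> \<subseteq> {a..b} \<Longrightarrow>
      (\<Sum>K\<in>\<D>. Sup K - Inf K) < \<delta>2 \<Longrightarrow> (\<Sum>K\<in>\<D>. cmod (H (Sup K) - H (Inf K))) < e / (3 * C')"
    using H[unfolded absolutely_continuous_on_def, rule_format, OF e'] by auto
  define \<delta> where "\<delta> = min (min \<delta>1 \<delta>2) (e / (3 * C'))"
  have "\<delta> > 0" using \<delta>1 \<delta>2 e' by (simp add: \<delta>_def)
  then show "\<exists>\<delta>>0. \<forall>\<D>. \<D> division_of \<Union>\<D> \<and> \<Union>\<D> \<subseteq> {a..b} \<and> (\<Sum>K\<in>\<D>. Sup K - Inf K) < \<delta> \<longrightarrow>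
      (\<Sum>K\<in>\<D>. cmod (F (Sup K) - F (Inf K))) < e"
  proof (intro exI[of _ \<delta>] conjI allI impI, simp, elim conjE)
    fix \<D> assume D: "\<D> division_of \<Union>\<D>" "\<Union>\<D> \<subseteq> {a..b}" and len: "(\<Sum>K\<in>\<D>. Sup K - Inf K) < \<delta>"
    let ?g = "\<lambda>K. cmod (G (Sup K) - G (Inf K))" and ?h = "\<lambda>K. cmod (H (Sup K) - H (Inf K))"
      and ?l = "\<lambda>K. Sup K - Inf K :: real"
    have "(\<Sum>K\<in>\<D>. cmod (F (Sup K) - F (Inf K))) \<le> (\<Sum>K\<in>\<D>. C' * ?g K + C' * ?h K + C' * ?l K)"
    proof (rule sum_mono)
      fix K assume K: "K \<in> \<D>"
      then obtain u v where uv: "K = {u..v}" "u \<le> v" "{u..v} \<subseteq> {a..b}"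
        using division_ofD(2,3,4)[OF D(1) K] D(2) by (metis Union_upper atLeastatMost_empty_iff box_real(2) order_trans)
      have "cmod (F v - F u) \<le> C * cmod (G v - G u) + C * cmod (H v - H u) + C * (v - u)"
        using uv by (intro le) auto
      also have "\<dots> \<le> C' * cmod (G v - G u) + C' * cmod (H v - H u) + C' * (v - u)"
        using uv(2) C' by (intro add_mono mult_right_mono) auto
      finally show "cmod (F (Sup K) - F (Inf K)) \<le> C' * ?g K + C' * ?h K + C' * ?l K"
        using uv by simp
    qed
    also have "\<dots> = C' * (\<Sum>K\<in>\<D>. ?g K) + C' * (\<Sum>K\<in>\<D>. ?h K) + C' * (\<Sum>K\<in>\<D>. ?l K)"
      by (simp add: sum.distrib sum_distrib_left)
    also have "\<dots> < C' * (e / (3 * C')) + C' * (e / (3 * C')) + C' * (e / (3 * C'))"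
      using \<delta>1(2)[OF D] \<delta>2(2)[OF D] len C' by (intro add_strict_mono mult_strict_left_mono) (auto simp: \<delta>_def)
    also have "\<dots> = e" using C' by (simp add: field_simps)
    finally show "(\<Sum>K\<in>\<D>. cmod (F (Sup K) - F (Inf K))) < e" .
  qed
qed

lemma absolutely_continuous_on_const: "absolutely_continuous_on a b (\<lambda>x. c)"
  unfolding absolutely_continuous_on_def by (auto intro: exI[of _ 1])

lemma absolutely_continuous_on_cong:
  assumes "\<And>x. x \<in> {a..b} \<Longrightarrow> F x = G x" and G: "absolutely_continuous_on a b G"
  shows "absolutely_continuous_on a b F"
  by (rule absolutely_continuous_on_bound[OF G absolutely_continuous_on_const[of a b 0], of _ 1]) (simp add: assms(1))

lemma absolutely_continuous_on_lipschitz: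
  assumes "\<And>u v. u \<in> {a..b} \<Longrightarrow> v \<in> {a..b} \<Longrightarrow> u \<le> v \<Longrightarrow> cmod (F v - F u) \<le> C * (v - u)"
  shows "absolutely_continuous_on a b F"
  by (rule absolutely_continuous_on_bound[OF absolutely_continuous_on_const[of a b 0] absolutely_continuous_on_const[of a b 0], of _ C])
     (simp add: assms)

lemma absolutely_continuous_on_add:
  assumes "absolutely_continuous_on a b F" "absolutely_continuous_on a b G"
  shows "absolutely_continuous_on a b (\<lambda>x. F x + G x)"
proof (rule absolutely_continuous_on_bound[OF assms, of _ 1])
  fix u v :: real assume "u \<le> v"
  have "cmod (F v + G v - (F u + G u)) \<le> cmod (F v - F u) + cmod (G v - G u)"
    using norm_triangle_ineq[of "F v - F u" "G v - G u"] by (simp add: algebra_simps)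
  then show "cmod (F v + G v - (F u + G u)) \<le> 1 * cmod (F v - F u) + 1 * cmod (G v - G u) + 1 * (v - u)"
    using \<open>u \<le> v\<close> by simp
qed

lemma absolutely_continuous_on_cnj:
  assumes "absolutely_continuous_on a b F"
  shows "absolutely_continuous_on a b (\<lambda>x. cnj (F x))"
proof (rule absolutely_continuous_on_bound[OF assms assms, of _ 1])
  fix u v :: real assume "u \<le> v"
  have "cmod (cnj (F v) - cnj (F u)) = cmod (F v - F u)" by (simp flip: complex_cnj_diff)
  then show "cmod (cnj (F v) - cnj (F u)) \<le> 1 * cmod (F v - F u) + 1 * cmod (F v - F u) + 1 * (v - u)"
    using \<open>u \<le> v\<close> by simp
qed

lemma absolutely_continuous_on_imp_continuous:
  assumes "absolutely_continuous_on a b F"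
  shows "continuous_on {a..b} F"
  unfolding continuous_on_iff
proof (intro ballI allI impI)
  fix x e :: real assume x: "x \<in> {a..b}" and "e > 0"
  then obtain \<delta> where \<delta>: "\<delta> > 0" "\<And>\<D>. \<D> division_of \<Union>\<D> \<Longrightarrow> \<Union>\<D> \<subseteq> {a..b} \<Longrightarrow>
      (\<Sum>K\<in>\<D>. Sup K - Inf K) < \<delta> \<Longrightarrow> (\<Sum>K\<in>\<D>. cmod (F (Sup K) - F (Inf K))) < e"
    using assms[unfolded absolutely_continuous_on_def, rule_format, of e] by auto
  show "\<exists>d>0. \<forall>y\<in>{a..b}. dist y x < d \<longrightarrow> dist (F y) (F x) < e"
  proof (intro exI[of _ \<delta>] conjI \<delta>(1) ballI impI)
    fix y assume y: "y \<in> {a..b}" "dist y x < \<delta>"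
    have "(\<Sum>K\<in>{{min x y..max x y}}. cmod (F (Sup K) - F (Inf K))) < e"
    proof (rule \<delta>(2))
      show "{{min x y..max x y}} division_of \<Union>{{min x y..max x y}}"
        using division_of_self[of "min x y" "max x y"] by simp
    qed (use x y in \<open>auto simp: dist_real_def min_def max_def split: if_splits\<close>)
    then show "dist (F y) (F x) < e"
      by (auto simp: dist_norm min_def max_def norm_minus_commute split: if_splits)
  qed
qed

lemma absolutely_continuous_on_mult:
  assumes F: "absolutely_continuous_on a b F" and G: "absolutely_continuous_on a b G"
  shows "absolutely_continuous_on a b (\<lambda>x. F x * G x)"
proof -
  have "bounded (F ` {a..b})" "bounded (G ` {a..b})"
    using assms by (auto intro!: compact_imp_bounded compact_continuous_image absolutely_continuous_on_imp_continuous)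
  then obtain B1 B2 where B: "\<And>x. x \<in> {a..b} \<Longrightarrow> cmod (F x) \<le> B1" "\<And>x. x \<in> {a..b} \<Longrightarrow> cmod (G x) \<le> B2"
    unfolding bounded_iff by (meson imageI)
  define C where "C = max 0 (max B1 B2)"
  have C: "C \<ge> 0" "\<And>x. x \<in> {a..b} \<Longrightarrow> cmod (F x) \<le> C" "\<And>x. x \<in> {a..b} \<Longrightarrow> cmod (G x) \<le> C"
    using B by (fastforce simp: C_def)+
  show ?thesis
  proof (rule absolutely_continuous_on_bound[OF assms, of _ C])
    fix u v :: real assume u: "u \<in> {a..b}" and v: "v \<in> {a..b}" and "u \<le> v"
    have "F v * G v - F u * G u = G v * (F v - F u) + F u * (G v - G u)" by (simp add: algebra_simps)
    then have "cmod (F v * G v - F u * G u) \<le> cmod (G v) * cmod (F v - F u) + cmod (F u) * cmod (G v - G u)"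
      by (metis norm_mult norm_triangle_ineq)
    also have "\<dots> \<le> C * cmod (F v - F u) + C * cmod (G v - G u)"
      using C u v by (intro add_mono mult_right_mono) auto
    finally show "cmod (F v * G v - F u * G u) \<le> C * cmod (F v - F u) + C * cmod (G v - G u) + C * (v - u)"
      using \<open>u \<le> v\<close> C(1) by (smt (verit) mult_nonneg_nonneg)
  qed
qed

definition locally_integrable :: "(real \<Rightarrow> complex) \<Rightarrow> bool"
  where "locally_integrable p \<longleftrightarrow> (\<forall>a b. 0 < a \<longrightarrow> p absolutely_integrable_on {a..b})"

text \<open>The pair is kept as a relation, with \<open>p\<close> determined only up to null sets, so that sum and product rules can
be stated for \<open>\<tau> f\<close> and other functions that exist only almost everywhere.\<close>

definition ac_derivative :: "(real \<Rightarrow> complex) \<Rightarrow> (real \<Rightarrow> complex) \<Rightarrow> bool"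
  where "ac_derivative P p \<longleftrightarrow> locally_absolutely_continuous P \<and>
    (AE x in half_line. (P has_vector_derivative p x) (at x))"

lemma ac_derivative_cong:
  assumes "ac_derivative P p" "\<And>x. 0 < x \<Longrightarrow> P x = Q x" "AE x in half_line. p x = q x"
  shows "ac_derivative Q q"
  unfolding ac_derivative_def
proof
  show "locally_absolutely_continuous Q"
    unfolding locally_absolutely_continuous_def
  proof (intro allI impI)
    fix a b :: real assume ab: "0 < a \<and> a \<le> b"
    then have "absolutely_continuous_on a b P"
      using assms(1) by (auto simp: ac_derivative_def locally_absolutely_continuous_def)
    then show "absolutely_continuous_on a b Q"
      by (rule absolutely_continuous_on_cong[rotated]) (use assms(2) ab in auto)
  qed
  have "AE x in half_line. (P has_vector_derivative p x) (at x)"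
    using assms(1) by (simp add: ac_derivative_def)
  moreover have "AE x in half_line. 0 < x" by (simp add: AE_half_line_iff)
  ultimately show "AE x in half_line. (Q has_vector_derivative q x) (at x)"
    using assms(3)
  proof eventually_elim
    case (elim x)
    from elim(1) have "(Q has_vector_derivative p x) (at x)"
      by (rule has_vector_derivative_transform_within_open[of _ _ _ "{0<..}"]) (use elim assms(2) in auto)
    then show ?case using elim by simp
  qed
qed

lemma locally_absolutely_continuous_continuous:
  assumes "locally_absolutely_continuous P" shows "continuous_on {0<..} P"
proof -
  have "continuous (at x) P" if "0 < x" for x
  proof -
    have "continuous_on {x/2..x+1} P"
      using assms that unfolding locally_absolutely_continuous_def
      by (intro absolutely_continuous_on_imp_continuous) auto
    then show ?thesis using that
      by (intro continuous_on_interior[of "{x/2..x+1}"]) auto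
  qed
  then show ?thesis by (simp add: continuous_at_imp_continuous_on)
qed

lemma ac_derivative_continuous:
  "ac_derivative P p \<Longrightarrow> continuous_on {0<..} P"
  by (simp add: ac_derivative_def locally_absolutely_continuous_continuous)

lemma ac_derivative_add:
  assumes "ac_derivative P p" "ac_derivative Q q"
  shows "ac_derivative (\<lambda>x. P x + Q x) (\<lambda>x. p x + q x)"
  unfolding ac_derivative_def
proof
  show "locally_absolutely_continuous (\<lambda>x. P x + Q x)"
    using assms by (auto simp: ac_derivative_def locally_absolutely_continuous_def absolutely_continuous_on_add)
  have "AE x in half_line. (P has_vector_derivative p x) (at x)" "AE x in half_line. (Q has_vector_derivative q x) (at x)"
    using assms by (auto simp: ac_derivative_def)
  then show "AE x in half_line. ((\<lambda>x. P x + Q x) has_vector_derivative p x + q x) (at x)"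
    by eventually_elim (rule has_vector_derivative_add)
qed

lemma ac_derivative_mult:
  assumes "ac_derivative P p" "ac_derivative Q q"
  shows "ac_derivative (\<lambda>x. P x * Q x) (\<lambda>x. P x * q x + p x * Q x)"
  unfolding ac_derivative_def
proof
  show "locally_absolutely_continuous (\<lambda>x. P x * Q x)"
    using assms by (auto simp: ac_derivative_def locally_absolutely_continuous_def absolutely_continuous_on_mult)
  have "AE x in half_line. (P has_vector_derivative p x) (at x)" "AE x in half_line. (Q has_vector_derivative q x) (at x)"
    using assms by (auto simp: ac_derivative_def)
  then show "AE x in half_line. ((\<lambda>x. P x * Q x) has_vector_derivative P x * q x + p x * Q x) (at x)"
    by eventually_elim (rule has_vector_derivative_mult)
qed

lemma ac_derivative_cnj:
  assumes "ac_derivative P p"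
  shows "ac_derivative (\<lambda>x. cnj (P x)) (\<lambda>x. cnj (p x))"
  unfolding ac_derivative_def
proof
  show "locally_absolutely_continuous (\<lambda>x. cnj (P x))"
    using assms by (auto simp: ac_derivative_def locally_absolutely_continuous_def absolutely_continuous_on_cnj)
  have "AE x in half_line. (P has_vector_derivative p x) (at x)"
    using assms by (auto simp: ac_derivative_def)
  then show "AE x in half_line. ((\<lambda>x. cnj (P x)) has_vector_derivative cnj (p x)) (at x)"
    by eventually_elim (rule has_vector_derivative_cnj)
qed

lemma ac_derivative_C1:
  assumes der: "\<And>x. 0 < x \<Longrightarrow> (P has_vector_derivative p x) (at x)" and cont: "continuous_on {0<..} p"
  shows "ac_derivative P p"
  unfolding ac_derivative_def
proof
  show "AE x in half_line. (P has_vector_derivative p x) (at x)"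
    by (rule AE_I2) (simp add: der)
  show "locally_absolutely_continuous P"
    unfolding locally_absolutely_continuous_def
  proof (intro allI impI, elim conjE)
    fix a b :: real assume ab: "0 < a" "a \<le> b"
    have "bounded (p ` {a..b})"
      using ab by (intro compact_imp_bounded compact_continuous_image continuous_on_subset[OF cont]) auto
    then obtain C where C: "\<And>x. x \<in> {a..b} \<Longrightarrow> cmod (p x) \<le> C"
      unfolding bounded_iff by (meson imageI)
    show "absolutely_continuous_on a b P"
    proof (rule absolutely_continuous_on_lipschitz[of _ _ _ C])
      fix u v assume u: "u \<in> {a..b}" and v: "v \<in> {a..b}" and "u \<le> v"
      have "norm (P v - P u) \<le> C * norm (v - u)"
      proof (rule differentiable_bound[of "{a..b}" P "\<lambda>x h. h *\<^sub>R p x"])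
        fix x assume x: "x \<in> {a..b}"
        show "(P has_derivative (\<lambda>h. h *\<^sub>R p x)) (at x within {a..b})"
          using der[of x] x ab by (auto simp: has_vector_derivative_def intro: has_derivative_at_withinI)
        show "onorm (\<lambda>h. h *\<^sub>R p x) \<le> C"
        proof (rule onorm_bound)
          show "0 \<le> C" using C[OF x] norm_ge_zero[of "p x"] by linarith
          fix h :: real
          show "norm (h *\<^sub>R p x) \<le> C * norm h"
            using mult_right_mono[OF C[OF x] abs_ge_zero[of h]] by (simp add: mult.commute)
        qed
      qed (use u v in auto)
      then show "cmod (P v - P u) \<le> C * (v - u)" using \<open>u \<le> v\<close> by simp
    qed
  qed
qed

lemma ac_derivative_ftc:
  assumes "ac_derivative P p" "0 < a" "a \<le> b"
  shows "(p has_integral P b - P a) {a..b}"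
proof (rule ftc_absolutely_continuous[OF assms(3)])
  show "absolutely_continuous_on a b P"
    using assms by (auto simp: ac_derivative_def locally_absolutely_continuous_def)
  show "negligible {x. 0 < x \<and> \<not> (P has_vector_derivative p x) (at x)}"
    using assms(1) unfolding ac_derivative_def AE_half_line_iff by blast
  show "(P has_vector_derivative p x) (at x within {a..b})"
    if "x \<in> {a..b} - {x. 0 < x \<and> \<not> (P has_vector_derivative p x) (at x)}" for x
    using that \<open>0 < a\<close> by (auto intro: has_vector_derivative_at_within)
qed

text \<open>Absolute continuity and the derivative almost everywhere of an indefinite integral, glued from the
compact intervals \<open>[1/(n+1), n]\<close>.\<close>

lemma ac_derivative_integral:
  assumes p: "locally_integrable p"
    and P: "\<And>a b. 0 < a \<Longrightarrow> a \<le> b \<Longrightarrow> P b - P a = integral {a..b} p"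
  shows "ac_derivative P p"
  unfolding ac_derivative_def
proof
  show "locally_absolutely_continuous P"
    unfolding locally_absolutely_continuous_def
  proof (intro allI impI, elim conjE)
    fix a b :: real assume ab: "0 < a" "a \<le> b"
    have "absolutely_continuous_on a b (\<lambda>x. P a + integral {a..x} p)"
      using p ab unfolding locally_integrable_def
      by (intro absolutely_continuous_on_add absolutely_continuous_on_const absolutely_continuous_indefinite_integral) auto
    moreover have "P a + integral {a..x} p = P x" if "x \<in> {a..b}" for x
      using P[of a x] ab that by (auto simp: algebra_simps)
    ultimately show "absolutely_continuous_on a b P"
      by (intro absolutely_continuous_on_cong[of a b P "\<lambda>x. P a + integral {a..x} p"]) auto
  qed
  define B where "B n = {x \<in> {1 / Suc n<..<real n}. \<not> ((\<lambda>x. integral {1 / Suc n..x} p) has_vector_derivative p x) (at x)}" for n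
  have "negligible (B n)" for n
    unfolding B_def using p
    by (intro lebesgue_differentiation) (auto simp: locally_integrable_def absolutely_integrable_on_def)
  then have "negligible (\<Union>n. B n)" by (intro negligible_countable_Union) auto
  moreover have "{x. 0 < x \<and> \<not> (P has_vector_derivative p x) (at x)} \<subseteq> (\<Union>n. B n)"
  proof clarify
    fix x assume x: "0 < x" "\<not> (P has_vector_derivative p x) (at x)"
    obtain n1 where n1: "1 / Suc n1 < x" using x(1) nat_approx_posE by blast
    obtain n2 where n2: "x < real n2" using reals_Archimedean2 by blast
    define n where "n = max n1 n2"
    have "1 / Suc n \<le> 1 / Suc n1" by (simp add: n_def frac_le)
    then have xn: "x \<in> {1 / Suc n<..<real n}" using n1 n2 by (auto simp: n_def)
    have "\<not> ((\<lambda>x. integral {1 / Suc n..x} p) has_vector_derivative p x) (at x)"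
    proof
      let ?a = "1 / real (Suc n)"
      assume "((\<lambda>x. integral {?a..x} p) has_vector_derivative p x) (at x)"
      then have "((\<lambda>x. P ?a + integral {?a..x} p) has_vector_derivative 0 + p x) (at x)"
        by (intro has_vector_derivative_add has_vector_derivative_const)
      then have "(P has_vector_derivative 0 + p x) (at x)"
      proof (rule has_vector_derivative_transform_within_open[of _ _ _ "{?a<..<real n}"])
        show "P ?a + integral {?a..y} p = P y" if "y \<in> {?a<..<real n}" for y
          using P[of ?a y] that by (auto simp: algebra_simps)
      qed (use xn in auto)
      with x(2) show False by simp
    qed
    with xn show "x \<in> (\<Union>n. B n)" unfolding B_def by blast
  qed
  ultimately show "AE x in half_line. (P has_vector_derivative p x) (at x)"
    unfolding AE_half_line_iff by (rule negligible_subset)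
qed

lemma ac_primitive_exists:
  assumes p: "locally_integrable p" and "0 < r"
  obtains P where "ac_derivative P p" "P r = c"
proof -
  define P0 where "P0 x = (if 1 \<le> x then integral {1..x} p else - integral {x..1} p)" for x
  have int: "p integrable_on {a..b}" if "0 < a" for a b
    using p that by (simp add: locally_integrable_def absolutely_integrable_on_def)
  have comb: "integral {a..b} p + integral {b..d} p = integral {a..d} p" if "0 < a" "a \<le> b" "b \<le> d" for a b d
    using that int by (intro Henstock_Kurzweil_Integration.integral_combine) auto
  have P0: "P0 b - P0 a = integral {a..b} p" if "0 < a" "a \<le> b" for a b
    using comb[of 1 a b] comb[of a 1 b] comb[of a b 1] that unfolding P0_def by (auto simp: algebra_simps)
  have "ac_derivative (\<lambda>x. P0 x + (c - P0 r)) p"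
    by (rule ac_derivative_integral[OF p]) (simp add: P0)
  then show ?thesis by (rule that) simp
qed

section \<open>Square-integrable functions, limits at the endpoints and regular functions\<close>

lemma absolutely_integrable_half_line_iff:
  fixes f :: "real \<Rightarrow> complex"
  shows "f absolutely_integrable_on {0<..} \<longleftrightarrow> integrable half_line f"
  unfolding set_integrable_def by (subst integrable_restrict_space) auto

lemma integral_half_line:
  fixes f :: "real \<Rightarrow> complex"
  assumes "integrable half_line f"
  shows "(LINT x|half_line. f x) = integral {0<..} f"
  using assms by (simp add: lebesgue_integral_eq_integral)

lemma square_integrable_restrict:
  assumes F: "square_integrable F" and A: "A \<in> sets lebesgue"
  shows "square_integrable (\<lambda>x. if x \<in> A then F x else 0)"
proof -
  have m: "(\<lambda>x. if x \<in> A then F x else 0) \<in> borel_measurable half_line"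
  proof (rule measurable_If)
    show "F \<in> borel_measurable half_line" using F by (rule square_integrableD)
    have "{x \<in> space half_line. x \<in> A} = {0<..} \<inter> A" by auto
    then show "{x \<in> space half_line. x \<in> A} \<in> sets half_line"
      using A by (auto simp: sets_restrict_space)
  qed simp
  have "integrable half_line (\<lambda>x. (cmod (if x \<in> A then F x else 0))\<^sup>2)"
  proof (rule Bochner_Integration.integrable_bound[OF square_integrableD(2)[OF F]])
    show "(\<lambda>x. (cmod (if x \<in> A then F x else 0))\<^sup>2) \<in> borel_measurable half_line"
      by (intro borel_measurable_power measurable_compose[OF m borel_measurable_norm])
  qed auto
  with m show ?thesis by (simp add: square_integrable_def)
qed

lemma square_integrable_cong:
  assumes "square_integrable F" "AE x in half_line. F x = G x"
  shows "square_integrable G"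
proof -
  have m: "G \<in> borel_measurable half_line"
  proof -
    have N: "negligible {x. 0 < x \<and> F x \<noteq> G x}" using assms(2) by (simp add: AE_half_line_iff)
    have "F measurable_on {0<..}"
      using square_integrableD(1)[OF assms(1)] by (simp add: measurable_on_iff_borel_measurable)
    then have "G measurable_on {0<..}" by (rule measurable_on_spike[OF _ N]) auto
    then show ?thesis by (simp add: measurable_on_iff_borel_measurable)
  qed
  have "integrable half_line (\<lambda>x. (cmod (F x))\<^sup>2) \<longleftrightarrow> integrable half_line (\<lambda>x. (cmod (G x))\<^sup>2)"
  proof (rule integrable_cong_AE)
    show "AE x in half_line. (cmod (F x))\<^sup>2 = (cmod (G x))\<^sup>2"
      using assms(2) by eventually_elim simp
  qed (intro borel_measurable_power measurable_compose[OF m borel_measurable_norm]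
        measurable_compose[OF square_integrableD(1)[OF assms(1)] borel_measurable_norm])+
  with m assms(1) show ?thesis by (simp add: square_integrable_def)
qed

lemma square_integrable_bounded_support:
  assumes m: "F \<in> borel_measurable half_line" and b: "\<And>x. 0 < x \<Longrightarrow> cmod (F x) \<le> B"
    and z: "\<And>x. r < x \<Longrightarrow> F x = 0"
  shows "square_integrable F"
proof -
  have "integrable lebesgue (\<lambda>x. indicator {0<..r} x *\<^sub>R (B\<^sup>2))"
    by (cases "0 \<le> r") (auto intro!: integrable_scaleR_left integrable_real_indicator)
  then have "integrable lebesgue (\<lambda>x. indicator {0<..} x *\<^sub>R (indicator {0<..r} x * B\<^sup>2))"
    by (rule Bochner_Integration.integrable_cong[THEN iffD1, rotated -1]) (auto simp: indicator_def)
  then have "integrable half_line (\<lambda>x. indicator {0<..r} x * B\<^sup>2 :: real)"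
    by (subst integrable_restrict_space) auto
  then have "integrable half_line (\<lambda>x. (cmod (F x))\<^sup>2)"
  proof (rule Bochner_Integration.integrable_bound)
    show "(\<lambda>x. (cmod (F x))\<^sup>2) \<in> borel_measurable half_line"
      by (intro borel_measurable_power measurable_compose[OF m borel_measurable_norm])
    have "norm ((cmod (F x))\<^sup>2) \<le> norm (indicator {0<..r} x * B\<^sup>2 :: real)" if "0 < x" for x
    proof (cases "x \<le> r")
      case True
      have "(cmod (F x))\<^sup>2 \<le> B\<^sup>2" using b[OF that] by (intro power_mono) auto
      then show ?thesis using True that by simp
    qed (use z[of x] in simp)
    then show "AE x in half_line. norm ((cmod (F x))\<^sup>2) \<le> norm (indicator {0<..r} x * B\<^sup>2 :: real)"
      by (intro AE_I2) simp
  qed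
  with m show ?thesis by (simp add: square_integrable_def)
qed

lemma half_line_integrable_imp_local:
  assumes "integrable half_line f" shows "locally_integrable f"
  unfolding locally_integrable_def
proof (intro allI impI)
  fix a b :: real assume "0 < a"
  then show "f absolutely_integrable_on {a..b}"
    using assms unfolding absolutely_integrable_half_line_iff[symmetric]
    by (intro absolutely_integrable_on_subinterval[of "{0<..}" f]) auto
qed

lemma locally_integrable_mult_continuous:
  assumes k: "locally_integrable k" and w: "continuous_on {0<..} w"
  shows "locally_integrable (\<lambda>x. k x * w x)"
  unfolding locally_integrable_def
proof (intro allI impI)
  fix a b :: real assume "0 < a"
  then have w': "continuous_on {a..b} w" by (intro continuous_on_subset[OF w]) auto
  have "(\<lambda>x. w x * k x) absolutely_integrable_on {a..b}"
  proof (rule absolutely_integrable_bounded_measurable_product[OF bilinear_times])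
    show "w \<in> borel_measurable (lebesgue_on {a..b})"
      by (intro continuous_imp_measurable_on_sets_lebesgue w') auto
    show "bounded (w ` {a..b})" by (intro compact_imp_bounded compact_continuous_image w') auto
    show "k absolutely_integrable_on {a..b}" using k \<open>0 < a\<close> by (simp add: locally_integrable_def)
  qed auto
  then show "(\<lambda>x. k x * w x) absolutely_integrable_on {a..b}" by (simp add: mult.commute)
qed

lemma square_integrable_imp_local:
  assumes F: "square_integrable F" shows "locally_integrable F"
  unfolding locally_integrable_def
proof (intro allI impI)
  fix a b :: real assume "0 < a"
  have ind: "square_integrable (indicator {a..b} :: real \<Rightarrow> complex)"
  proof (rule square_integrable_bounded_support[of _ 1 b])
    have "(indicator ({0<..} \<inter> {a..b}) :: real \<Rightarrow> complex) \<in> borel_measurable half_line"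
      by (intro borel_measurable_indicator) (auto simp: sets_restrict_space)
    moreover have "{0<..} \<inter> {a..b} = {a..b}" using \<open>0 < a\<close> by auto
    ultimately show "(indicator {a..b} :: real \<Rightarrow> complex) \<in> borel_measurable half_line" by simp
  qed (auto simp: indicator_def)
  have "integrable half_line (\<lambda>x. F x * cnj (indicator {a..b} x))"
    by (rule square_integrable_mult_cnj[OF F ind])
  then have "(\<lambda>x. F x * cnj (indicator {a..b} x)) absolutely_integrable_on {a..b}"
    using half_line_integrable_imp_local \<open>0 < a\<close> by (auto simp: locally_integrable_def)
  then show "F absolutely_integrable_on {a..b}"
    by (rule set_integrable_cong[THEN iffD1, rotated -1]) (auto simp: indicator_def)
qed

lemma square_integrable_norm_mult:
  assumes "square_integrable F" "square_integrable G"
  shows "integrable half_line (\<lambda>x. F x * G x)"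
proof -
  have "square_integrable (\<lambda>x. cnj (G x))"
    using square_integrableD[OF assms(2)]
    by (auto simp: square_integrable_def intro!: measurable_compose[OF _ borel_measurable_continuous_onI[OF continuous_on_cnj[OF continuous_on_id]]])
  from square_integrable_mult_cnj[OF assms(1) this] show ?thesis by simp
qed

lemma ac_derivative_limits:
  assumes P: "ac_derivative P p" and p: "integrable half_line p"
  obtains l0 l1 where "(P \<longlongrightarrow> l0) (at_right 0)" "(P \<longlongrightarrow> l1) at_top" "(LINT x|half_line. p x) = l1 - l0"
proof -
  have pint: "p absolutely_integrable_on {0<..}" using p by (simp add: absolutely_integrable_half_line_iff)
  have p1: "p absolutely_integrable_on {0<..1}" and p2: "p absolutely_integrable_on {1..}"
    using pint by (auto intro: set_integrable_subset)
  have p01: "p integrable_on {0..1}"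
    by (rule integrable_spike_set[of p "{0<..1}"])
       (use p1 in \<open>auto simp: absolutely_integrable_on_def intro: negligible_subset[of "{0}"]\<close>)
  have ftc: "integral {a..b} p = P b - P a" if "0 < a" "a \<le> b" for a b
    using ac_derivative_ftc[OF P that] by (rule integral_unique)
  have A: "(P \<longlongrightarrow> P 1 - integral {0..1} p) (at_right 0)"
  proof -
    have "continuous_on {0..1} (\<lambda>x. P 1 - integral {x..1} p)"
      by (intro continuous_intros indefinite_integral_continuous_1' p01)
    then have "((\<lambda>x. P 1 - integral {x..1} p) \<longlongrightarrow> P 1 - integral {0..1} p) (at 0 within {0..1})"
      by (auto simp: continuous_on_def)
    then have "((\<lambda>x. P 1 - integral {x..1} p) \<longlongrightarrow> P 1 - integral {0..1} p) (at_right 0)"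
      by (simp add: at_within_Icc_at_right)
    moreover have "eventually (\<lambda>x. P 1 - integral {x..1} p = P x) (at_right 0)"
      using eventually_at_right_real[of 0 "1::real"]  by (auto elim!: eventually_mono simp: ftc)
    ultimately show ?thesis by (rule Lim_transform_eventually)
  qed
  have B: "(P \<longlongrightarrow> P 1 + integral {1..} p) at_top"
  proof -
    have "((\<lambda>b. LINT x:{1..b}|lebesgue. p x) \<longlongrightarrow> (LINT x:{1..}|lebesgue. p x)) at_top"
      by (rule tendsto_set_lebesgue_integral_at_top[OF _ p2]) auto
    then have "((\<lambda>b. P 1 + (LINT x:{1..b}|lebesgue. p x)) \<longlongrightarrow> P 1 + integral {1..} p) at_top"
      using set_lebesgue_integral_eq_integral(2)[OF p2] by (auto intro!: tendsto_intros)
    moreover have "eventually (\<lambda>b. P 1 + (LINT x:{1..b}|lebesgue. p x) = P b) at_top"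
      using eventually_ge_at_top[of 1]
    proof eventually_elim
      case (elim b)
      have "p absolutely_integrable_on {1..b}" using p2 by (rule set_integrable_subset) auto
      from set_lebesgue_integral_eq_integral(2)[OF this] show ?case using ftc[of 1 b] elim by simp
    qed
    ultimately show ?thesis by (rule Lim_transform_eventually)
  qed
  have "(LINT x|half_line. p x) = integral {0<..} p" by (rule integral_half_line[OF p])
  also have "integral {0<..} p = integral ({0<..1} \<union> {1..}) p" by (rule arg_cong[of _ _ "\<lambda>S. integral S p"]) auto
  also have "\<dots> = integral {0<..1} p + integral {1..} p"
    using p1 p2 by (intro Henstock_Kurzweil_Integration.integral_Un) (auto simp: absolutely_integrable_on_def intro: negligible_subset[of "{1}"])
  also have "integral {0<..1} p = integral {0..1} p"
    by (rule integral_spike_set) (auto intro: negligible_subset[of "{0}"])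
  finally have "(LINT x|half_line. p x) = (P 1 + integral {1..} p) - (P 1 - integral {0..1} p)" by simp
  with A B show ?thesis by (rule that)
qed

text \<open>Used for coefficients whose derivative is integrable near \<open>0\<close> but perhaps not near infinity.\<close>

lemma ac_derivative_limit_at_0:
  assumes P: "ac_derivative P p" and p: "integrable half_line (\<lambda>x. if x \<le> 1 then p x else 0)"
  obtains l where "(P \<longlongrightarrow> l) (at_right 0)"
proof -
  have loc: "locally_integrable (\<lambda>x. if x \<le> 1 then p x else 0)" by (rule half_line_integrable_imp_local[OF p])
  obtain Q where Q: "ac_derivative Q (\<lambda>x. if x \<le> 1 then p x else 0)" "Q 1 = P 1"
    by (rule ac_primitive_exists[OF loc zero_less_one])
  obtain l where l: "(Q \<longlongrightarrow> l) (at_right 0)" by (rule ac_derivative_limits[OF Q(1) p])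
  have "Q x = P x" if "0 < x" "x \<le> 1" for x
  proof -
    have "integral {x..1} (\<lambda>x. if x \<le> 1 then p x else 0) = integral {x..1} p"
      by (rule integral_cong) auto
    then show ?thesis
      using integral_unique[OF ac_derivative_ftc[OF Q(1) that]] integral_unique[OF ac_derivative_ftc[OF P that]] Q(2) by simp
  qed
  then have "eventually (\<lambda>x. Q x = P x) (at_right 0)"
    using eventually_at_right_real[of 0 "1::real"] by (auto elim!: eventually_mono)
  with l have "(P \<longlongrightarrow> l) (at_right 0)" by (rule Lim_transform_eventually)
  then show ?thesis by (rule that)
qed

lemma ac_derivative_scale:
  assumes "ac_derivative P p" shows "ac_derivative (\<lambda>x. c * P x) (\<lambda>x. c * p x)"
  using ac_derivative_mult[OF ac_derivative_C1[of "\<lambda>x. c" "\<lambda>x. 0"] assms] by simp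

lemma ac_derivative_diff:
  assumes "ac_derivative P p" "ac_derivative Q q"
  shows "ac_derivative (\<lambda>x. P x - Q x) (\<lambda>x. p x - q x)"
  using ac_derivative_add[OF assms(1) ac_derivative_scale[OF assms(2), of "-1"]] by simp

text \<open>An absolutely continuous function is the indefinite integral of its derivative, and for a continuous
integrand the elementary fundamental theorem applies. Primitives acquire their classical derivative in this way.\<close>

lemma ac_derivative_imp_has_vector_derivative:
  assumes P: "ac_derivative P p" and p: "continuous_on {0<..} p" and x: "0 < x"
  shows "(P has_vector_derivative p x) (at x)"
proof -
  have "((\<lambda>y. integral {x/2..y} p) has_vector_derivative p x) (at x within {x/2..2*x})"
    using x by (intro integral_has_vector_derivative continuous_on_subset[OF p]) auto
  then have "((\<lambda>y. integral {x/2..y} p) has_vector_derivative p x) (at x)"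
    using x by (subst (asm) at_within_interior) auto
  then have "((\<lambda>y. P (x/2) + integral {x/2..y} p) has_vector_derivative 0 + p x) (at x)"
    by (intro has_vector_derivative_add has_vector_derivative_const)
  then have "(P has_vector_derivative 0 + p x) (at x)"
  proof (rule has_vector_derivative_transform_within_open[of _ _ _ "{x/2<..}"])
    show "P (x/2) + integral {x/2..y} p = P y" if "y \<in> {x/2<..}" for y
      using integral_unique[OF ac_derivative_ftc[OF P, of "x/2" y]] that x by simp
  qed (use x in auto)
  then show ?thesis by simp
qed

lemma regularD:
  assumes F: "regular F"
  shows "0 < x \<Longrightarrow> (F has_vector_derivative D1 F x) (at x)"
    and "continuous_on {0<..} F" "continuous_on {0<..} (D1 F)"
    and "ac_derivative F (D1 F)"
    and "ac_derivative (D1 F) (\<lambda>x. complex_of_real ((\<nu>\<^sup>2 - 1/4) / x\<^sup>2) * F x - tau \<nu> F x)"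
proof -
  show *: "0 < x \<Longrightarrow> (F has_vector_derivative D1 F x) (at x)" for x
    using F by (simp add: regular_def vector_derivative_works)
  show "continuous_on {0<..} F" "continuous_on {0<..} (D1 F)"
    using F by (auto simp: regular_def intro: locally_absolutely_continuous_continuous)
  have "AE x in half_line. (F has_vector_derivative D1 F x) (at x)"
    by (rule AE_I2) (simp add: *)
  then show "ac_derivative F (D1 F)" using F by (simp add: ac_derivative_def regular_def)
  have "AE x in half_line. D1 F differentiable (at x)" using F by (simp add: regular_def)
  then have "AE x in half_line. (D1 F has_vector_derivative D1 (D1 F) x) (at x)"
    by eventually_elim (simp add: vector_derivative_works)
  then show "ac_derivative (D1 F) (\<lambda>x. complex_of_real ((\<nu>\<^sup>2 - 1/4) / x\<^sup>2) * F x - tau \<nu> F x)"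
    using F by (simp add: ac_derivative_def regular_def tau_def)
qed

lemma regularI:
  assumes F: "ac_derivative F G" and G: "ac_derivative G H"
  shows "regular F" "0 < x \<Longrightarrow> D1 F x = G x"
    "AE x in half_line. tau \<nu> F x = complex_of_real ((\<nu>\<^sup>2 - 1/4) / x\<^sup>2) * F x - H x"
proof -
  have cG: "continuous_on {0<..} G" by (rule ac_derivative_continuous[OF G])
  have der: "(F has_vector_derivative G x) (at x)" if "0 < x" for x
    by (rule ac_derivative_imp_has_vector_derivative[OF F cG that])
  show D: "0 < x \<Longrightarrow> D1 F x = G x" for x using der by (simp add: vector_derivative_at)
  have G': "ac_derivative (D1 F) H" using G by (rule ac_derivative_cong) (auto simp: D)
  have der2: "AE x in half_line. (D1 F has_vector_derivative H x) (at x)"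
    using G' by (simp add: ac_derivative_def)
  then have "AE x in half_line. D1 F differentiable (at x)"
    by eventually_elim (auto simp: differentiable_def has_vector_derivative_def)
  moreover have "F differentiable (at x)" if "0 < x" for x
    using der[OF that] by (auto simp: differentiable_def has_vector_derivative_def)
  ultimately show "regular F" using F G' by (auto simp: regular_def ac_derivative_def)
  from der2 show "AE x in half_line. tau \<nu> F x = complex_of_real ((\<nu>\<^sup>2 - 1/4) / x\<^sup>2) * F x - H x"
    by eventually_elim (simp add: tau_def vector_derivative_at)
qed

text \<open>Lagrange's identity: the terms \<open>F' G'\<close> cancel, and so do the potential terms, the potential
  being real.\<close>

lemma ac_derivative_lagrange_bracket:
  assumes F: "regular F" and G: "regular G"
  shows "ac_derivative (lagrange_bracket F G) (\<lambda>x. tau \<nu> F x * cnj (G x) - F x * cnj (tau \<nu> G x))"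
proof -
  note f = regularD(4)[OF F] regularD(5)[OF F, of \<nu>]
    and g = regularD(4)[OF G, THEN ac_derivative_cnj] regularD(5)[OF G, of \<nu>, THEN ac_derivative_cnj]
  have "ac_derivative (\<lambda>x. F x * cnj (D1 G x) - D1 F x * cnj (G x))
      (\<lambda>x. (F x * cnj (complex_of_real ((\<nu>\<^sup>2 - 1/4) / x\<^sup>2) * G x - tau \<nu> G x) + D1 F x * cnj (D1 G x))
        - (D1 F x * cnj (D1 G x) + (complex_of_real ((\<nu>\<^sup>2 - 1/4) / x\<^sup>2) * F x - tau \<nu> F x) * cnj (G x)))"
    by (intro ac_derivative_diff ac_derivative_mult f g)
  then show ?thesis unfolding lagrange_bracket_def
    by (rule ac_derivative_cong) (auto simp: algebra_simps)
qed

section \<open>Variation of constants\<close>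

lemma powr_pred: "0 < x \<Longrightarrow> x powr (a - 1) = x powr a / (x::real)"
  by (simp add: powr_diff)

lemma has_vector_derivative_powr:
  "0 < x \<Longrightarrow> ((\<lambda>x. complex_of_real (x powr \<alpha>)) has_vector_derivative complex_of_real (\<alpha> * x powr (\<alpha> - 1))) (at x)"
  by (rule has_vector_derivative_of_real)
     (auto intro!: derivative_eq_intros simp flip: has_real_derivative_iff_has_vector_derivative)

lemma continuous_on_powr_half_line: "continuous_on {0<..} (\<lambda>x. complex_of_real (x powr \<alpha>))"
  by (intro continuous_intros) auto

lemma ac_derivative_powr:
  "ac_derivative (\<lambda>x. complex_of_real (x powr \<alpha>)) (\<lambda>x. complex_of_real (\<alpha> * x powr (\<alpha> - 1)))"
  by (rule ac_derivative_C1[OF has_vector_derivative_powr]) (auto intro!: continuous_intros)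

lemma square_integrable_powr:
  assumes "\<alpha> > - 1/2"
  shows "square_integrable (\<lambda>x. if x \<le> r then complex_of_real (x powr \<alpha>) else 0)"
proof (cases "0 < r")
  case False
  then have "AE x in half_line. 0 = (if x \<le> r then complex_of_real (x powr \<alpha>) else 0)"
    by (intro AE_I2) auto
  then show ?thesis by (rule square_integrable_cong[OF square_integrable_zero])
next
  case True
  have "(\<lambda>x. complex_of_real (x powr \<alpha>)) \<in> borel_measurable half_line"
    by (rule continuous_imp_measurable_on_sets_lebesgue[OF continuous_on_powr_half_line]) auto
  moreover have "{x \<in> space half_line. x \<le> r} \<in> sets half_line"
  proof -
    have "{x \<in> space half_line. x \<le> r} = {0<..} \<inter> {..r}" by auto
    then show ?thesis by (auto simp: sets_restrict_space)
  qed
  ultimately have m: "(\<lambda>x. if x \<le> r then complex_of_real (x powr \<alpha>) else 0) \<in> borel_measurable half_line"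
    by (intro measurable_If) auto
  have "(\<lambda>x. x powr (2 * \<alpha>)) integrable_on {0..r}"
    using assms True by (intro integrable_on_powr_from_0) auto
  then have "(\<lambda>x. x powr (2 * \<alpha>)) absolutely_integrable_on {0..r}"
    by (rule nonnegative_absolutely_integrable_1) auto
  then have "integrable lebesgue (\<lambda>x. indicator {0..r} x *\<^sub>R x powr (2 * \<alpha>))"
    by (simp add: set_integrable_def)
  then have "integrable lebesgue (\<lambda>x. indicator {0<..} x *\<^sub>R (cmod (if x \<le> r then complex_of_real (x powr \<alpha>) else 0))\<^sup>2)"
  proof (rule Bochner_Integration.integrable_cong[THEN iffD1, rotated -1, OF _ refl])
    fix x :: real
    show "indicator {0..r} x *\<^sub>R x powr (2 * \<alpha>) =
        indicator {0<..} x *\<^sub>R (cmod (if x \<le> r then complex_of_real (x powr \<alpha>) else 0))\<^sup>2"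
      by (auto simp: indicator_def powr_add[symmetric] power2_eq_square)
  qed
  then have "integrable half_line (\<lambda>x. (cmod (if x \<le> r then complex_of_real (x powr \<alpha>) else 0))\<^sup>2)"
    by (subst integrable_restrict_space) auto
  with m show ?thesis by (simp add: square_integrable_def)
qed

text \<open>Applied to primitives of squares, this turns integral bounds into smallness at arbitrarily large
arguments.\<close>

lemma bounded_above_imp_small_derivative:
  fixes \<Psi> :: "real \<Rightarrow> real"
  assumes der: "\<And>y. R \<le> y \<Longrightarrow> (\<Psi> has_real_derivative \<psi> y) (at y)"
    and B: "\<And>y. R \<le> y \<Longrightarrow> \<Psi> y \<le> B" and "0 < \<delta>"
  shows "\<exists>y\<ge>R. \<psi> y < \<delta>"
proof (rule ccontr)
  assume "\<not> ?thesis"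
  then have ge: "\<And>y. R \<le> y \<Longrightarrow> \<delta> \<le> \<psi> y" by force
  define y where "y = R + (B - \<Psi> R) / \<delta> + 1"
  have "R < y" using B[of R] \<open>0 < \<delta>\<close> by (simp add: y_def add_nonneg_pos)
  obtain z where z: "R < z" "z < y" "\<Psi> y - \<Psi> R = (y - R) * \<psi> z"
    using MVT2[OF \<open>R < y\<close>, of \<Psi> \<psi>] der by auto
  have "(y - R) * \<delta> \<le> \<Psi> y - \<Psi> R"
    unfolding z(3) using ge[of z] z \<open>R < y\<close> by (intro mult_left_mono) auto
  moreover have "(y - R) * \<delta> = B - \<Psi> R + \<delta>" using \<open>0 < \<delta>\<close> by (simp add: y_def field_simps)
  ultimately show False using B[of y] \<open>R < y\<close> \<open>0 < \<delta>\<close> by simp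
qed

definition maximal_function :: "real \<Rightarrow> (real \<Rightarrow> complex) \<Rightarrow> bool"
  where "maximal_function \<nu> F \<longleftrightarrow> regular F \<and> square_integrable F \<and> square_integrable (tau \<nu> F)"

lemma maximal_functionD:
  assumes "maximal_function \<nu> F"
  shows "regular F" "square_integrable F" "square_integrable (tau \<nu> F)"
  using assms by (auto simp: maximal_function_def)

locale bessel =
  fixes \<nu> :: real
  assumes \<nu>: "0 < \<nu>" "\<nu> < 1"
begin

text \<open>A fundamental system of \<open>\<tau> f = 0\<close>, its derivatives, and the potential.\<close>

definition u :: "real \<Rightarrow> complex" where "u x = complex_of_real (x powr (1/2 - \<nu>))"
definition v :: "real \<Rightarrow> complex" where "v x = complex_of_real (x powr (1/2 + \<nu>))"
definition u' :: "real \<Rightarrow> complex" where "u' x = complex_of_real ((1/2 - \<nu>) * x powr (1/2 - \<nu> - 1))"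
definition v' :: "real \<Rightarrow> complex" where "v' x = complex_of_real ((1/2 + \<nu>) * x powr (1/2 + \<nu> - 1))"
definition q :: "real \<Rightarrow> complex" where "q x = complex_of_real ((\<nu>\<^sup>2 - 1/4) / x\<^sup>2)"

lemma cnj_uv [simp]: "cnj (u x) = u x" "cnj (v x) = v x" "cnj (u' x) = u' x" "cnj (v' x) = v' x" "cnj (q x) = q x"
  by (simp_all add: u_def v_def u'_def v'_def q_def)

lemma v_eq: "v x = u x * complex_of_real (x powr (2 * \<nu>))"
  unfolding u_def v_def by (simp flip: of_real_mult powr_add add: add.commute)

lemma u'_eq: "0 < x \<Longrightarrow> u' x = complex_of_real ((1/2 - \<nu>) / x) * u x"
  unfolding u_def u'_def powr_pred by simp

lemma v'_eq: "0 < x \<Longrightarrow> v' x = complex_of_real ((1/2 + \<nu>) / x) * v x"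
  unfolding v_def v'_def powr_pred by simp

lemma uv_x: "0 < x \<Longrightarrow> u x * v x = complex_of_real x"
  unfolding u_def v_def by (simp flip: of_real_mult powr_add)

lemma wronskian: "0 < x \<Longrightarrow> u x * v' x - u' x * v x = complex_of_real (2 * \<nu>)"
proof -
  assume x: "0 < x"
  have "u x * v' x - u' x * v x = complex_of_real ((1/2 + \<nu>) / x) * (u x * v x) - complex_of_real ((1/2 - \<nu>) / x) * (u x * v x)"
    unfolding u'_eq[OF x] v'_eq[OF x] by (simp only: ac_simps)
  also have "\<dots> = complex_of_real ((1/2 + \<nu>) / x * x - (1/2 - \<nu>) / x * x)"
    unfolding uv_x[OF x] by (simp only: of_real_mult of_real_diff)
  also have "(1/2 + \<nu>) / x * x - (1/2 - \<nu>) / x * x = 2 * \<nu>" using x by (simp add: field_simps)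
  finally show ?thesis .
qed

lemma ac_u: "ac_derivative u u'" and ac_v: "ac_derivative v v'"
  using ac_derivative_powr[of "1/2 - \<nu>"] ac_derivative_powr[of "1/2 + \<nu>"]
  by (simp_all add: u_def[abs_def] u'_def[abs_def] v_def[abs_def] v'_def[abs_def])

lemma ac_derivative_powr_solution:
  assumes "\<gamma> * (\<gamma> - 1) = \<nu>\<^sup>2 - 1/4"
  shows "ac_derivative (\<lambda>x. complex_of_real (\<gamma> * x powr (\<gamma> - 1))) (\<lambda>x. q x * complex_of_real (x powr \<gamma>))"
proof -
  have "ac_derivative (\<lambda>x. complex_of_real \<gamma> * complex_of_real (x powr (\<gamma> - 1)))
      (\<lambda>x. complex_of_real \<gamma> * complex_of_real ((\<gamma> - 1) * x powr (\<gamma> - 1 - 1)))"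
    by (rule ac_derivative_scale[OF ac_derivative_powr])
  then show ?thesis
  proof (rule ac_derivative_cong)
    show "AE x in half_line. complex_of_real \<gamma> * complex_of_real ((\<gamma> - 1) * x powr (\<gamma> - 1 - 1)) = q x * complex_of_real (x powr \<gamma>)"
    proof (rule AE_I2)
      fix x assume "x \<in> space half_line" then have x: "0 < x" by simp
      have "x powr (\<gamma> - 1 - 1) = x powr \<gamma> / x\<^sup>2"
        unfolding powr_pred[OF x] by (simp add: power2_eq_square)
      then have "\<gamma> * ((\<gamma> - 1) * x powr (\<gamma> - 1 - 1)) = (\<nu>\<^sup>2 - 1/4) / x\<^sup>2 * x powr \<gamma>"
        unfolding assms[symmetric] by simp
      then show "complex_of_real \<gamma> * complex_of_real ((\<gamma> - 1) * x powr (\<gamma> - 1 - 1)) = q x * complex_of_real (x powr \<gamma>)"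
        unfolding q_def by (simp only: of_real_mult[symmetric])
    qed
  qed simp
qed

lemma ac_u': "ac_derivative u' (\<lambda>x. q x * u x)" and ac_v': "ac_derivative v' (\<lambda>x. q x * v x)"
  using ac_derivative_powr_solution[of "1/2 - \<nu>"] ac_derivative_powr_solution[of "1/2 + \<nu>"]
  by (simp_all add: u_def[abs_def] u'_def[abs_def] v_def[abs_def] v'_def[abs_def] field_simps power2_eq_square)

lemma continuous_uv: "continuous_on {0<..} u" "continuous_on {0<..} v" "continuous_on {0<..} u'" "continuous_on {0<..} v'"
  using ac_u ac_v ac_u' ac_v' by (auto dest: ac_derivative_continuous)

lemma ac_D1: "regular F \<Longrightarrow> ac_derivative (D1 F) (\<lambda>x. q x * F x - tau \<nu> F x)"
  unfolding q_def by (rule regularD(5))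

text \<open>The coefficients \<open>a\<close>, \<open>b\<close> for which \<open>F = a u + b v\<close> and \<open>F' = a u' + b v'\<close>, by Cramer's rule; up to the
  factor \<open>2\<nu>\<close> they are the brackets \<open>[F, v]\<close> and \<open>- [F, u]\<close>.\<close>

definition cu :: "(real \<Rightarrow> complex) \<Rightarrow> real \<Rightarrow> complex"
  where "cu F x = (F x * v' x - D1 F x * v x) / complex_of_real (2 * \<nu>)"
definition cv :: "(real \<Rightarrow> complex) \<Rightarrow> real \<Rightarrow> complex"
  where "cv F x = (D1 F x * u x - F x * u' x) / complex_of_real (2 * \<nu>)"

lemma cu_cv_expand:
  assumes "0 < x"
  shows "F x = cu F x * u x + cv F x * v x" "D1 F x = cu F x * u' x + cv F x * v' x"
proof -
  have W: "complex_of_real (2 * \<nu>) \<noteq> 0" using \<nu> by simp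
  have "complex_of_real (2 * \<nu>) * (cu F x * u x + cv F x * v x) = F x * (u x * v' x - u' x * v x)"
    using W by (simp add: cu_def cv_def field_simps)
  then show "F x = cu F x * u x + cv F x * v x" using W unfolding wronskian[OF assms] by simp
  have "complex_of_real (2 * \<nu>) * (cu F x * u' x + cv F x * v' x) = D1 F x * (u x * v' x - u' x * v x)"
    using W by (simp add: cu_def cv_def field_simps)
  then show "D1 F x = cu F x * u' x + cv F x * v' x" using W unfolding wronskian[OF assms] by simp
qed

lemma ac_cu:
  assumes "regular F"
  shows "ac_derivative (cu F) (\<lambda>x. inverse (complex_of_real (2 * \<nu>)) * (tau \<nu> F x * v x))"
proof -
  have "ac_derivative (\<lambda>x. inverse (complex_of_real (2 * \<nu>)) * (F x * v' x - D1 F x * v x))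
     (\<lambda>x. inverse (complex_of_real (2 * \<nu>)) * ((F x * (q x * v x) + D1 F x * v' x) - (D1 F x * v' x + (q x * F x - tau \<nu> F x) * v x)))"
    by (intro ac_derivative_scale ac_derivative_diff ac_derivative_mult regularD(4) ac_D1 ac_v ac_v' assms)
  then show ?thesis
    by (rule ac_derivative_cong) (auto simp: cu_def field_simps intro!: AE_I2)
qed

lemma ac_cv:
  assumes "regular F"
  shows "ac_derivative (cv F) (\<lambda>x. - inverse (complex_of_real (2 * \<nu>)) * (tau \<nu> F x * u x))"
proof -
  have "ac_derivative (\<lambda>x. inverse (complex_of_real (2 * \<nu>)) * (D1 F x * u x - F x * u' x))
     (\<lambda>x. inverse (complex_of_real (2 * \<nu>)) * ((D1 F x * u' x + (q x * F x - tau \<nu> F x) * u x) - (F x * (q x * u x) + D1 F x * u' x)))"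
    by (intro ac_derivative_scale ac_derivative_diff ac_derivative_mult regularD(4) ac_D1 ac_u ac_u' assms)
  then show ?thesis
    by (rule ac_derivative_cong) (auto simp: cv_def field_simps intro!: AE_I2)
qed

text \<open>The Wronskian being constant, the bracket becomes a form with constant coefficients in the
coefficients of variation of constants.\<close>

lemma bracket_cu_cv:
  assumes x: "0 < x"
  shows "lagrange_bracket F G x = complex_of_real (2 * \<nu>) * (cu F x * cnj (cv G x) - cv F x * cnj (cu G x))"
proof -
  have "lagrange_bracket F G x =
     (cu F x * u x + cv F x * v x) * cnj (cu G x * u' x + cv G x * v' x)
     - (cu F x * u' x + cv F x * v' x) * cnj (cu G x * u x + cv G x * v x)"
    unfolding lagrange_bracket_def using cu_cv_expand[OF x, of F] cu_cv_expand[OF x, of G] by metis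
  also have "\<dots> = (u x * v' x - u' x * v x) * (cu F x * cnj (cv G x) - cv F x * cnj (cu G x))"
    by (simp add: algebra_simps)
  finally show ?thesis unfolding wronskian[OF x] .
qed

text \<open>Near \<open>0\<close> the derivatives of the coefficients are products of \<open>\<tau> F\<close> with \<open>v\<close> or \<open>u\<close>, both in \<open>L\<^sup>2\<close> there: the
exponent \<open>1/2 - \<nu>\<close> exceeds \<open>- 1/2\<close> as \<open>\<nu> < 1\<close>.\<close>

lemma coefficients_converge:
  assumes F: "maximal_function \<nu> F"
  shows "\<exists>l. (cu F \<longlongrightarrow> l) (at_right 0)" "\<exists>l. (cv F \<longlongrightarrow> l) (at_right 0)"
proof -
  have *: "integrable half_line (\<lambda>x. if x \<le> 1 then c * (tau \<nu> F x * complex_of_real (x powr \<alpha>)) else 0)" if "\<alpha> > - 1/2" for c \<alpha>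
  proof -
    have "integrable half_line (\<lambda>x. c * (tau \<nu> F x * (if x \<le> 1 then complex_of_real (x powr \<alpha>) else 0)))"
      by (intro integrable_mult_right square_integrable_norm_mult maximal_functionD[OF F] square_integrable_powr that)
    then show ?thesis by (rule Bochner_Integration.integrable_cong[THEN iffD1, rotated -1]) auto
  qed
  have "1/2 + \<nu> > -1/2" "1/2 - \<nu> > -1/2" using \<nu> by auto
  note i = *[OF this(1)] *[OF this(2)]
  show "\<exists>l. (cu F \<longlongrightarrow> l) (at_right 0)"
    using ac_derivative_limit_at_0[OF ac_cu[OF maximal_functionD(1)[OF F]]] i(1) unfolding v_def by metis
  show "\<exists>l. (cv F \<longlongrightarrow> l) (at_right 0)"
    using ac_derivative_limit_at_0[OF ac_cv[OF maximal_functionD(1)[OF F]]] i(2) unfolding u_def by metis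
qed

definition \<alpha> :: "(real \<Rightarrow> complex) \<Rightarrow> complex" where "\<alpha> F = Lim (at_right 0) (cu F)"
definition \<beta> :: "(real \<Rightarrow> complex) \<Rightarrow> complex" where "\<beta> F = Lim (at_right 0) (cv F)"

lemma tendsto_\<alpha>: "maximal_function \<nu> F \<Longrightarrow> (cu F \<longlongrightarrow> \<alpha> F) (at_right 0)"
  and tendsto_\<beta>: "maximal_function \<nu> F \<Longrightarrow> (cv F \<longlongrightarrow> \<beta> F) (at_right 0)"
  using coefficients_converge[of F] unfolding \<alpha>_def \<beta>_def
  by (auto simp: tendsto_Lim)

text \<open>The right-hand factor in \<open>\<tau> = - (d/dx + c/x) (d/dx - c/x)\<close>, \<open>c = 1/2 - \<nu>\<close>. It annihilates \<open>u\<close>, so the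
energy is free of the \<open>u\<close>-part of \<open>F'\<close>, which is in general not square-integrable near \<open>0\<close>.\<close>

definition quasi :: "(real \<Rightarrow> complex) \<Rightarrow> real \<Rightarrow> complex"
  where "quasi F x = D1 F x - complex_of_real ((1/2 - \<nu>) / x) * F x"

lemma continuous_quasi: "regular F \<Longrightarrow> continuous_on {0<..} (quasi F)"
  unfolding quasi_def by (intro continuous_intros regularD(2,3)) auto

lemma bracket_quasi: "lagrange_bracket F G x = F x * cnj (quasi G x) - quasi F x * cnj (G x)"
  by (simp add: lagrange_bracket_def quasi_def algebra_simps)

lemma quasi_cnj:
  assumes x: "0 < x"
  shows "quasi F x * cnj (F x) = complex_of_real (2 * \<nu>) *
    (cv F x * cnj (cu F x) + cv F x * cnj (cv F x) * complex_of_real (x powr (2 * \<nu>)))"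
proof -
  have "quasi F x * u x = D1 F x * u x - F x * u' x" by (simp add: quasi_def u'_eq[OF x] algebra_simps)
  then have qu: "quasi F x * u x = complex_of_real (2 * \<nu>) * cv F x" using \<nu> by (simp add: cv_def)
  have "quasi F x * cnj (F x) = quasi F x * cnj (cu F x * u x + cv F x * v x)"
    using cu_cv_expand(1)[OF x, of F] by simp
  also have "\<dots> = (quasi F x * u x) * (cnj (cu F x) + cnj (cv F x) * complex_of_real (x powr (2 * \<nu>)))"
    unfolding v_eq by (simp add: algebra_simps)
  finally show ?thesis unfolding qu by (simp add: algebra_simps)
qed

text \<open>The product rule together with \<open>c\<^sup>2 - c = \<nu>\<^sup>2 - 1/4\<close>.\<close>

lemma ac_energy:
  assumes F: "regular F"
  shows "ac_derivative (\<lambda>x. quasi F x * cnj (F x)) (\<lambda>x. quasi F x * cnj (quasi F x) - tau \<nu> F x * cnj (F x))"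
proof -
  let ?c = "\<lambda>x. complex_of_real ((1/2 - \<nu>) / x)"
  have c: "ac_derivative ?c (\<lambda>x. complex_of_real (- (1/2 - \<nu>) / x\<^sup>2))"
  proof (rule ac_derivative_C1)
    show "continuous_on {0<..} (\<lambda>x. complex_of_real (- (1/2 - \<nu>) / x\<^sup>2))"
      by (intro continuous_intros) auto
    fix x :: real assume "0 < x"
    then have "((\<lambda>x. (1/2 - \<nu>) / x) has_real_derivative - (1/2 - \<nu>) / x\<^sup>2) (at x)"
      by (auto intro!: derivative_eq_intros simp: power2_eq_square field_simps)
    then show "(?c has_vector_derivative complex_of_real (- (1/2 - \<nu>) / x\<^sup>2)) (at x)"
      by (intro has_vector_derivative_of_real) (simp add: has_real_derivative_iff_has_vector_derivative)
  qed
  have g: "ac_derivative (quasi F) (\<lambda>x. (q x * F x - tau \<nu> F x) - (?c x * D1 F x + complex_of_real (- (1/2 - \<nu>) / x\<^sup>2) * F x))"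
    unfolding quasi_def by (intro ac_derivative_diff ac_derivative_mult c ac_D1 regularD(4) F)
  note h = ac_derivative_mult[OF g ac_derivative_cnj[OF regularD(4)[OF F]]]
  show ?thesis
  proof (rule ac_derivative_cong[OF h refl], rule AE_I2)
    fix x assume "x \<in> space half_line"
    then have x: "0 < x" by simp
    have q: "q x = ?c x * ?c x + complex_of_real (- (1/2 - \<nu>) / x\<^sup>2)"
      unfolding q_def using x by (simp flip: of_real_mult of_real_add add: field_simps power2_eq_square)
    show "quasi F x * cnj (D1 F x) +
         ((q x * F x - tau \<nu> F x) - (?c x * D1 F x + complex_of_real (- (1/2 - \<nu>) / x\<^sup>2) * F x)) * cnj (F x) =
         quasi F x * cnj (quasi F x) - tau \<nu> F x * cnj (F x)"
      unfolding q quasi_def by (simp add: algebra_simps)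
  qed
qed

end

section \<open>Behaviour at infinity and the energy inequality\<close>

lemma ac_derivative_Re:
  assumes P: "ac_derivative P p" and p: "continuous_on {0<..} p" and x: "0 < x"
  shows "((\<lambda>x. Re (P x)) has_real_derivative Re (p x)) (at x)"
proof -
  have "(P has_derivative (\<lambda>h. h *\<^sub>R p x)) (at x)"
    using ac_derivative_imp_has_vector_derivative[OF P p x] by (simp add: has_vector_derivative_def)
  then have "((\<lambda>x. Re (P x)) has_derivative (\<lambda>h. Re (h *\<^sub>R p x))) (at x)"
    by (rule has_derivative_Re)
  then show ?thesis
    unfolding has_field_derivative_def by (rule has_derivative_eq_rhs) (simp add: fun_eq_iff)
qed

lemma square_integrable_primitive:
  assumes F: "square_integrable F" and c: "continuous_on {0<..} F"
  obtains S B where "\<And>y. 0 < y \<Longrightarrow> (S has_real_derivative (cmod (F y))\<^sup>2) (at y)" "\<And>y. 0 < y \<Longrightarrow> S y \<le> B"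
proof -
  have i: "integrable half_line (\<lambda>x. F x * cnj (F x))" by (rule square_integrable_mult_cnj[OF F F])
  obtain P where P: "ac_derivative P (\<lambda>x. F x * cnj (F x))"
    using ac_primitive_exists[OF half_line_integrable_imp_local[OF i] zero_less_one] by metis
  obtain l0 l1 where l1: "(P \<longlongrightarrow> l1) at_top" using ac_derivative_limits[OF P i] by metis
  define S where "S x = Re (P x)" for x
  have der: "(S has_real_derivative (cmod (F y))\<^sup>2) (at y)" if "0 < y" for y
  proof -
    have "((\<lambda>x. Re (P x)) has_real_derivative Re (F y * cnj (F y))) (at y)"
      by (rule ac_derivative_Re[OF P _ that]) (intro continuous_intros c)
    then show ?thesis unfolding S_def complex_norm_square[symmetric] by (simp flip: of_real_power)
  qed
  have mono: "S a \<le> S b" if "0 < a" "a \<le> b" for a b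
  proof (rule DERIV_nonneg_imp_nondecreasing[OF that(2)])
    fix x assume "a \<le> x"
    then show "\<exists>y. (S has_real_derivative y) (at x) \<and> 0 \<le> y"
      using der[of x] that by (intro exI[of _ "(cmod (F x))\<^sup>2"]) simp
  qed
  have "(S \<longlongrightarrow> Re l1) at_top" unfolding S_def by (intro tendsto_Re l1)
  then have "eventually (\<lambda>y. S y < Re l1 + 1) at_top" by (intro order_tendstoD(2)) auto
  then obtain R where R: "\<And>y. R \<le> y \<Longrightarrow> S y < Re l1 + 1" by (auto simp: eventually_at_top_linorder)
  have "S y \<le> Re l1 + 1" if "0 < y" for y
    using mono[of y "max y R"] R[of "max y R"] that by simp
  with der show ?thesis by (rule that)
qed

context bessel
begin

text \<open>On \<open>[1,\<infinity>)\<close> twice the boundary term differs from \<open>(|F|\<^sup>2)'\<close> by at most a multiple of \<open>|F|\<^sup>2\<close>. Were it to stay above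
\<open>\<epsilon>\<close>, then \<open>|F|\<^sup>2\<close> plus a multiple of its primitive would grow linearly, although it is increasing, the
primitive is bounded, and \<open>|F|\<^sup>2\<close> is small at arbitrarily large arguments.\<close>

lemma energy_frequently_small:
  assumes F: "maximal_function \<nu> F" and R: "1 \<le> R" and "0 < \<epsilon>"
  shows "\<exists>y\<ge>R. Re (quasi F y * cnj (F y)) < \<epsilon>"
proof (rule ccontr)
  assume "\<not> ?thesis"
  then have ge: "\<And>y. R \<le> y \<Longrightarrow> \<epsilon> \<le> Re (quasi F y * cnj (F y))" by force
  note reg = maximal_functionD(1)[OF F]
  obtain S B where S: "\<And>y. 0 < y \<Longrightarrow> (S has_real_derivative (cmod (F y))\<^sup>2) (at y)" "\<And>y. 0 < y \<Longrightarrow> S y \<le> B"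
    using square_integrable_primitive[OF maximal_functionD(2)[OF F] regularD(2)[OF reg]] by metis
  define C where "C = \<bar>1/2 - \<nu>\<bar>"
  define H where "H x = Re (F x * cnj (F x))" for x
  define \<Phi> where "\<Phi> y = H y + 2 * C * S y" for y
  define \<phi> where "\<phi> y = Re (F y * cnj (D1 F y) + D1 F y * cnj (F y)) + 2 * C * (cmod (F y))\<^sup>2" for y
  have der: "(\<Phi> has_real_derivative \<phi> y) (at y)" if "0 < y" for y
  proof -
    have "(H has_real_derivative Re (F y * cnj (D1 F y) + D1 F y * cnj (F y))) (at y)"
      unfolding H_def
    proof (rule ac_derivative_Re[OF _ _ that])
      show "ac_derivative (\<lambda>x. F x * cnj (F x)) (\<lambda>x. F x * cnj (D1 F x) + D1 F x * cnj (F x))"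
        by (intro ac_derivative_mult ac_derivative_cnj regularD(4) reg)
      show "continuous_on {0<..} (\<lambda>x. F x * cnj (D1 F x) + D1 F x * cnj (F x))"
        by (intro continuous_intros regularD(2,3) reg)
    qed
    then show ?thesis unfolding \<Phi>_def \<phi>_def by (intro DERIV_add DERIV_cmult S that)
  qed
  have lower: "2 * \<epsilon> \<le> \<phi> y" if "R \<le> y" for y
  proof -
    have y: "1 \<le> y" using that R by simp
    have "D1 F y * cnj (F y) = quasi F y * cnj (F y) + complex_of_real ((1/2 - \<nu>) / y * (cmod (F y))\<^sup>2)"
      unfolding of_real_mult complex_norm_square by (simp add: quasi_def algebra_simps)
    then have "Re (D1 F y * cnj (F y)) = Re (quasi F y * cnj (F y)) + (1/2 - \<nu>) / y * (cmod (F y))\<^sup>2"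
      by (simp only: plus_complex.sel Re_complex_of_real)
    moreover have "Re (F y * cnj (D1 F y)) = Re (D1 F y * cnj (F y))" by simp
    ultimately have *: "Re (F y * cnj (D1 F y) + D1 F y * cnj (F y)) = 2 * Re (quasi F y * cnj (F y)) + 2 * ((1/2 - \<nu>) / y * (cmod (F y))\<^sup>2)"
      by (simp only: plus_complex.sel)
    have "\<bar>(1/2 - \<nu>) / y\<bar> \<le> C" using y unfolding C_def abs_divide by (simp add: divide_le_eq mult_le_cancel_left1)
    then have "- C \<le> (1/2 - \<nu>) / y" by linarith
    then have "- C * (cmod (F y))\<^sup>2 \<le> (1/2 - \<nu>) / y * (cmod (F y))\<^sup>2"
      by (intro mult_right_mono) auto
    then show ?thesis unfolding \<phi>_def * using ge[OF that] by simp
  qed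
  have mono: "\<Phi> a \<le> \<Phi> b" if "R \<le> a" "a \<le> b" for a b
  proof (rule DERIV_nonneg_imp_nondecreasing[OF that(2)])
    fix x assume "a \<le> x"
    then have "(\<Phi> has_real_derivative \<phi> x) (at x)" "0 \<le> \<phi> x"
      using lower[of x] der[of x] that R \<open>0 < \<epsilon>\<close> by auto
    then show "\<exists>y. (\<Phi> has_real_derivative y) (at x) \<and> 0 \<le> y" by blast
  qed
  have bound: "\<Phi> y \<le> 1 + 2 * C * B" if "R \<le> y" for y
  proof -
    have "\<exists>z\<ge>y. (cmod (F z))\<^sup>2 < 1"
      using S that R by (intro bounded_above_imp_small_derivative[of y S "\<lambda>y. (cmod (F y))\<^sup>2" B 1]) auto
    then obtain z where z: "y \<le> z" "(cmod (F z))\<^sup>2 < 1" by blast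
    have "\<Phi> y \<le> \<Phi> z" using that z by (intro mono)
    also have "\<Phi> z = (cmod (F z))\<^sup>2 + 2 * C * S z"
      unfolding \<Phi>_def H_def complex_norm_square[symmetric] by (simp flip: of_real_power)
    also have "\<dots> \<le> 1 + 2 * C * B" using z S(2)[of z] that R
      by (intro add_mono mult_left_mono) (auto simp: C_def)
    finally show ?thesis .
  qed
  obtain y where "R \<le> y" "\<phi> y < 2 * \<epsilon>"
  proof -
    have "\<exists>y\<ge>R. \<phi> y < 2 * \<epsilon>"
      using der bound R \<open>0 < \<epsilon>\<close>
      by (intro bounded_above_imp_small_derivative[of R \<Phi> \<phi> "1 + 2 * C * B" "2 * \<epsilon>"]) auto
    with that show ?thesis by blast
  qed
  with lower show False by force
qed

text \<open>Adding to the boundary term a primitive \<open>K\<close> of \<open>\<tau> F cnj F\<close> gives a primitive of \<open>|quasi F|\<^sup>2\<close>, whose real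
part is therefore monotone.\<close>

lemma energy_primitive:
  assumes F: "maximal_function \<nu> F"
  obtains K l0 l1 where "(K \<longlongrightarrow> l0) (at_right 0)" "(K \<longlongrightarrow> l1) at_top"
    "(LINT x|half_line. tau \<nu> F x * cnj (F x)) = l1 - l0"
    "\<forall>y>0. ((\<lambda>x. Re (quasi F x * cnj (F x) + K x)) has_real_derivative (cmod (quasi F y))\<^sup>2) (at y)"
    "\<forall>a b. 0 < a \<longrightarrow> a \<le> b \<longrightarrow> Re (quasi F a * cnj (F a) + K a) \<le> Re (quasi F b * cnj (F b) + K b)"
proof -
  note reg = maximal_functionD(1)[OF F]
  have i: "integrable half_line (\<lambda>x. tau \<nu> F x * cnj (F x))"
    by (intro square_integrable_mult_cnj maximal_functionD[OF F])
  obtain K where K: "ac_derivative K (\<lambda>x. tau \<nu> F x * cnj (F x))"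
    using ac_primitive_exists[OF half_line_integrable_imp_local[OF i] zero_less_one] by metis
  obtain l0 l1 where l: "(K \<longlongrightarrow> l0) (at_right 0)" "(K \<longlongrightarrow> l1) at_top"
    "(LINT x|half_line. tau \<nu> F x * cnj (F x)) = l1 - l0" using ac_derivative_limits[OF K i] by metis
  have ac: "ac_derivative (\<lambda>x. quasi F x * cnj (F x) + K x) (\<lambda>x. quasi F x * cnj (quasi F x))"
    using ac_derivative_add[OF ac_energy[OF reg] K] by simp
  have der: "((\<lambda>x. Re (quasi F x * cnj (F x) + K x)) has_real_derivative (cmod (quasi F y))\<^sup>2) (at y)" if "0 < y" for y
  proof -
    have "((\<lambda>x. Re (quasi F x * cnj (F x) + K x)) has_real_derivative Re (quasi F y * cnj (quasi F y))) (at y)"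
      by (rule ac_derivative_Re[OF ac _ that]) (intro continuous_intros continuous_quasi reg)
    then show ?thesis unfolding complex_norm_square[symmetric] by (simp flip: of_real_power)
  qed
  have "Re (quasi F a * cnj (F a) + K a) \<le> Re (quasi F b * cnj (F b) + K b)" if "0 < a" "a \<le> b" for a b
  proof (rule DERIV_nonneg_imp_nondecreasing[OF that(2)])
    fix x assume "a \<le> x"
    then show "\<exists>y. ((\<lambda>x. Re (quasi F x * cnj (F x) + K x)) has_real_derivative y) (at x) \<and> 0 \<le> y"
      using der[of x] that by (intro exI[of _ "(cmod (quasi F x))\<^sup>2"]) simp
  qed
  with l der show ?thesis by (intro that) auto
qed

text \<open>A monotone function that is bounded along a sequence tending to infinity is bounded: \<open>quasi F\<close> is
square-integrable away from \<open>0\<close>.\<close>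

lemma quasi_primitive:
  assumes F: "maximal_function \<nu> F"
  obtains M B where "\<And>y. 0 < y \<Longrightarrow> (M has_real_derivative (cmod (quasi F y))\<^sup>2) (at y)" "\<And>y. 0 < y \<Longrightarrow> M y \<le> B"
proof -
  obtain K l0 l1 where K: "(K \<longlongrightarrow> l0) (at_right 0)" "(K \<longlongrightarrow> l1) at_top"
    "(LINT x|half_line. tau \<nu> F x * cnj (F x)) = l1 - l0"
    "\<forall>y>0. ((\<lambda>x. Re (quasi F x * cnj (F x) + K x)) has_real_derivative (cmod (quasi F y))\<^sup>2) (at y)"
    "\<forall>a b. 0 < a \<longrightarrow> a \<le> b \<longrightarrow> Re (quasi F a * cnj (F a) + K a) \<le> Re (quasi F b * cnj (F b) + K b)"
    by (rule energy_primitive[OF F])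
  have "eventually (\<lambda>y. Re (K y) < Re l1 + 1) at_top"
    using tendsto_Re[OF K(2)] by (intro order_tendstoD(2)) auto
  then obtain R where R: "\<And>y. R \<le> y \<Longrightarrow> Re (K y) < Re l1 + 1" by (auto simp: eventually_at_top_linorder)
  have "Re (quasi F y * cnj (F y) + K y) \<le> 1 + (Re l1 + 1)" if "0 < y" for y
  proof -
    obtain z where z: "max 1 (max y R) \<le> z" "Re (quasi F z * cnj (F z)) < 1"
      using energy_frequently_small[OF F, of "max 1 (max y R)" 1] by auto
    have "Re (quasi F y * cnj (F y) + K y) \<le> Re (quasi F z * cnj (F z) + K z)" using z that by (intro K(5)[rule_format]) auto
    also have "\<dots> \<le> 1 + (Re l1 + 1)" using z R[of z] by (simp only: plus_complex.sel) (intro add_mono, auto)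
    finally show ?thesis .
  qed
  with K(4)[rule_format] show ?thesis by (rule that)
qed

text \<open>At infinity the limit exists by Lagrange's identity. It vanishes because the real multiple of \<open>F\<close> in
\<open>quasi F\<close> drops out of the bracket, so that the bracket is dominated by the squares of \<open>F\<close>, \<open>G\<close>, \<open>quasi F\<close>,
\<open>quasi G\<close>, whose primitives are bounded.\<close>

lemma bracket_limits:
  assumes F: "maximal_function \<nu> F" and G: "maximal_function \<nu> G"
  shows "(lagrange_bracket F G \<longlongrightarrow> complex_of_real (2 * \<nu>) * (\<alpha> F * cnj (\<beta> G) - \<beta> F * cnj (\<alpha> G))) (at_right 0)"
    and "(lagrange_bracket F G \<longlongrightarrow> 0) at_top"
    and "(LINT x|half_line. tau \<nu> F x * cnj (G x)) - (LINT x|half_line. F x * cnj (tau \<nu> G x))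
      = - complex_of_real (2 * \<nu>) * (\<alpha> F * cnj (\<beta> G) - \<beta> F * cnj (\<alpha> G))"
proof -
  note f = maximal_functionD[OF F] and g = maximal_functionD[OF G]
  have i: "integrable half_line (\<lambda>x. tau \<nu> F x * cnj (G x))" "integrable half_line (\<lambda>x. F x * cnj (tau \<nu> G x))"
    by (intro square_integrable_mult_cnj f g)+
  obtain l0 l1 where l: "(lagrange_bracket F G \<longlongrightarrow> l0) (at_right 0)" "(lagrange_bracket F G \<longlongrightarrow> l1) at_top"
    "(LINT x|half_line. tau \<nu> F x * cnj (G x) - F x * cnj (tau \<nu> G x)) = l1 - l0"
    using ac_derivative_limits[OF ac_derivative_lagrange_bracket[OF f(1) g(1)] Bochner_Integration.integrable_diff[OF i]] by metis
  show zero: "(lagrange_bracket F G \<longlongrightarrow> complex_of_real (2 * \<nu>) * (\<alpha> F * cnj (\<beta> G) - \<beta> F * cnj (\<alpha> G))) (at_right 0)"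
  proof (rule Lim_transform_eventually)
    show "((\<lambda>x. complex_of_real (2 * \<nu>) * (cu F x * cnj (cv G x) - cv F x * cnj (cu G x))) \<longlongrightarrow>
        complex_of_real (2 * \<nu>) * (\<alpha> F * cnj (\<beta> G) - \<beta> F * cnj (\<alpha> G))) (at_right 0)"
      by (intro tendsto_intros tendsto_\<alpha> tendsto_\<beta> F G)
    show "eventually (\<lambda>x. complex_of_real (2 * \<nu>) * (cu F x * cnj (cv G x) - cv F x * cnj (cu G x)) = lagrange_bracket F G x) (at_right 0)"
      using eventually_at_right_less[of 0] by (rule eventually_mono) (simp add: bracket_cu_cv)
  qed
  have "l1 = 0"
  proof (rule ccontr)
    assume "l1 \<noteq> 0"
    define \<delta> where "\<delta> = cmod l1 / 2"
    have "0 < \<delta>" "\<delta> < cmod l1" using \<open>l1 \<noteq> 0\<close> by (auto simp: \<delta>_def)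
    have "eventually (\<lambda>y. \<delta> < cmod (lagrange_bracket F G y)) at_top"
      using tendsto_norm[OF l(2)] \<open>\<delta> < cmod l1\<close> by (rule order_tendstoD(1))
    then obtain R where R: "\<And>y. R \<le> y \<Longrightarrow> \<delta> < cmod (lagrange_bracket F G y)" by (auto simp: eventually_at_top_linorder)
    obtain S1 B1 where S1: "\<And>y. 0 < y \<Longrightarrow> (S1 has_real_derivative (cmod (F y))\<^sup>2) (at y)" "\<And>y. 0 < y \<Longrightarrow> S1 y \<le> B1"
      using square_integrable_primitive[OF f(2) regularD(2)[OF f(1)]] by metis
    obtain S2 B2 where S2: "\<And>y. 0 < y \<Longrightarrow> (S2 has_real_derivative (cmod (G y))\<^sup>2) (at y)" "\<And>y. 0 < y \<Longrightarrow> S2 y \<le> B2"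
      using square_integrable_primitive[OF g(2) regularD(2)[OF g(1)]] by metis
    obtain S3 B3 where S3: "\<And>y. 0 < y \<Longrightarrow> (S3 has_real_derivative (cmod (quasi F y))\<^sup>2) (at y)" "\<And>y. 0 < y \<Longrightarrow> S3 y \<le> B3"
      using quasi_primitive[OF F] by metis
    obtain S4 B4 where S4: "\<And>y. 0 < y \<Longrightarrow> (S4 has_real_derivative (cmod (quasi G y))\<^sup>2) (at y)" "\<And>y. 0 < y \<Longrightarrow> S4 y \<le> B4"
      using quasi_primitive[OF G] by metis
    have "\<exists>y\<ge>max 1 R. (cmod (F y))\<^sup>2 + (cmod (G y))\<^sup>2 + (cmod (quasi F y))\<^sup>2 + (cmod (quasi G y))\<^sup>2 < \<delta>"
    proof (rule bounded_above_imp_small_derivative[OF _ _ \<open>0 < \<delta>\<close>])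
      fix y assume "max 1 R \<le> y"
      then have y: "0 < y" by simp
      show "((\<lambda>y. S1 y + S2 y + S3 y + S4 y) has_real_derivative (cmod (F y))\<^sup>2 + (cmod (G y))\<^sup>2 + (cmod (quasi F y))\<^sup>2 + (cmod (quasi G y))\<^sup>2) (at y)"
        by (intro DERIV_add S1 S2 S3 S4 y)
      show "S1 y + S2 y + S3 y + S4 y \<le> B1 + B2 + B3 + B4"
        by (intro add_mono S1 S2 S3 S4 y)
    qed
    then obtain y where y: "max 1 R \<le> y" "(cmod (F y))\<^sup>2 + (cmod (G y))\<^sup>2 + (cmod (quasi F y))\<^sup>2 + (cmod (quasi G y))\<^sup>2 < \<delta>" by blast
    have "cmod (lagrange_bracket F G y) \<le> cmod (F y) * cmod (quasi G y) + cmod (quasi F y) * cmod (G y)"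
      unfolding bracket_quasi using norm_triangle_ineq4[of "F y * cnj (quasi G y)" "quasi F y * cnj (G y)"] by (simp add: norm_mult)
    also have "\<dots> \<le> (cmod (F y))\<^sup>2 + (cmod (G y))\<^sup>2 + (cmod (quasi F y))\<^sup>2 + (cmod (quasi G y))\<^sup>2"
    proof -
      have "2 * cmod (F y) * cmod (quasi G y) \<le> (cmod (F y))\<^sup>2 + (cmod (quasi G y))\<^sup>2"
        "2 * cmod (quasi F y) * cmod (G y) \<le> (cmod (quasi F y))\<^sup>2 + (cmod (G y))\<^sup>2"
        by (rule sum_squares_bound)+
      moreover have "0 \<le> cmod (F y) * cmod (quasi G y)" "0 \<le> cmod (quasi F y) * cmod (G y)" by simp_all
      ultimately show ?thesis by linarith
    qed
    finally show False using y R[of y] by simp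
  qed
  then show "(lagrange_bracket F G \<longlongrightarrow> 0) at_top" using l(2) by simp
  have "l0 = complex_of_real (2 * \<nu>) * (\<alpha> F * cnj (\<beta> G) - \<beta> F * cnj (\<alpha> G))"
    using l(1) zero by (rule tendsto_unique[rotated]) simp
  then show "(LINT x|half_line. tau \<nu> F x * cnj (G x)) - (LINT x|half_line. F x * cnj (tau \<nu> G x))
      = - complex_of_real (2 * \<nu>) * (\<alpha> F * cnj (\<beta> G) - \<beta> F * cnj (\<alpha> G))"
    using l(3) \<open>l1 = 0\<close> i by simp
qed

text \<open>The boundary term tends to \<open>2\<nu> \<beta> F cnj (\<alpha> F)\<close> at \<open>0\<close>, since \<open>x powr (2\<nu>)\<close> tends to \<open>0\<close>, and is small
somewhere arbitrarily far out.\<close>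

lemma energy_lower_bound:
  assumes F: "maximal_function \<nu> F"
  shows "2 * \<nu> * Re (\<beta> F * cnj (\<alpha> F)) \<le> Re (LINT x|half_line. tau \<nu> F x * cnj (F x))"
proof (rule field_le_epsilon)
  fix \<epsilon> :: real assume "0 < \<epsilon>"
  obtain K l0 l1 where K: "(K \<longlongrightarrow> l0) (at_right 0)" "(K \<longlongrightarrow> l1) at_top"
    "(LINT x|half_line. tau \<nu> F x * cnj (F x)) = l1 - l0"
    "\<forall>y>0. ((\<lambda>x. Re (quasi F x * cnj (F x) + K x)) has_real_derivative (cmod (quasi F y))\<^sup>2) (at y)"
    "\<forall>a b. 0 < a \<longrightarrow> a \<le> b \<longrightarrow> Re (quasi F a * cnj (F a) + K a) \<le> Re (quasi F b * cnj (F b) + K b)"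
    by (rule energy_primitive[OF F])
  \<comment> \<open>The factor \<open>0 powr (2 * \<nu>)\<close> is \<open>0\<close>; it is carried along only to match the limit rule for \<open>powr\<close>.\<close>
  have E0: "((\<lambda>x. quasi F x * cnj (F x)) \<longlongrightarrow> complex_of_real (2 * \<nu>) *
      (\<beta> F * cnj (\<alpha> F) + \<beta> F * cnj (\<beta> F) * complex_of_real (0 powr (2 * \<nu>)))) (at_right 0)"
  proof (rule Lim_transform_eventually)
    have "((\<lambda>x. x powr (2 * \<nu>)) \<longlongrightarrow> 0 powr (2 * \<nu>)) (at_right 0)"
    proof (rule tendsto_powr2[OF tendsto_ident_at tendsto_const])
      show "eventually (\<lambda>x. 0 \<le> x) (at_right (0::real))"
        using eventually_at_right_less[of "0::real"] by (rule eventually_mono) simp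
    qed (use \<nu> in simp)
    then show "((\<lambda>x. complex_of_real (2 * \<nu>) *
      (cv F x * cnj (cu F x) + cv F x * cnj (cv F x) * complex_of_real (x powr (2 * \<nu>)))) \<longlongrightarrow> complex_of_real (2 * \<nu>) *
      (\<beta> F * cnj (\<alpha> F) + \<beta> F * cnj (\<beta> F) * complex_of_real (0 powr (2 * \<nu>)))) (at_right 0)"
      by (intro tendsto_add tendsto_mult tendsto_const tendsto_cnj tendsto_of_real tendsto_\<alpha> tendsto_\<beta> F)
    show "eventually (\<lambda>x. complex_of_real (2 * \<nu>) *
      (cv F x * cnj (cu F x) + cv F x * cnj (cv F x) * complex_of_real (x powr (2 * \<nu>))) = quasi F x * cnj (F x)) (at_right 0)"
      using eventually_at_right_less[of 0] by (rule eventually_mono) (simp add: quasi_cnj)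
  qed
  have "eventually (\<lambda>y. Re (K y) < Re l1 + \<epsilon>/2) at_top"
    using tendsto_Re[OF K(2)] \<open>0 < \<epsilon>\<close> by (intro order_tendstoD(2)) auto
  then obtain R where R: "\<And>y. R \<le> y \<Longrightarrow> Re (K y) < Re l1 + \<epsilon>/2" by (auto simp: eventually_at_top_linorder)
  obtain z where z: "max 1 R \<le> z" "Re (quasi F z * cnj (F z)) < \<epsilon>/2"
    using energy_frequently_small[OF F, of "max 1 R" "\<epsilon>/2"] \<open>0 < \<epsilon>\<close> by auto
  have "((\<lambda>x. Re (quasi F x * cnj (F x) + K x)) \<longlongrightarrow> Re (complex_of_real (2 * \<nu>) *
      (\<beta> F * cnj (\<alpha> F) + \<beta> F * cnj (\<beta> F) * complex_of_real (0 powr (2 * \<nu>))) + l0)) (at_right 0)"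
    by (intro tendsto_Re tendsto_add E0 K)
  then have "Re (complex_of_real (2 * \<nu>) *
      (\<beta> F * cnj (\<alpha> F) + \<beta> F * cnj (\<beta> F) * complex_of_real (0 powr (2 * \<nu>))) + l0) \<le> Re (quasi F z * cnj (F z) + K z)"
  proof (rule tendsto_upperbound)
    have "0 < z" using z by simp
    then have "eventually (\<lambda>x. 0 < x \<and> x < z) (at_right 0)" by (rule eventually_at_right_real[THEN eventually_mono]) auto
    then show "eventually (\<lambda>x. Re (quasi F x * cnj (F x) + K x) \<le> Re (quasi F z * cnj (F z) + K z)) (at_right 0)"
      by (rule eventually_mono) (intro K(5)[rule_format], auto)
  qed simp
  then have "2 * \<nu> * Re (\<beta> F * cnj (\<alpha> F)) + Re l0 \<le> Re (quasi F z * cnj (F z)) + Re (K z)"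
    using \<nu> by (simp only: plus_complex.sel Re_complex_of_real) (simp add: algebra_simps)
  moreover have "Re (LINT x|half_line. tau \<nu> F x * cnj (F x)) = Re l1 - Re l0" unfolding K(3) by simp
  ultimately show "2 * \<nu> * Re (\<beta> F * cnj (\<alpha> F)) \<le> Re (LINT x|half_line. tau \<nu> F x * cnj (F x)) + \<epsilon>"
    using z R[of z] by simp
qed

lemma solution_exists:
  assumes k: "locally_integrable k" and r: "0 < r"
  obtains F where "regular F" "AE x in half_line. tau \<nu> F x = k x"
    "ac_derivative (cu F) (\<lambda>x. k x * v x / complex_of_real (2 * \<nu>))"
    "ac_derivative (cv F) (\<lambda>x. - (k x * u x / complex_of_real (2 * \<nu>)))"
    "cu F r = A" "cv F r = B"
proof -
  let ?W = "complex_of_real (2 * \<nu>)"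
  have W: "?W \<noteq> 0" using \<nu> by simp
  have "continuous_on {0<..} (\<lambda>x. v x / ?W)" "continuous_on {0<..} (\<lambda>x. - (u x / ?W))"
    using W by (intro continuous_intros continuous_uv; simp)+
  from this[THEN locally_integrable_mult_continuous[OF k]]
  have loc: "locally_integrable (\<lambda>x. k x * v x / ?W)" "locally_integrable (\<lambda>x. - (k x * u x / ?W))" by simp_all
  obtain a where a: "ac_derivative a (\<lambda>x. k x * v x / ?W)" "a r = A" by (rule ac_primitive_exists[OF loc(1) r])
  obtain b where b: "ac_derivative b (\<lambda>x. - (k x * u x / ?W))" "b r = B" by (rule ac_primitive_exists[OF loc(2) r])
  define F where "F x = a x * u x + b x * v x" for x
  define G where "G x = a x * u' x + b x * v' x" for x
  have FG: "ac_derivative F G"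
  proof -
    have "ac_derivative F (\<lambda>x. (a x * u' x + k x * v x / ?W * u x) + (b x * v' x + - (k x * u x / ?W) * v x))"
      unfolding F_def by (intro ac_derivative_add ac_derivative_mult a b ac_u ac_v)
    then show ?thesis by (rule ac_derivative_cong) (auto simp: G_def algebra_simps)
  qed
  have G: "ac_derivative G (\<lambda>x. q x * F x - k x)"
  proof -
    have "ac_derivative G (\<lambda>x. (a x * (q x * u x) + k x * v x / ?W * u' x) + (b x * (q x * v x) + - (k x * u x / ?W) * v' x))"
      unfolding G_def by (intro ac_derivative_add ac_derivative_mult a b ac_u' ac_v')
    then show ?thesis
    proof (rule ac_derivative_cong[OF _ refl], intro AE_I2)
      fix x assume "x \<in> space half_line" then have x: "0 < x" by simp
      have "(a x * (q x * u x) + k x * v x / ?W * u' x) + (b x * (q x * v x) + - (k x * u x / ?W) * v' x)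
        = q x * F x - k x * (u x * v' x - u' x * v x) / ?W"
        using W by (simp add: F_def field_simps)
      also have "\<dots> = q x * F x - k x" unfolding wronskian[OF x] using W by simp
      finally show "(a x * (q x * u x) + k x * v x / ?W * u' x) + (b x * (q x * v x) + - (k x * u x / ?W) * v' x) = q x * F x - k x" .
    qed
  qed
  note R = regularI[OF FG G]
  have cuF: "cu F x = a x" if x: "0 < x" for x
  proof -
    have "cu F x = a x * (u x * v' x - u' x * v x) / ?W"
      using W unfolding cu_def R(2)[OF x] unfolding F_def G_def by (simp add: field_simps)
    then show ?thesis unfolding wronskian[OF x] using W by simp
  qed
  have cvF: "cv F x = b x" if x: "0 < x" for x
  proof -
    have "cv F x = b x * (u x * v' x - u' x * v x) / ?W"
      using W unfolding cv_def R(2)[OF x] unfolding F_def G_def by (simp add: field_simps)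
    then show ?thesis unfolding wronskian[OF x] using W by simp
  qed
  show ?thesis
  proof (rule that[OF R(1)])
    from R(3)[of \<nu>] show "AE x in half_line. tau \<nu> F x = k x" by eventually_elim (simp add: q_def)
    show "ac_derivative (cu F) (\<lambda>x. k x * v x / ?W)" using a(1) by (rule ac_derivative_cong) (auto simp: cuF)
    show "ac_derivative (cv F) (\<lambda>x. - (k x * u x / ?W))" using b(1) by (rule ac_derivative_cong) (auto simp: cvF)
    show "cu F r = A" "cv F r = B" using a b r by (auto simp: cuF cvF)
  qed
qed

end

section \<open>Functions with prescribed boundary values\<close>

lemma powr_has_integral:
  fixes a b \<gamma> :: real
  assumes "0 < a" "a \<le> b" "\<gamma> \<noteq> 0"
  shows "((\<lambda>x. x powr (\<gamma> - 1)) has_integral (b powr \<gamma> - a powr \<gamma>) / \<gamma>) {a..b}"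
proof -
  have "((\<lambda>x. x powr \<gamma> / \<gamma>) has_vector_derivative x powr (\<gamma> - 1)) (at x within {a..b})" if "x \<in> {a..b}" for x
    unfolding has_real_derivative_iff_has_vector_derivative[symmetric]
    using that assms by (auto intro!: derivative_eq_intros)
  from fundamental_theorem_of_calculus[OF assms(2) this] show ?thesis by (simp add: diff_divide_distrib)
qed

lemma integral_pos_continuous:
  fixes g :: "real \<Rightarrow> real"
  assumes g: "continuous_on {a..b} g" and nonneg: "\<And>x. x \<in> {a..b} \<Longrightarrow> 0 \<le> g x"
    and c: "c \<in> {a..b}" "0 < g c" and ab: "a < b"
  shows "0 < integral {a..b} g"
proof -
  have "integral {a..b} g \<noteq> 0"
  proof
    assume "integral {a..b} g = 0"
    then have "(g has_integral 0) (cbox a b)"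
      using integrable_integral[OF integrable_continuous_real[OF g]] by simp
    then have "g c = 0"
      by (rule has_integral_0_cbox_imp_0[OF g[folded box_real(2)], rotated 1]) (use nonneg c ab in auto)
    with c show False by simp
  qed
  moreover have "0 \<le> integral {a..b} g"
    by (intro integral_nonneg integrable_continuous_real g nonneg)
  ultimately show ?thesis by simp
qed

lemma ac_derivative_diff_integral:
  assumes P: "ac_derivative P p" and ab: "0 < a" "a \<le> b"
  shows "P a = P b - integral {a..b} p"
  using integral_unique[OF ac_derivative_ftc[OF P ab]] by simp

lemma measurable_continuous_half_line: "continuous_on {0<..} F \<Longrightarrow> F \<in> borel_measurable half_line"
  by (rule continuous_imp_measurable_on_sets_lebesgue) auto

lemma square_integrable_continuous_restrict:
  assumes F: "continuous_on {0<..} F" and ab: "0 < a"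
  shows "square_integrable (\<lambda>x. if x \<in> {a..b} then F x else 0)"
proof -
  have "bounded (F ` {a..b})"
    using ab by (intro compact_imp_bounded compact_continuous_image continuous_on_subset[OF F]) auto
  then obtain B where B: "\<And>x. x \<in> {a..b} \<Longrightarrow> cmod (F x) \<le> B" unfolding bounded_iff by (meson imageI)
  have m: "(\<lambda>x. if x \<in> {a..b} then F x else 0) \<in> borel_measurable half_line"
  proof (rule measurable_If)
    have "{x \<in> space half_line. x \<in> {a..b}} = {0<..} \<inter> {a..b}" by auto
    then show "{x \<in> space half_line. x \<in> {a..b}} \<in> sets half_line" by (auto simp: sets_restrict_space)
  qed (simp_all add: measurable_continuous_half_line F)
  show ?thesis
    by (rule square_integrable_bounded_support[OF m, of "max B 0" b]) (use B in \<open>auto simp: le_max_iff_disj\<close>)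
qed

context bessel
begin

text \<open>Let the coefficients vanish at \<open>r\<close>. They then vanish beyond \<open>r\<close>, where \<open>k\<close> is zero, and are constant below
\<open>p\<close>, where they equal the moments of \<open>k\<close> against \<open>v\<close> and \<open>u\<close> up to sign and the factor \<open>2\<nu>\<close>. Zero moments
produce functions with compact support in \<open>(0,\<infinity>)\<close>, other moments arbitrary boundary values.\<close>

lemma cutoff_solution:
  assumes k: "square_integrable k" and supp: "\<And>x. x \<notin> {p..r} \<Longrightarrow> k x = 0" and pr: "0 < p" "p \<le> r"
    and ku: "integral {p..r} (\<lambda>x. k x * u x) = complex_of_real (2 * \<nu>) * B"
    and kv: "integral {p..r} (\<lambda>x. k x * v x) = - complex_of_real (2 * \<nu>) * A"
  obtains F where "maximal_function \<nu> F" "AE x in half_line. tau \<nu> F x = k x" "\<alpha> F = A" "\<beta> F = B"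
    "\<forall>x\<ge>r. F x = 0" "\<forall>x. 0 < x \<longrightarrow> x \<le> p \<longrightarrow> F x = A * u x + B * v x"
    "\<forall>x. 0 < x \<longrightarrow> x \<le> r \<longrightarrow> complex_of_real (2 * \<nu>) * F x =
      integral {x..r} (\<lambda>t. k t * u t) * v x - integral {x..r} (\<lambda>t. k t * v t) * u x"
proof -
  let ?W = "complex_of_real (2 * \<nu>)"
  have W: "?W \<noteq> 0" using \<nu> by simp
  have loc: "locally_integrable k" by (rule square_integrable_imp_local[OF k])
  have r: "0 < r" using pr by simp
  obtain F where F: "regular F" "AE x in half_line. tau \<nu> F x = k x"
    "ac_derivative (cu F) (\<lambda>x. k x * v x / ?W)"
    "ac_derivative (cv F) (\<lambda>x. - (k x * u x / ?W))"
    "cu F r = 0" "cv F r = 0" by (rule solution_exists[OF loc r])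
  have cu: "cu F x = - integral {x..r} (\<lambda>t. k t * v t) / ?W" if "0 < x" "x \<le> r" for x
    using ac_derivative_diff_integral[OF F(3) that] F(5) by simp
  have cv: "cv F x = integral {x..r} (\<lambda>t. k t * u t) / ?W" if "0 < x" "x \<le> r" for x
    using ac_derivative_diff_integral[OF F(4) that] F(6) by simp
  have low: "integral {x..r} (\<lambda>t. k t * f t) = integral {p..r} (\<lambda>t. k t * f t)" if "x \<le> p" for x and f :: "real \<Rightarrow> complex"
  proof -
    have eq: "(\<lambda>t. if t \<in> {p..r} then k t * f t else 0) = (\<lambda>t. k t * f t)" using supp by auto
    have "integral {x..r} (\<lambda>t. if t \<in> {p..r} then k t * f t else 0) = integral {p..r} (\<lambda>t. k t * f t)"
      unfolding integral_restrict_Int using that by (simp add: Int_absorb1 Int_absorb2 atLeastatMost_subset_iff)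
    then show ?thesis unfolding eq .
  qed
  have cu_low: "cu F x = A" and cv_low: "cv F x = B" if "0 < x" "x \<le> p" for x
    using that pr W by (simp_all add: cu cv low ku kv)
  have zero: "cu F x = 0 \<and> cv F x = 0" if "r \<le> x" for x
  proof -
    have *: "integral {r..x} (\<lambda>t. k t * f t / c) = 0" for f :: "real \<Rightarrow> complex" and c
    proof -
      have "integral {r..x} (\<lambda>t. k t * f t / c) = integral {r..x} (\<lambda>t. 0)"
        by (rule integral_spike[of "{r}"]) (use supp in auto)
      then show ?thesis by simp
    qed
    have "integral {r..x} (\<lambda>t. - (k t * u t / ?W)) = 0" using *[of u "-?W"] by simp
    then show ?thesis
      using ac_derivative_diff_integral[OF F(3) r that] ac_derivative_diff_integral[OF F(4) r that] F(5,6) *[of v ?W] \<nu> by simp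
  qed
  have Fzero: "F x = 0" if "r \<le> x" for x using zero[OF that] cu_cv_expand(1)[of x F] that r by simp
  have Flow: "F x = A * u x + B * v x" if "0 < x" "x \<le> p" for x
    using cu_cv_expand(1)[OF that(1), of F] cu_low[OF that] cv_low[OF that] by simp
  have sF: "square_integrable F"
  proof -
    have c: "continuous_on {0<..} F" by (rule regularD(2)[OF F(1)])
    have i: "square_integrable (\<lambda>x. if x \<le> p then u x else 0)" "square_integrable (\<lambda>x. if x \<le> p then v x else 0)"
      unfolding u_def v_def using \<nu> by (auto intro!: square_integrable_powr)
    have "square_integrable (\<lambda>x. (A * (if x \<le> p then u x else 0) + B * (if x \<le> p then v x else 0))
        + (if x \<in> {p..r} then F x - (if x = p then F x else 0) else 0))"
    proof (intro square_integrable_add square_integrable_scale i)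
      have "AE x in half_line. (if x \<in> {p..r} then F x else 0) = (if x \<in> {p..r} then F x - (if x = p then F x else 0) else 0)"
        unfolding AE_half_line_iff by (rule negligible_subset[of "{p}"]) auto
      then show "square_integrable (\<lambda>x. if x \<in> {p..r} then F x - (if x = p then F x else 0) else 0)"
        by (rule square_integrable_cong[OF square_integrable_continuous_restrict[OF c pr(1)]])
    qed
    then show ?thesis
    proof (rule square_integrable_cong, intro AE_I2)
      fix x assume "x \<in> space half_line"
      then show "(A * (if x \<le> p then u x else 0) + B * (if x \<le> p then v x else 0))
        + (if x \<in> {p..r} then F x - (if x = p then F x else 0) else 0) = F x"
        using Flow[of x] Fzero[of x] by auto
    qed
  qed
  have "square_integrable (tau \<nu> F)"
    by (rule square_integrable_cong[OF k]) (use F(2) in \<open>auto simp: eq_commute\<close>)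
  then have max: "maximal_function \<nu> F" using F(1) sF by (simp add: maximal_function_def)
  have ev: "eventually (\<lambda>x. 0 < x \<and> x \<le> p) (at_right 0)"
    using eventually_at_right_real[OF pr(1)] by (rule eventually_mono) auto
  have "eventually (\<lambda>x. cu F x = A) (at_right 0)" using ev by (rule eventually_mono) (use cu_low in auto)
  then have \<alpha>: "\<alpha> F = A"
    using tendsto_unique[OF trivial_limit_at_right_real tendsto_\<alpha>[OF max] tendsto_eventually] by blast
  have "eventually (\<lambda>x. cv F x = B) (at_right 0)" using ev by (rule eventually_mono) (use cv_low in auto)
  then have \<beta>: "\<beta> F = B"
    using tendsto_unique[OF trivial_limit_at_right_real tendsto_\<beta>[OF max] tendsto_eventually] by blast
  have rep: "?W * F x = integral {x..r} (\<lambda>t. k t * u t) * v x - integral {x..r} (\<lambda>t. k t * v t) * u x"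
    if x: "0 < x" "x \<le> r" for x
    using cu_cv_expand(1)[OF x(1), of F] cu[OF x] cv[OF x] W by (simp add: field_simps)
  show ?thesis
    by (rule that[OF max F(2) \<alpha> \<beta>]) (use Fzero Flow rep in auto)
qed

text \<open>In the variable \<open>s = x powr (2\<nu>)\<close> the weight \<open>x powr (3\<nu> - 3/2)\<close> turns the moments against \<open>u\<close> and \<open>v\<close>
into the moments of order \<open>0\<close> and \<open>1\<close> of Lebesgue measure (up to a factor \<open>2\<nu>\<close>), which are explicit.\<close>

lemma moment_integral:
  assumes "0 < s" "s \<le> t"
  shows "((\<lambda>x. complex_of_real (x powr (3 * \<nu> - 3/2 + 2 * \<nu> * real j)) * u x) has_integral
      complex_of_real ((t ^ Suc j - s ^ Suc j) / (2 * \<nu> * Suc j))) {s powr (1 / (2 * \<nu>))..t powr (1 / (2 * \<nu>))}"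
proof -
  let ?a = "s powr (1 / (2 * \<nu>))" and ?b = "t powr (1 / (2 * \<nu>))" and ?\<gamma> = "2 * \<nu> * Suc j"
  have ab: "0 < ?a" "?a \<le> ?b" "?\<gamma> \<noteq> 0" using assms \<nu> by (auto intro!: powr_mono2)
  have e: "?b powr ?\<gamma> = t ^ Suc j" "?a powr ?\<gamma> = s ^ Suc j"
    using assms \<nu> by (simp_all add: powr_powr powr_realpow[symmetric] del: power_Suc)
  have "((\<lambda>x. complex_of_real (x powr (?\<gamma> - 1))) has_integral complex_of_real ((?b powr ?\<gamma> - ?a powr ?\<gamma>) / ?\<gamma>)) {?a..?b}"
    by (rule has_integral_of_real[OF powr_has_integral[OF ab]])
  then show ?thesis unfolding e
  proof (rule has_integral_eq[rotated])
    fix x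
    show "complex_of_real (x powr (?\<gamma> - 1)) = complex_of_real (x powr (3 * \<nu> - 3/2 + 2 * \<nu> * real j)) * u x"
      unfolding u_def of_real_mult[symmetric] powr_add[symmetric] by (simp add: algebra_simps)
  qed
qed

lemma weight_v: "complex_of_real (x powr (3 * \<nu> - 3/2 + 2 * \<nu> * real j)) * v x
    = complex_of_real (x powr (3 * \<nu> - 3/2 + 2 * \<nu> * real (Suc j))) * u x"
  unfolding v_def u_def of_real_mult[symmetric] powr_add[symmetric] by (simp add: algebra_simps)

text \<open>A right-hand side of the form weight times \<open>c\<^sub>0 + c\<^sub>1 s\<close> on \<open>s \<in> [1,2]\<close>. The Gram matrix of \<open>1\<close> and \<open>s\<close> there has
determinant \<open>7/3 - 9/4 = 1/12\<close>; each moment brings a factor \<open>1/2\<nu>\<close>, whence the constant \<open>48\<nu>\<^sup>2\<close>.\<close>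

lemma prescribed_moments:
  obtains k p r where "square_integrable k" "\<forall>x. x \<notin> {p..r} \<longrightarrow> k x = 0" "0 < p" "p \<le> r"
    "integral {p..r} (\<lambda>x. k x * u x) = A" "integral {p..r} (\<lambda>x. k x * v x) = B"
proof -
  define p where "p = 1 powr (1 / (2 * \<nu>))"
  define r where "r = 2 powr (1 / (2 * \<nu>))"
  have pr: "0 < p" "p \<le> r" using \<nu> by (auto simp: p_def r_def intro!: ge_one_powr_ge_zero)
  define I where "I j = complex_of_real ((2 ^ Suc j - 1 ^ Suc j) / (2 * \<nu> * Suc j))" for j
  define W where "W j x = complex_of_real (x powr (3 * \<nu> - 3/2 + 2 * \<nu> * real j))" for j x
  have WI: "((\<lambda>x. W j x * u x) has_integral I j) {p..r}" for j
    unfolding W_def I_def p_def r_def by (rule moment_integral) auto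
  have Wv: "W j x * v x = W (Suc j) x * u x" for j x unfolding W_def by (rule weight_v)
  define N where "N = complex_of_real \<nu>"
  have N: "N \<noteq> 0" using \<nu> by (simp add: N_def)
  have I: "I 0 = 1 / (2 * N)" "I 1 = 3 / (4 * N)" "I 2 = 7 / (6 * N)"
    by (simp_all add: I_def N_def power2_eq_square)
  define c0 where "c0 = 48 * N\<^sup>2 * (A * I 2 - B * I 1)"
  define c1 where "c1 = 48 * N\<^sup>2 * (B * I 0 - A * I 1)"
  define k0 where "k0 x = c0 * W 0 x + c1 * W 1 x" for x
  have ck0: "continuous_on {0<..} k0" unfolding k0_def W_def by (intro continuous_intros) auto
  define k where "k x = (if x \<in> {p..r} then k0 x else 0)" for x
  have "((\<lambda>x. c0 * (W 0 x * u x) + c1 * (W 1 x * u x)) has_integral c0 * I 0 + c1 * I 1) {p..r}"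
    by (intro has_integral_add has_integral_mult_right WI)
  then have "((\<lambda>x. k x * u x) has_integral c0 * I 0 + c1 * I 1) {p..r}"
    by (rule has_integral_eq[rotated]) (simp add: k_def k0_def algebra_simps)
  moreover have "c0 * I 0 + c1 * I 1 = A"
    using N unfolding c0_def c1_def I by (simp add: field_simps power2_eq_square)
  ultimately have u: "integral {p..r} (\<lambda>x. k x * u x) = A" by (simp add: integral_unique)
  have "((\<lambda>x. c0 * (W 1 x * u x) + c1 * (W 2 x * u x)) has_integral c0 * I 1 + c1 * I 2) {p..r}"
    by (intro has_integral_add has_integral_mult_right WI)
  then have "((\<lambda>x. k x * v x) has_integral c0 * I 1 + c1 * I 2) {p..r}"
  proof (rule has_integral_eq[rotated])
    fix x assume "x \<in> {p..r}"
    then have "k x * v x = c0 * (W 0 x * v x) + c1 * (W 1 x * v x)" by (simp add: k_def k0_def algebra_simps)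
    then show "c0 * (W 1 x * u x) + c1 * (W 2 x * u x) = k x * v x" by (simp add: Wv numeral_2_eq_2)
  qed
  moreover have "c0 * I 1 + c1 * I 2 = B"
    using N unfolding c0_def c1_def I by (simp add: field_simps power2_eq_square)
  ultimately have v: "integral {p..r} (\<lambda>x. k x * v x) = B" by (simp add: integral_unique)
  have "square_integrable k" unfolding k_def[abs_def] by (rule square_integrable_continuous_restrict[OF ck0 pr(1)])
  then show ?thesis by (rule that[OF _ _ pr u v]) (simp add: k_def)
qed

lemma boundary_values_surjective:
  obtains F where "maximal_function \<nu> F" "\<alpha> F = A" "\<beta> F = B"
proof -
  obtain k p r where k: "square_integrable k" "\<forall>x. x \<notin> {p..r} \<longrightarrow> k x = 0" "0 < p" "p \<le> r"
    "integral {p..r} (\<lambda>x. k x * u x) = complex_of_real (2 * \<nu>) * B" "integral {p..r} (\<lambda>x. k x * v x) = - complex_of_real (2 * \<nu>) * A"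
    by (rule prescribed_moments)
  obtain F where "maximal_function \<nu> F" "\<alpha> F = A" "\<beta> F = B"
    by (rule cutoff_solution[OF k(1) k(2)[rule_format] k(3-6)])
  then show ?thesis by (rule that)
qed

text \<open>The trial function is the cut-off solution for \<open>k = - \<kappa>\<close> times the weight, on \<open>s \<in> [1/2m, 3/2m]\<close>. The
quotient of its moments against \<open>v\<close> and \<open>u\<close> is the midpoint \<open>1/m\<close> of that interval, so the boundary values
are proportional to \<open>(1, - m)\<close>, and \<open>\<kappa>\<close> normalises them. Since \<open>v / u\<close> is increasing, the function
is positive where \<open>k\<close> is negative, apart from the right end of the interval, where it vanishes.\<close>

lemma negative_energy:
  assumes m: "0 < m"
  obtains F where "maximal_function \<nu> F" "\<alpha> F = 1" "\<beta> F = - complex_of_real m"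
    "Re (LINT x|half_line. tau \<nu> F x * cnj (F x)) < 0"
proof -
  define s where "s = 1 / (2 * m)"
  define t where "t = 3 / (2 * m)"
  have st: "0 < s" "s < t" using m by (simp_all add: s_def t_def divide_strict_right_mono)
  define p where "p = s powr (1 / (2 * \<nu>))"
  define r where "r = t powr (1 / (2 * \<nu>))"
  have pr: "0 < p" "p < r" using st \<nu> by (auto simp: p_def r_def intro!: powr_less_mono2)
  define \<kappa> where "\<kappa> = 4 * \<nu>\<^sup>2 * m\<^sup>2"
  have \<kappa>: "0 < \<kappa>" using m \<nu> by (simp add: \<kappa>_def)
  define w where "w x = x powr (3 * \<nu> - 3/2)" for x :: real
  define k where "k x = (if x \<in> {p..r} then - complex_of_real (\<kappa> * w x) else 0)" for x
  have wI: "((\<lambda>x. complex_of_real (w x) * u x) has_integral complex_of_real ((t - s) / (2 * \<nu>))) {p..r}"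
    using moment_integral[of s t 0] st unfolding w_def p_def r_def by simp
  have wv: "complex_of_real (w x) * v x = complex_of_real (x powr (3 * \<nu> - 3/2 + 2 * \<nu> * real 1)) * u x" for x
    using weight_v[of x 0] unfolding w_def by simp
  have vI: "((\<lambda>x. complex_of_real (w x) * v x) has_integral complex_of_real ((t\<^sup>2 - s\<^sup>2) / (4 * \<nu>))) {p..r}"
    unfolding wv using moment_integral[of s t 1] st unfolding p_def r_def by (simp add: power2_eq_square)
  have "((\<lambda>x. - complex_of_real \<kappa> * (complex_of_real (w x) * u x)) has_integral - complex_of_real \<kappa> * complex_of_real ((t - s) / (2 * \<nu>))) {p..r}"
    by (rule has_integral_mult_right[OF wI])
  then have kuI: "((\<lambda>x. k x * u x) has_integral - complex_of_real \<kappa> * complex_of_real ((t - s) / (2 * \<nu>))) {p..r}"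
    by (rule has_integral_eq[rotated]) (simp add: k_def)
  have "((\<lambda>x. - complex_of_real \<kappa> * (complex_of_real (w x) * v x)) has_integral - complex_of_real \<kappa> * complex_of_real ((t\<^sup>2 - s\<^sup>2) / (4 * \<nu>))) {p..r}"
    by (rule has_integral_mult_right[OF vI])
  then have kvI: "((\<lambda>x. k x * v x) has_integral - complex_of_real \<kappa> * complex_of_real ((t\<^sup>2 - s\<^sup>2) / (4 * \<nu>))) {p..r}"
    by (rule has_integral_eq[rotated]) (simp add: k_def)
  have "\<kappa> * ((t - s) / (2 * \<nu>)) = 2 * \<nu> * m" "\<kappa> * ((t\<^sup>2 - s\<^sup>2) / (4 * \<nu>)) = 2 * \<nu>"
    using m \<nu> unfolding \<kappa>_def s_def t_def by (simp_all add: field_simps power2_eq_square)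
  then have e: "- complex_of_real \<kappa> * complex_of_real ((t - s) / (2 * \<nu>)) = complex_of_real (2 * \<nu>) * - complex_of_real m"
    "- complex_of_real \<kappa> * complex_of_real ((t\<^sup>2 - s\<^sup>2) / (4 * \<nu>)) = - complex_of_real (2 * \<nu>) * 1"
    unfolding mult_minus_left mult_minus_right mult_1_right by (simp_all only: of_real_mult[symmetric])
  have ku: "integral {p..r} (\<lambda>x. k x * u x) = complex_of_real (2 * \<nu>) * - complex_of_real m"
    using integral_unique[OF kuI] e(1) by simp
  have kv: "integral {p..r} (\<lambda>x. k x * v x) = - complex_of_real (2 * \<nu>) * 1"
    using integral_unique[OF kvI] e(2) by simp
  have cw: "continuous_on {0<..} (\<lambda>x. - complex_of_real (\<kappa> * w x))"
    unfolding w_def by (intro continuous_intros) auto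
  have sk: "square_integrable k"
    unfolding k_def[abs_def] by (rule square_integrable_continuous_restrict[OF cw pr(1)])
  obtain F where F: "maximal_function \<nu> F" "AE x in half_line. tau \<nu> F x = k x" "\<alpha> F = 1" "\<beta> F = - complex_of_real m"
    "\<forall>x\<ge>r. F x = 0" "\<forall>x. 0 < x \<longrightarrow> x \<le> p \<longrightarrow> F x = 1 * u x + - complex_of_real m * v x"
    "\<forall>x. 0 < x \<longrightarrow> x \<le> r \<longrightarrow> complex_of_real (2 * \<nu>) * F x =
      integral {x..r} (\<lambda>t. k t * u t) * v x - integral {x..r} (\<lambda>t. k t * v t) * u x"
    by (rule cutoff_solution[OF sk _ pr(1) _ ku kv]) (use pr in \<open>auto simp: k_def\<close>)
  have pos: "0 < Re (F x)" "Im (F x) = 0" if x: "p \<le> x" "x < r" for x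
  proof -
    have x0: "0 < x" using x pr by simp
    let ?W = "complex_of_real (2 * \<nu>)"
    define g where "g y = w y * (y powr (1/2 + \<nu>) * x powr (1/2 - \<nu>) - y powr (1/2 - \<nu>) * x powr (1/2 + \<nu>))" for y
    have cg: "continuous_on {x..r} g" unfolding g_def w_def using x0 by (intro continuous_intros) auto
    have g0: "0 \<le> g y" "y \<noteq> x \<Longrightarrow> 0 < g y" if "y \<in> {x..r}" for y
    proof -
      have y: "x \<le> y" "0 < y" using that x0 by auto
      have "g y = w y * (y powr (1/2 - \<nu>) * x powr (1/2 - \<nu>)) * (y powr (2 * \<nu>) - x powr (2 * \<nu>))"
      proof -
        have "z powr (1/2 + \<nu>) = z powr (1/2 - \<nu>) * z powr (2 * \<nu>)" for z :: real by (simp flip: powr_add add: add.commute)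
        then show ?thesis unfolding g_def by (simp add: algebra_simps)
      qed
      moreover have "x powr (2 * \<nu>) \<le> y powr (2 * \<nu>)" "y \<noteq> x \<Longrightarrow> x powr (2 * \<nu>) < y powr (2 * \<nu>)"
        using y x0 \<nu> by (auto intro!: powr_mono2 powr_less_mono2)
      ultimately show "0 \<le> g y" "y \<noteq> x \<Longrightarrow> 0 < g y" using y x0 by (auto simp: w_def)
    qed
    have gpos: "0 < integral {x..r} g"
      by (rule integral_pos_continuous[OF cg _ _ _ x(2), of r]) (use g0 x in auto)
    have sub: "{x..r} \<subseteq> {p..r}" using x by auto
    have i: "(\<lambda>t. k t * u t) integrable_on {x..r}" "(\<lambda>t. k t * v t) integrable_on {x..r}"
      using kuI kvI sub by (blast intro: integrable_subinterval_real has_integral_integrable)+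
    have "?W * F x = integral {x..r} (\<lambda>t. k t * u t) * v x - integral {x..r} (\<lambda>t. k t * v t) * u x"
      using F(7) x0 x by simp
    also have "\<dots> = integral {x..r} (\<lambda>t. k t * u t * v x - k t * v t * u x)"
      using i by (simp add: integral_diff integrable_on_mult_left)
    also have "\<dots> = integral {x..r} (\<lambda>t. complex_of_real (\<kappa> * g t))"
    proof (rule integral_cong)
      fix y assume "y \<in> {x..r}"
      then have "k y = - complex_of_real (\<kappa> * w y)" using sub by (auto simp: k_def)
      then show "k y * u y * v x - k y * v y * u x = complex_of_real (\<kappa> * g y)"
        by (simp add: g_def u_def v_def algebra_simps)
    qed
    also have "\<dots> = complex_of_real (integral {x..r} (\<lambda>t. \<kappa> * g t))"
      by (rule integral_unique, rule has_integral_of_real, rule integrable_integral)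
         (intro integrable_continuous_real continuous_intros cg)
    also have "\<dots> = complex_of_real (\<kappa> * integral {x..r} g)" by simp
    finally have "?W * F x = complex_of_real (\<kappa> * integral {x..r} g)" .
    then have "F x = complex_of_real (\<kappa> * integral {x..r} g / (2 * \<nu>))" using \<nu> by (simp add: field_simps)
    then show "0 < Re (F x)" "Im (F x) = 0" using \<kappa> gpos \<nu> by simp_all
  qed
  note fm = maximal_functionD[OF F(1)]
  have cF: "continuous_on {0<..} F" by (rule regularD(2)[OF fm(1)])
  define G where "G x = \<kappa> * (w x * Re (F x))" for x
  have cG: "continuous_on {p..r} G" unfolding G_def w_def using pr
    by (intro continuous_intros continuous_on_subset[OF cF]) auto
  have G0: "0 \<le> G x" "x < r \<Longrightarrow> 0 < G x" if "x \<in> {p..r}" for x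
  proof -
    have "0 < w x" using that pr by (simp add: w_def)
    moreover have "0 \<le> Re (F x)" using pos(1)[of x] F(5) that by (cases "x = r") auto
    ultimately show "0 \<le> G x" "x < r \<Longrightarrow> 0 < G x" using pos(1)[of x] \<kappa> that by (simp_all add: G_def)
  qed
  have Gpos: "0 < integral {p..r} G"
    by (rule integral_pos_continuous[OF cG _ _ _ pr(2), of p]) (use G0 pr in auto)
  have int: "integrable half_line (\<lambda>x. tau \<nu> F x * cnj (F x))" by (intro square_integrable_mult_cnj fm)
  have "(LINT x|half_line. tau \<nu> F x * cnj (F x)) = integral {0<..} (\<lambda>x. tau \<nu> F x * cnj (F x))"
    by (rule integral_half_line[OF int])
  also have "\<dots> = integral {0<..} (\<lambda>x. if x \<in> {p..r} then - complex_of_real (G x) else 0)"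
  proof (rule integral_spike[OF F(2)[unfolded AE_half_line_iff]])
    fix x assume x: "x \<in> {0<..} - {x. 0 < x \<and> tau \<nu> F x \<noteq> k x}"
    then have k: "tau \<nu> F x = k x" by auto
    have "Im (F x) = 0" if "x \<in> {p..r}" using pos(2)[of x] F(5) that by (cases "x = r") auto
    then have "x \<in> {p..r} \<Longrightarrow> cnj (F x) = complex_of_real (Re (F x))" by (simp add: complex_eq_iff)
    then show "(if x \<in> {p..r} then - complex_of_real (G x) else 0) = tau \<nu> F x * cnj (F x)"
      unfolding k by (simp add: k_def G_def)
  qed
  also have "\<dots> = integral {p..r} (\<lambda>x. - complex_of_real (G x))"
    unfolding integral_restrict_Int using pr by (simp add: Int_absorb1 Int_absorb2 subset_eq)
  also have "\<dots> = - complex_of_real (integral {p..r} G)"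
    by (intro integral_unique has_integral_neg has_integral_of_real integrable_integral integrable_continuous_real cG)
  finally have "Re (LINT x|half_line. tau \<nu> F x * cnj (F x)) < 0" using Gpos by simp
  with F(1,3,4) show ?thesis by (rule that)
qed

end

section \<open>Representatives, inner products and adjoints\<close>

lemma represents_square_integrable: "represents F f \<Longrightarrow> square_integrable F"
  by transfer simp

lemma represents_exists: "\<exists>F. represents F f"
  by transfer auto

lemma square_integrable_represents:
  assumes "square_integrable F" shows "\<exists>f. represents F f"
proof -
  have "represents F (abs_l2 F)"
    using assms by (simp add: represents.abs_eq)
  then show ?thesis by blast
qed

lemma represents_unique: "represents F f \<Longrightarrow> represents G f \<Longrightarrow> AE x in half_line. F x = G x"
  by transfer (auto elim: eventually_elim2)

lemma represents_cong: "represents F f \<Longrightarrow> AE x in half_line. F x = G x \<Longrightarrow> represents G f"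
  using square_integrable_cong[of F G]
  by transfer (auto elim: eventually_elim2)

lemma represents_add: "represents F f \<Longrightarrow> represents G g \<Longrightarrow> represents (\<lambda>x. F x + G x) (f + g)"
  by transfer (auto intro: square_integrable_add elim: eventually_elim2)

lemma represents_scale: "represents F f \<Longrightarrow> represents (\<lambda>x. c * F x) (scaleC c f)"
  by transfer (auto intro: square_integrable_scale elim: eventually_mono)

lemma represents_diff: "represents F f \<Longrightarrow> represents G g \<Longrightarrow> represents (\<lambda>x. F x - G x) (f - g)"
  using represents_add[of F f "\<lambda>x. - 1 * G x" "scaleC (- 1) g"] represents_scale[of G g "-1"]
  by (simp add: minus_l2_def uminus_l2_def)

lemma represents_zero: "represents (\<lambda>x. 0) 0"
  by transfer (simp add: square_integrable_zero)

lemma cinner_represents: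
  assumes "represents F f" "represents G g"
  shows "cinner f g = (LINT x|half_line. F x * cnj (G x))"
  using assms
proof transfer
  fix F f G g :: "real \<Rightarrow> complex"
  assume f: "square_integrable f \<and> square_integrable f \<and> (AE x in half_line. f x = f x)"
    and g: "square_integrable g \<and> square_integrable g \<and> (AE x in half_line. g x = g x)"
    and F: "square_integrable F \<and> (AE x in half_line. F x = f x)"
    and G: "square_integrable G \<and> (AE x in half_line. G x = g x)"
  show "(LINT x|half_line. f x * cnj (g x)) = (LINT x|half_line. F x * cnj (G x))"
  proof (rule integral_cong_AE)
    show "AE x in half_line. f x * cnj (g x) = F x * cnj (G x)"
      using conjunct2[OF F] conjunct2[OF G] by eventually_elim simp
    have sq: "square_integrable f" "square_integrable g" "square_integrable F" "square_integrable G"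
      using f g F G by blast+
    show "(\<lambda>x. f x * cnj (g x)) \<in> borel_measurable half_line" "(\<lambda>x. F x * cnj (G x)) \<in> borel_measurable half_line"
      by (rule borel_measurable_integrable[OF square_integrable_mult_cnj[OF sq(1,2)]],
          rule borel_measurable_integrable[OF square_integrable_mult_cnj[OF sq(3,4)]])
  qed
qed

lemma norm_represents:
  assumes "represents F f"
  shows "(norm f)\<^sup>2 = (LINT x|half_line. (cmod (F x))\<^sup>2)"
proof -
  have "(norm f)\<^sup>2 = Re (cinner f f)" by (simp only: power2_norm_eq_inner inner_l2_def)
  also have "cinner f f = complex_of_real (LINT x|half_line. (cmod (F x))\<^sup>2)"
    unfolding cinner_represents[OF assms assms]
    by (simp add: complex_norm_square[symmetric] del: of_real_power)
  finally show ?thesis by simp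
qed

lemma represents_tendsto:
  assumes F: "\<And>n. represents (F n) (f n)" and G: "represents G g" and W: "square_integrable W"
    and dom: "\<And>n. AE x in half_line. cmod (F n x) \<le> cmod (W x)" and dom': "AE x in half_line. cmod (G x) \<le> cmod (W x)"
    and lim: "AE x in half_line. (\<lambda>n. F n x) \<longlonglongrightarrow> G x"
  shows "f \<longlonglongrightarrow> g"
proof -
  have D: "represents (\<lambda>x. F n x - G x) (f n - g)" for n by (intro represents_diff F G)
  have m: "(\<lambda>x. (cmod (F n x - G x))\<^sup>2) \<in> borel_measurable half_line" for n
    using square_integrableD(2)[OF represents_square_integrable[OF D[of n]]] by (rule borel_measurable_integrable)
  have "(\<lambda>n. LINT x|half_line. (cmod (F n x - G x))\<^sup>2) \<longlonglongrightarrow> (LINT x|half_line. (0::real))"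
  proof (rule integral_dominated_convergence[where w="\<lambda>x. 4 * (cmod (W x))\<^sup>2"])
    show "integrable half_line (\<lambda>x. 4 * (cmod (W x))\<^sup>2)" by (intro integrable_mult_right square_integrableD W)
    show "AE x in half_line. (\<lambda>n. (cmod (F n x - G x))\<^sup>2) \<longlonglongrightarrow> 0"
      using lim
    proof eventually_elim
      case (elim x)
      then have "(\<lambda>n. (cmod (F n x - G x))\<^sup>2) \<longlonglongrightarrow> (cmod (G x - G x))\<^sup>2" by (intro tendsto_intros)
      then show ?case by simp
    qed
    show "AE x in half_line. norm ((cmod (F n x - G x))\<^sup>2) \<le> 4 * (cmod (W x))\<^sup>2" for n
      using dom[of n] dom'
    proof eventually_elim
      case (elim x)
      then have "cmod (F n x - G x) \<le> 2 * cmod (W x)" using norm_triangle_ineq4[of "F n x" "G x"] by linarith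
      then have "(cmod (F n x - G x))\<^sup>2 \<le> (2 * cmod (W x))\<^sup>2" by (intro power_mono) auto
      then show ?case by (simp add: power_mult_distrib)
    qed
  qed (use m in auto)
  then have "(\<lambda>n. (norm (f n - g))\<^sup>2) \<longlonglongrightarrow> 0" using norm_represents[OF D] by simp
  then have "(\<lambda>n. sqrt ((norm (f n - g))\<^sup>2)) \<longlonglongrightarrow> sqrt 0" by (rule tendsto_real_sqrt)
  then have "(\<lambda>n. norm (f n - g)) \<longlonglongrightarrow> 0" by simp
  then show ?thesis by (simp add: tendsto_norm_zero_iff LIM_zero_iff)
qed

lemma cinner_scale: "cinner (scaleC c f) g = c * cinner f g"
  by transfer (simp add: mult.assoc)

lemma cinner_commute: "cinner g f = cnj (cinner f g)"
proof transfer
  fix F G :: "real \<Rightarrow> complex"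
  have "(LINT x|half_line. G x * cnj (F x)) = (LINT x|half_line. cnj (F x * cnj (G x)))"
    by (simp add: mult.commute)
  also have "\<dots> = cnj (LINT x|half_line. F x * cnj (G x))" by (rule Bochner_Integration.integral_cnj)
  finally show "(LINT x|half_line. G x * cnj (F x)) = cnj (LINT x|half_line. F x * cnj (G x))" .
qed

lemma continuous_on_cinner:
  fixes g :: "'a::topological_space \<Rightarrow> l2"
  assumes "continuous_on S g"
  shows "continuous_on S (\<lambda>x. cinner f (g x))" "continuous_on S (\<lambda>x. cinner (g x) f)"
proof -
  have eq: "cinner f h = Complex (inner f h) (inner (scaleC (- \<i>) f) h)" for f h
    by (simp add: inner_l2_def cinner_scale complex_eq_iff)
  show 1: "continuous_on S (\<lambda>x. cinner f (g x))"
    unfolding eq Complex_eq by (intro continuous_intros assms)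
  show "continuous_on S (\<lambda>x. cinner (g x) f)"
    unfolding cinner_commute[of _ f] by (intro continuous_intros 1)
qed

lemma closed_adjoint_op: "closed (adjoint_op A)"
proof -
  have "adjoint_op A = (\<Inter>(f,f')\<in>A. {p. cinner f' (fst p) = cinner f (snd p)})"
    by (auto simp: adjoint_op_def)
  moreover have "closed {p. cinner f' (fst p) = cinner f (snd p)}" for f f'
    by (intro closed_Collect_eq continuous_on_cinner continuous_intros)
  ultimately show ?thesis by (auto intro!: closed_INT)
qed

lemma adjoint_op_antimono: "A \<subseteq> B \<Longrightarrow> adjoint_op B \<subseteq> adjoint_op A"
  by (fastforce simp: adjoint_op_def)

lemma adjoint_op_closure: "adjoint_op (closure A) = adjoint_op A"
proof
  show "adjoint_op (closure A) \<subseteq> adjoint_op A" by (intro adjoint_op_antimono closure_subset)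
  show "adjoint_op A \<subseteq> adjoint_op (closure A)"
  proof clarify
    fix g g' assume g: "(g, g') \<in> adjoint_op A"
    have "closed {p. cinner (snd p) g = cinner (fst p) g'}"
      by (intro closed_Collect_eq continuous_on_cinner continuous_intros)
    moreover have "A \<subseteq> {p. cinner (snd p) g = cinner (fst p) g'}" using g by (auto simp: adjoint_op_def)
    ultimately have "closure A \<subseteq> {p. cinner (snd p) g = cinner (fst p) g'}" by (rule closure_minimal[rotated])
    then show "(g, g') \<in> adjoint_op (closure A)" by (auto simp: adjoint_op_def)
  qed
qed

section \<open>Density of the domain of the minimal operator\<close>

definition tame :: "real \<Rightarrow> real \<Rightarrow> real \<Rightarrow> (real \<Rightarrow> complex) \<Rightarrow> bool"
  where "tame M p r B \<longleftrightarrow> 0 < p \<and> B \<in> borel_measurable half_line \<and> (\<forall>x>0. cmod (B x) \<le> M) \<and>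
    (\<forall>x>0. x \<notin> {p..r} \<longrightarrow> B x = 0)"

lemma tame_square_integrable: "tame M p r B \<Longrightarrow> square_integrable B"
  by (rule square_integrable_bounded_support[of B M "max r 0"]) (auto simp: tame_def)

text \<open>Steklov average. Each application gains one derivative and preserves the bound. Averaging over points to
the right of \<open>x\<close> makes sense on all of \<open>(0,\<infinity>)\<close>, and for \<open>h \<le> p / 2\<close> enlarges a support in \<open>[p, r]\<close> only to \<open>[p / 2, r]\<close>.\<close>

definition average :: "real \<Rightarrow> (real \<Rightarrow> complex) \<Rightarrow> real \<Rightarrow> complex"
  where "average h B x = integral {x..x + h} B / complex_of_real h"

lemma average_primitive:
  assumes P: "ac_derivative P B" and "0 < h" "0 < x"
  shows "average h B x = (P (x + h) - P x) / complex_of_real h"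
  using integral_unique[OF ac_derivative_ftc[OF P, of x "x + h"]] assms by (simp add: average_def)

lemma continuous_on_shift_half_line:
  assumes "continuous_on {0<..} P" "0 < h"
  shows "continuous_on {0<..} (\<lambda>x::real. P (x + h) :: complex)"
  by (rule continuous_on_compose2[OF assms(1)]) (use assms(2) in \<open>auto intro!: continuous_intros\<close>)

lemma average_continuous:
  assumes "locally_integrable B" "0 < h"
  shows "continuous_on {0<..} (average h B)"
proof -
  obtain P where P: "ac_derivative P B" using ac_primitive_exists[OF assms(1) zero_less_one] by metis
  have c: "continuous_on {0<..} P" by (rule ac_derivative_continuous[OF P])
  have "continuous_on {0<..} (\<lambda>x. (P (x + h) - P x) / complex_of_real h)"
    using \<open>0 < h\<close> by (intro continuous_intros continuous_on_shift_half_line c) auto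
  then show ?thesis
    by (rule continuous_on_eq) (use average_primitive[OF P \<open>0 < h\<close>] in auto)
qed

lemma has_vector_derivative_shift_half_line:
  assumes "\<And>x. 0 < x \<Longrightarrow> (P has_vector_derivative B x) (at x)" "0 < h" "0 < x"
  shows "((\<lambda>x::real. P (x + h) :: complex) has_vector_derivative B (x + h)) (at x)"
proof -
  have "((P \<circ> (\<lambda>x. x + h)) has_vector_derivative 1 *\<^sub>R B (x + h)) (at x)"
    by (rule vector_diff_chain_at) (use assms in \<open>auto intro!: derivative_eq_intros simp: has_vector_derivative_add_const\<close>)
  then show ?thesis by (simp add: o_def)
qed

lemma average_has_vector_derivative:
  assumes B: "continuous_on {0<..} B" and "0 < h" "0 < x"
  shows "(average h B has_vector_derivative (B (x + h) - B x) / complex_of_real h) (at x)"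
proof -
  have loc: "locally_integrable B"
    unfolding locally_integrable_def
    by (intro allI impI absolutely_integrable_continuous_real continuous_on_subset[OF B]) auto
  obtain P where P: "ac_derivative P B" using ac_primitive_exists[OF loc zero_less_one] by metis
  note d = ac_derivative_imp_has_vector_derivative[OF P B]
  have "((\<lambda>x. (P (x + h) - P x) / complex_of_real h) has_vector_derivative (B (x + h) - B x) / complex_of_real h) (at x)"
    using has_vector_derivative_diff[OF has_vector_derivative_shift_half_line[OF d \<open>0 < h\<close> \<open>0 < x\<close>] d[OF \<open>0 < x\<close>]]
    by (rule has_vector_derivative_divide)
  then show ?thesis
    by (rule has_vector_derivative_transform_within_open[of _ _ _ "{0<..}"])
       (use average_primitive[OF P \<open>0 < h\<close>] \<open>0 < x\<close> in auto)
qed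

lemma tame_average:
  assumes B: "tame M p r B" and h: "0 < h" "h \<le> p / 2"
  shows "tame M (p / 2) r (average h B)"
  unfolding tame_def
proof (intro conjI allI impI)
  have loc: "locally_integrable B" by (rule square_integrable_imp_local[OF tame_square_integrable[OF B]])
  show "0 < p / 2" using B by (simp add: tame_def)
  show "average h B \<in> borel_measurable half_line"
    by (rule measurable_continuous_half_line[OF average_continuous[OF loc h(1)]])
  fix x :: real assume x: "0 < x"
  have i: "B integrable_on {x..x + h}" using loc x by (simp add: locally_integrable_def absolutely_integrable_on_def)
  have "norm (integral {x..x + h} B) \<le> integral {x..x + h} (\<lambda>x. M)"
    by (rule integral_norm_bound_integral[OF i]) (use B x in \<open>auto simp: tame_def\<close>)
  then show "cmod (average h B x) \<le> M" using h by (simp add: average_def norm_divide field_simps)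
  assume "x \<notin> {p / 2..r}"
  then have "B y = 0" if "y \<in> {x..x + h}" for y
    using B h x that by (auto simp: tame_def)
  then have "integral {x..x + h} B = integral {x..x + h} (\<lambda>x. 0)" by (intro integral_cong)
  then show "average h B x = 0" by (simp add: average_def)
qed

text \<open>The averages over shrinking intervals converge almost everywhere, by Lebesgue's differentiation theorem,
and are dominated by a fixed bounded function of bounded support.\<close>

lemma tame_in_closed:
  assumes B: "tame M p r B" and K: "closed K" and b: "represents B b"
    and av: "\<And>h c. 0 < h \<Longrightarrow> h \<le> p / 2 \<Longrightarrow> represents (average h B) c \<Longrightarrow> c \<in> K"
  shows "b \<in> K"
proof -
  have p: "0 < p" using B by (simp add: tame_def)
  define h where "h n = p / 2 / real (Suc n)" for n
  have h: "0 < h n" "h n \<le> p / 2" for n using p by (auto simp: h_def divide_le_eq mult_le_cancel_left1)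
  have h0: "h \<longlonglongrightarrow> 0"
    unfolding h_def by (rule lim_const_over_n[THEN LIMSEQ_Suc])
  have tm: "tame M (p / 2) r (average (h n) B)" for n by (rule tame_average[OF B h])
  then have "\<exists>c. represents (average (h n) B) c" for n
    by (intro square_integrable_represents tame_square_integrable)
  then obtain c where c: "\<And>n. represents (average (h n) B) (c n)" by metis
  define W where "W x = (if x \<in> {p/2..r} then complex_of_real M else 0)" for x
  have dW: "cmod (C x) \<le> cmod (W x)" if "tame M p' r C" "p / 2 \<le> p'" "0 < x" for C p' x
    using that by (auto simp: W_def tame_def)
  have W: "square_integrable W"
    unfolding W_def[abs_def] using p by (intro square_integrable_continuous_restrict) auto
  have loc: "locally_integrable B" by (rule square_integrable_imp_local[OF tame_square_integrable[OF B]])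
  obtain P where P: "ac_derivative P B" using ac_primitive_exists[OF loc zero_less_one] by metis
  have "c \<longlonglongrightarrow> b"
  proof (rule represents_tendsto[OF c b W])
    show "AE x in half_line. cmod (average (h n) B x) \<le> cmod (W x)" for n
      by (rule AE_I2) (use dW[OF tm] p in auto)
    show "AE x in half_line. cmod (B x) \<le> cmod (W x)"
      by (rule AE_I2) (use dW[OF B] p in auto)
    have "AE x in half_line. 0 < x" by (rule AE_I2) simp
    moreover have "AE x in half_line. (P has_vector_derivative B x) (at x)" using P by (simp add: ac_derivative_def)
    ultimately show "AE x in half_line. (\<lambda>n. average (h n) B x) \<longlonglongrightarrow> B x"
    proof eventually_elim
      case (elim x)
      have lim: "(\<lambda>t. norm (P (x + t) - P x - t *\<^sub>R B x) / norm t) \<midarrow>0\<rightarrow> 0"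
        using elim(2) by (simp add: has_vector_derivative_def has_derivative_at)
      have *: "norm (P (x + t) - P x - t *\<^sub>R B x) / norm t = norm ((P (x + t) - P x) /\<^sub>R t - B x)" if "t \<noteq> 0" for t
      proof -
        have "(P (x + t) - P x) /\<^sub>R t - B x = (P (x + t) - P x - t *\<^sub>R B x) /\<^sub>R t"
          using that by (simp add: scaleR_diff_right)
        then show ?thesis by (simp add: divide_inverse mult.commute)
      qed
      from lim have "((\<lambda>t. norm ((P (x + t) - P x) /\<^sub>R t - B x)) \<longlongrightarrow> 0) (at 0)"
        by (rule Lim_transform_eventually) (unfold eventually_at, use * in \<open>auto intro!: exI[of _ 1]\<close>)
      then have "((\<lambda>t. (P (x + t) - P x) /\<^sub>R t) \<longlongrightarrow> B x) (at 0)"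
        by (simp add: tendsto_norm_zero_iff LIM_zero_iff)
      moreover have "filterlim h (at 0) sequentially"
        using h0 h(1) by (auto simp: filterlim_at intro!: always_eventually) (metis less_irrefl)
      ultimately have "(\<lambda>n. (P (x + h n) - P x) /\<^sub>R h n) \<longlonglongrightarrow> B x" by (rule filterlim_compose)
      then show ?case
        by (rule filterlim_cong[THEN iffD1, rotated -1])
           (use average_primitive[OF P h(1) elim(1)] in \<open>auto simp: scaleR_conv_of_real divide_inverse mult.commute\<close>)
    qed
  qed
  then show ?thesis using K av[OF h c] by (auto simp: closed_sequential_limits)
qed

lemma smooth_in_minimal_domain:
  assumes B: "tame M p r F" and F: "\<And>x. 0 < x \<Longrightarrow> (F has_vector_derivative F1 x) (at x)"
    and F1: "\<And>x. 0 < x \<Longrightarrow> (F1 has_vector_derivative F2 x) (at x)" and F2: "continuous_on {0<..} F2"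
    and f: "represents F f"
  shows "f \<in> Domain (restrict_op (maximal_op \<nu>) compactly_supported)"
proof -
  have p: "0 < p" using B by (simp add: tame_def)
  have cF1: "continuous_on {0<..} F1" and cF: "continuous_on {0<..} F"
    using F F1 by (auto intro!: continuous_at_imp_continuous_on dest: has_vector_derivative_continuous)
  note R = regularI[OF ac_derivative_C1[OF F cF1] ac_derivative_C1[OF F1 F2]]
  have z: "F x = 0" if "0 < x" "x \<notin> {p..r}" for x using B that by (auto simp: tame_def)
  have op: "open ({0<..} - {p..r})" by (intro open_Diff) auto
  have dz: "G1 x = 0" if "\<And>x. 0 < x \<Longrightarrow> (G has_vector_derivative G1 x) (at x)"
    "\<And>x. 0 < x \<Longrightarrow> x \<notin> {p..r} \<Longrightarrow> G x = 0" "0 < x" "x \<notin> {p..r}" for G G1 :: "real \<Rightarrow> complex" and x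
  proof -
    have "(G has_vector_derivative 0) (at x)"
      by (rule has_vector_derivative_transform_within_open[OF has_vector_derivative_const op]) (use that in auto)
    then show ?thesis using that(1)[OF that(3)] vector_derivative_unique_at by blast
  qed
  have z1: "F1 x = 0" if "0 < x" "x \<notin> {p..r}" for x using dz[of F F1] F z that by blast
  have z2: "F2 x = 0" if "0 < x" "x \<notin> {p..r}" for x using dz[of F1 F2] F1 z1 that by blast
  let ?T = "\<lambda>x. complex_of_real ((\<nu>\<^sup>2 - 1/4) / x\<^sup>2) * F x - F2 x"
  have cT: "continuous_on {0<..} ?T" by (intro continuous_intros cF F2) auto
  have "AE x in half_line. (if x \<in> {p..r} then ?T x else 0) = tau \<nu> F x"
  proof -
    have "AE x in half_line. tau \<nu> F x = ?T x" by (rule R(3))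
    then show ?thesis unfolding AE_half_line_iff by (rule negligible_subset) (auto simp: z z2)
  qed
  with square_integrable_continuous_restrict[OF cT p] have "square_integrable (tau \<nu> F)"
    by (rule square_integrable_cong)
  then obtain g where g: "represents (tau \<nu> F) g" using square_integrable_represents by blast
  have "(f, g) \<in> maximal_op \<nu>" unfolding maximal_op_def using f g R(1) by blast
  moreover have "f \<in> compactly_supported" unfolding compactly_supported_def using f p z by blast
  ultimately show ?thesis unfolding restrict_op_def by blast
qed

text \<open>A bounded function with compact support in \<open>(0,\<infinity>)\<close> becomes twice continuously differentiable after three
averages: the first makes it continuous, the others add one derivative each. Truncation reduces the
general case to this one.\<close>

lemma minimal_domain_dense: "closure (Domain (restrict_op (maximal_op \<nu>) compactly_supported)) = UNIV"
proof -
  let ?K = "closure (Domain (restrict_op (maximal_op \<nu>) compactly_supported))"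
  have K: "closed ?K" by simp
  have s3: "f \<in> ?K" if "tame M p r F" "\<And>x. 0 < x \<Longrightarrow> (F has_vector_derivative F1 x) (at x)"
    "\<And>x. 0 < x \<Longrightarrow> (F1 has_vector_derivative F2 x) (at x)" "continuous_on {0<..} F2" "represents F f" for M p r F F1 F2 f
    using smooth_in_minimal_domain[OF that] closure_subset by blast
  have s2: "f \<in> ?K" if B: "tame M p r F" and F: "\<And>x. 0 < x \<Longrightarrow> (F has_vector_derivative F1 x) (at x)"
    and F1: "continuous_on {0<..} F1" and f: "represents F f" for M p r F F1 f
  proof (rule tame_in_closed[OF B K f])
    fix h c assume h: "0 < h" "h \<le> p / 2" and c: "represents (average h F) c"
    have cF: "continuous_on {0<..} F"
      using F by (auto intro!: continuous_at_imp_continuous_on dest: has_vector_derivative_continuous)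
    show "c \<in> ?K"
    proof (rule s3[OF tame_average[OF B h] average_has_vector_derivative[OF cF h(1)] _ _ c])
      show "((\<lambda>x. (F (x + h) - F x) / complex_of_real h) has_vector_derivative (F1 (x + h) - F1 x) / complex_of_real h) (at x)" if "0 < x" for x
        using has_vector_derivative_diff[OF has_vector_derivative_shift_half_line[OF F h(1) that] F[OF that]]
        by (rule has_vector_derivative_divide)
      show "continuous_on {0<..} (\<lambda>x. (F1 (x + h) - F1 x) / complex_of_real h)"
        using h by (intro continuous_intros continuous_on_shift_half_line F1) auto
    qed
  qed
  have s1: "f \<in> ?K" if B: "tame M p r F" and F: "continuous_on {0<..} F" and f: "represents F f" for M p r F f
  proof (rule tame_in_closed[OF B K f])
    fix h c assume h: "0 < h" "h \<le> p / 2" and c: "represents (average h F) c"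
    show "c \<in> ?K"
    proof (rule s2[OF tame_average[OF B h] average_has_vector_derivative[OF F h(1)] _ c])
      show "continuous_on {0<..} (\<lambda>x. (F (x + h) - F x) / complex_of_real h)"
        using h by (intro continuous_intros continuous_on_shift_half_line F) auto
    qed
  qed
  have s0: "f \<in> ?K" if B: "tame M p r F" and f: "represents F f" for M p r F f
  proof (rule tame_in_closed[OF B K f])
    fix h c assume h: "0 < h" "h \<le> p / 2" and c: "represents (average h F) c"
    have loc: "locally_integrable F" by (rule square_integrable_imp_local[OF tame_square_integrable[OF B]])
    show "c \<in> ?K" by (rule s1[OF tame_average[OF B h] average_continuous[OF loc h(1)] c])
  qed
  have "f \<in> ?K" for f
  proof -
    obtain F where F: "represents F f" using represents_exists by blast
    note sF = represents_square_integrable[OF F]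
    define T where "T n x = (if x \<in> {1 / Suc n..real n} then if cmod (F x) \<le> n then F x else 0 else 0)" for n x
    have tm: "tame (real n) (1 / Suc n) (real n) (T n)" for n
      unfolding tame_def
    proof (intro conjI allI impI)
      have c: "(\<lambda>x. if cmod (F x) \<le> n then F x else 0) \<in> borel_measurable half_line"
        by (rule measurable_compose[OF square_integrableD(1)[OF sF], of "\<lambda>z. if cmod z \<le> n then z else 0"]) measurable
      show "T n \<in> borel_measurable half_line"
        unfolding T_def
      proof (rule measurable_If[OF c])
        have "{x \<in> space half_line. x \<in> {1 / Suc n..real n}} = {0<..} \<inter> {1 / Suc n..real n}" by auto
        then show "{x \<in> space half_line. x \<in> {1 / Suc n..real n}} \<in> sets half_line" by (auto simp: sets_restrict_space)
      qed simp
    qed (auto simp: T_def)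
    have "\<exists>g. represents (T n) g" for n by (intro square_integrable_represents tame_square_integrable[OF tm])
    then obtain g where g: "\<And>n. represents (T n) (g n)" by metis
    have "g \<longlonglongrightarrow> f"
    proof (rule represents_tendsto[OF g F sF])
      show "AE x in half_line. (\<lambda>n. T n x) \<longlonglongrightarrow> F x"
      proof (rule AE_I2)
        fix x assume "x \<in> space half_line"
        then have x: "0 < x" by simp
        obtain n1 where n1: "1 / Suc n1 < x" using x nat_approx_posE by blast
        obtain n2 where n2: "x < real n2" using reals_Archimedean2 by blast
        obtain n3 where n3: "cmod (F x) < real n3" using reals_Archimedean2 by blast
        have "T n x = F x" if "max n1 (max n2 n3) \<le> n" for n
        proof -
          have "1 / Suc n \<le> 1 / Suc n1" using that by (simp add: frac_le)
          then show ?thesis using that n1 n2 n3 by (auto simp: T_def)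
        qed
        then have "eventually (\<lambda>n. T n x = F x) sequentially" unfolding eventually_sequentially by blast
        then show "(\<lambda>n. T n x) \<longlonglongrightarrow> F x" by (rule tendsto_eventually)
      qed
    qed (auto simp: T_def)
    moreover have "g n \<in> ?K" for n by (rule s0[OF tm g])
    ultimately show ?thesis using K by (auto simp: closed_sequential_limits)
  qed
  then show ?thesis by blast
qed

section \<open>The adjoint of the minimal operator\<close>

lemma cinner_add_left: "cinner (f + g) h = cinner f h + cinner g h"
proof -
  obtain F G H where r: "represents F f" "represents G g" "represents H h" using represents_exists by metis
  note sq = r[THEN represents_square_integrable]
  show ?thesis
    unfolding cinner_represents[OF represents_add[OF r(1,2)] r(3)] cinner_represents[OF r(1,3)] cinner_represents[OF r(2,3)]
    by (simp add: distrib_right square_integrable_mult_cnj sq)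
qed

lemma cinner_add_right: "cinner h (f + g) = cinner h f + cinner h g"
  by (subst (1 2 3) cinner_commute) (simp add: cinner_add_left)

lemma cinner_scale_right: "cinner h (scaleC c f) = cnj c * cinner h f"
  by (subst (1 2) cinner_commute) (simp add: cinner_scale)

lemma adjoint_op_iff: "(g, g') \<in> adjoint_op A \<longleftrightarrow> (\<forall>f f'. (f, f') \<in> A \<longrightarrow> cinner f' g = cinner f g')"
  by (auto simp: adjoint_op_def)

lemma linear_operator_adjoint_op:
  assumes dense: "closure (Domain A) = UNIV"
  shows "linear_operator (adjoint_op A)"
proof -
  have zero: "cinner f 0 = 0" for f
    using cinner_scale_right[of f 0 0] cinner_add_right[of f 0 0] by simp
  have add: "(f + g, f' + g') \<in> adjoint_op A" if "(f, f') \<in> adjoint_op A" "(g, g') \<in> adjoint_op A" for f f' g g'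
    using that by (simp add: adjoint_op_iff cinner_add_right)
  have scale: "(scaleC c f, scaleC c f') \<in> adjoint_op A" if "(f, f') \<in> adjoint_op A" for c f f'
    using that by (simp add: adjoint_op_iff cinner_scale_right)
  have "single_valued (adjoint_op A)"
  proof (rule single_valuedI)
    fix g g' g'' assume g: "(g, g') \<in> adjoint_op A" "(g, g'') \<in> adjoint_op A"
    have "closed {f. cinner f g' = cinner f g''}"
      by (intro closed_Collect_eq continuous_on_cinner continuous_intros)
    moreover have "Domain A \<subseteq> {f. cinner f g' = cinner f g''}"
      using g by (fastforce simp: adjoint_op_def)
    ultimately have "UNIV \<subseteq> {f. cinner f g' = cinner f g''}" unfolding dense[symmetric] by (rule closure_minimal[rotated])
    then have "cinner (g' - g'') g' = cinner (g' - g'') g''" by blast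
    then have "inner (g' - g'') g' = inner (g' - g'') g''" by (simp only: inner_l2_def)
    then have "inner (g' - g'') (g' - g'') = 0" by (simp only: inner_diff_right diff_self)
    then show "g' = g''" by simp
  qed
  with add scale zero show ?thesis unfolding linear_operator_def by (auto simp: adjoint_op_def)
qed

lemma continuous_AE_eq:
  fixes F G :: "real \<Rightarrow> complex"
  assumes "continuous_on {0<..} F" "continuous_on {0<..} G" and S: "open S" "S \<subseteq> {0<..}"
    and ae: "AE x in half_line. x \<in> S \<longrightarrow> F x = G x" and x: "x \<in> S"
  shows "F x = G x"
proof (rule ccontr)
  assume ne: "F x \<noteq> G x"
  have "continuous_on S (\<lambda>x. F x - G x)"
    by (intro continuous_on_diff continuous_on_subset[OF assms(1) S(2)] continuous_on_subset[OF assms(2) S(2)])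
  then have "open (S \<inter> (\<lambda>x. F x - G x) -` (- {0}))"
    by (rule continuous_open_preimage[OF _ S(1)]) (simp add: open_Compl)
  moreover have "negligible (S \<inter> (\<lambda>x. F x - G x) -` (- {0}))"
    using ae unfolding AE_half_line_iff by (rule negligible_subset) (use S in auto)
  moreover have "x \<in> S \<inter> (\<lambda>x. F x - G x) -` (- {0})" using ne x by simp
  ultimately show False using open_not_negligible by (metis empty_iff)
qed

lemma vector_derivative_eq_on:
  fixes F G :: "real \<Rightarrow> complex"
  assumes "\<And>x. x \<in> S \<Longrightarrow> F x = G x" "open S" "x \<in> S"
  shows "D1 F x = D1 G x"
proof -
  have "(F has_vector_derivative d) (at x) \<longleftrightarrow> (G has_vector_derivative d) (at x)" for d
    using has_vector_derivative_transform_within_open[of F d x S G] has_vector_derivative_transform_within_open[of G d x S F] assms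
    by auto
  then show ?thesis by (simp add: vector_derivative_def)
qed

lemma regular_unique:
  assumes F: "regular F" and G: "regular G" and ae: "AE x in half_line. F x = G x" and x: "0 < x"
  shows "F x = G x" "D1 F x = D1 G x" "tau \<nu> F x = tau \<nu> G x"
proof -
  have eq: "F y = G y" if "0 < y" for y
    by (rule continuous_AE_eq[OF regularD(2)[OF F] regularD(2)[OF G] open_greaterThan subset_refl]) (use ae that in auto)
  have eq1: "D1 F y = D1 G y" if "0 < y" for y
    by (rule vector_derivative_eq_on[OF _ open_greaterThan]) (use eq that in auto)
  have "D1 (D1 F) x = D1 (D1 G) x"
    by (rule vector_derivative_eq_on[OF _ open_greaterThan]) (use eq1 x in auto)
  with eq eq1 x show "F x = G x" "D1 F x = D1 G x" "tau \<nu> F x = tau \<nu> G x" by (auto simp: tau_def)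
qed

lemma maximal_opE:
  assumes "(f, g) \<in> maximal_op \<nu>"
  obtains F where "maximal_function \<nu> F" "represents F f" "represents (tau \<nu> F) g"
  using assms by (auto simp: maximal_op_def maximal_function_def dest: represents_square_integrable)

lemma maximal_opI:
  "maximal_function \<nu> F \<Longrightarrow> represents F f \<Longrightarrow> represents (tau \<nu> F) g \<Longrightarrow> (f, g) \<in> maximal_op \<nu>"
  by (auto simp: maximal_op_def maximal_function_def)

lemma maximal_function_represents:
  assumes "maximal_function \<nu> F"
  obtains f g where "represents F f" "represents (tau \<nu> F) g"
  using maximal_functionD[OF assms] square_integrable_represents by metis

lemma compactly_supported_vanishes:
  assumes F: "regular F" "represents F f" and f: "f \<in> compactly_supported"
  obtains a b where "0 < a" "a \<le> b" "\<And>x. 0 < x \<Longrightarrow> x \<notin> {a..b} \<Longrightarrow> F x = 0 \<and> D1 F x = 0"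
proof -
  obtain G a b where G: "represents G f" "0 < a" "\<forall>x>0. x \<notin> {a..b} \<longrightarrow> G x = 0"
    using f unfolding compactly_supported_def by blast
  define b' where "b' = max a b"
  have op: "open ({0<..} - {a..b'})" by (intro open_Diff) auto
  have ae: "AE x in half_line. F x = G x" by (rule represents_unique[OF F(2) G(1)])
  have z: "F x = 0" if "x \<in> {0<..} - {a..b'}" for x
  proof (rule continuous_AE_eq[OF regularD(2)[OF F(1)] _ op _ _ that, of "\<lambda>x. 0"])
    show "AE x in half_line. x \<in> {0<..} - {a..b'} \<longrightarrow> F x = 0"
      using ae unfolding AE_half_line_iff by (rule negligible_subset) (use G(3) in \<open>auto simp: b'_def\<close>)
  qed auto
  have "D1 F x = 0" if "x \<in> {0<..} - {a..b'}" for x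
  proof -
    have "D1 F x = D1 (\<lambda>x. 0) x" by (rule vector_derivative_eq_on[OF _ op that]) (rule z)
    then show ?thesis by simp
  qed
  with z G(2) show ?thesis by (intro that[of a b']) (auto simp: b'_def)
qed

lemma integral_half_line_support:
  fixes f :: "real \<Rightarrow> complex"
  assumes f: "integrable half_line f" and z: "\<And>x. 0 < x \<Longrightarrow> x \<notin> {a..b} \<Longrightarrow> f x = 0" and a: "0 < a"
  shows "(LINT x|half_line. f x) = integral {a..b} f"
proof -
  have "integral {0<..} f = integral {0<..} (\<lambda>x. if x \<in> {a..b} then f x else 0)"
    by (rule integral_cong) (use z in auto)
  also have "\<dots> = integral ({a..b} \<inter> {0<..}) f" by (rule Henstock_Kurzweil_Integration.integral_restrict_Int)
  also have "{a..b} \<inter> {0<..} = {a..b}" using a by auto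
  finally show ?thesis using integral_half_line[OF f] by simp
qed

context bessel
begin

abbreviation preminimal_op :: "(l2 \<times> l2) set"
  where "preminimal_op \<equiv> restrict_op (maximal_op \<nu>) compactly_supported"

lemma operator_green:
  assumes F: "maximal_function \<nu> F" "represents F f" "represents (tau \<nu> F) f'"
    and G: "maximal_function \<nu> G" "represents G g" "represents (tau \<nu> G) g'"
  shows "cinner f' g = cinner f g' \<longleftrightarrow> \<alpha> F * cnj (\<beta> G) = \<beta> F * cnj (\<alpha> G)"
proof -
  have "cinner f' g - cinner f g' = - complex_of_real (2 * \<nu>) * (\<alpha> F * cnj (\<beta> G) - \<beta> F * cnj (\<alpha> G))"
    unfolding cinner_represents[OF F(3) G(2)] cinner_represents[OF F(2) G(3)] by (rule bracket_limits(3)[OF F(1) G(1)])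
  then show ?thesis using \<nu> by (metis diff_eq_diff_eq diff_self eq_iff_diff_eq_0 mult_eq_0_iff neg_equal_0_iff_equal of_real_eq_0_iff less_numeral_extra(3) zero_neq_numeral order_less_irrefl)
qed

lemma preminimal_boundary_values:
  assumes F: "maximal_function \<nu> F" "represents F f" and f: "f \<in> compactly_supported"
  shows "\<alpha> F = 0" "\<beta> F = 0"
proof -
  obtain a b where a: "0 < a" "\<And>x. 0 < x \<Longrightarrow> x \<notin> {a..b} \<Longrightarrow> F x = 0 \<and> D1 F x = 0"
    using compactly_supported_vanishes[OF maximal_functionD(1)[OF F(1)] F(2) f] by metis
  have ev: "eventually (\<lambda>x. F x = 0 \<and> D1 F x = 0) (at_right 0)"
    using eventually_at_right_real[OF a(1)] by (rule eventually_mono) (use a in auto)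
  have "eventually (\<lambda>x. cu F x = 0) (at_right 0)" "eventually (\<lambda>x. cv F x = 0) (at_right 0)"
    using ev by (auto elim!: eventually_mono simp: cu_def cv_def)
  then show "\<alpha> F = 0" "\<beta> F = 0"
    using tendsto_unique[OF trivial_limit_at_right_real tendsto_\<alpha>[OF F(1)] tendsto_eventually]
      tendsto_unique[OF trivial_limit_at_right_real tendsto_\<beta>[OF F(1)] tendsto_eventually] by blast+
qed

lemma maximal_subset_adjoint: "maximal_op \<nu> \<subseteq> adjoint_op preminimal_op"
proof clarify
  fix g g' assume "(g, g') \<in> maximal_op \<nu>"
  then obtain G where G: "maximal_function \<nu> G" "represents G g" "represents (tau \<nu> G) g'" by (rule maximal_opE)
  have "cinner f' g = cinner f g'" if ff: "(f, f') \<in> preminimal_op" for f f'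
  proof -
    from ff have "(f, f') \<in> maximal_op \<nu>" and fc: "f \<in> compactly_supported" by (auto simp: restrict_op_def)
    then obtain F where F: "maximal_function \<nu> F" "represents F f" "represents (tau \<nu> F) f'" by (metis maximal_opE)
    show ?thesis using operator_green[OF F G] preminimal_boundary_values[OF F(1,2) fc] by simp
  qed
  then show "(g, g') \<in> adjoint_op preminimal_op" by (auto simp: adjoint_op_def)
qed

text \<open>The functions \<open>u\<close>, \<open>v\<close> and general solutions are not square-integrable up to infinity; they are only paired
with functions of compact support in \<open>(0,\<infinity>)\<close>.\<close>

definition locally_L2 :: "(real \<Rightarrow> complex) \<Rightarrow> bool"
  where "locally_L2 Q \<longleftrightarrow> (\<forall>a b. 0 < a \<longrightarrow> square_integrable (\<lambda>x. if x \<in> {a..b} then Q x else 0))"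

lemma locally_L2_mult_integrable:
  assumes Q: "locally_L2 Q" and k: "square_integrable k" "\<And>x. x \<notin> {a..b} \<Longrightarrow> k x = 0" and a: "0 < a"
  shows "integrable half_line (\<lambda>x. k x * cnj (Q x))"
proof -
  have "integrable half_line (\<lambda>x. k x * cnj (if x \<in> {a..b} then Q x else 0))"
    using Q a by (intro square_integrable_mult_cnj k) (simp add: locally_L2_def)
  then show ?thesis
    by (rule Bochner_Integration.integrable_cong[THEN iffD1, rotated -1]) (use k(2) in auto)
qed

lemma locally_L2_continuous: "continuous_on {0<..} Q \<Longrightarrow> locally_L2 Q"
  unfolding locally_L2_def using square_integrable_continuous_restrict by blast

lemma locally_L2_add: "locally_L2 P \<Longrightarrow> locally_L2 Q \<Longrightarrow> locally_L2 (\<lambda>x. P x + Q x)"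
  unfolding locally_L2_def
proof (intro allI impI)
  fix a b :: real
  assume "\<forall>a b. 0 < a \<longrightarrow> square_integrable (\<lambda>x. if x \<in> {a..b} then P x else 0)"
    "\<forall>a b. 0 < a \<longrightarrow> square_integrable (\<lambda>x. if x \<in> {a..b} then Q x else 0)" "0 < a"
  then have "square_integrable (\<lambda>x. (if x \<in> {a..b} then P x else 0) + (if x \<in> {a..b} then Q x else 0))"
    by (intro square_integrable_add) auto
  then show "square_integrable (\<lambda>x. if x \<in> {a..b} then P x + Q x else 0)"
    by (rule square_integrable_cong) (auto intro!: AE_I2)
qed

lemma locally_L2_square_integrable: "square_integrable Q \<Longrightarrow> locally_L2 Q"
  unfolding locally_L2_def by (intro allI impI square_integrable_restrict) auto

lemma pairing_support:
  assumes "locally_L2 Q" "square_integrable k" "\<forall>x. x \<notin> {p..r} \<longrightarrow> k x = 0" "0 < p"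
  shows "(LINT x|half_line. k x * cnj (Q x)) = integral {p..r} (\<lambda>x. k x * cnj (Q x))"
proof (rule integral_half_line_support[OF _ _ assms(4)])
  show "integrable half_line (\<lambda>x. k x * cnj (Q x))"
    by (rule locally_L2_mult_integrable[OF assms(1,2) _ assms(4)]) (use assms(3) in blast)
qed (use assms(3) in simp)

text \<open>Choose \<open>k\<^sub>0\<close>, \<open>k\<^sub>1\<close> dual to \<open>u\<close>, \<open>v\<close>. Subtracting from any \<open>k\<close> its moments times \<open>k\<^sub>0\<close>, \<open>k\<^sub>1\<close> makes it admissible, so
pairing with \<open>Q\<close> is a fixed combination of the two moments, that is, pairing with a fixed combination of
\<open>u\<close> and \<open>v\<close>. Taking for \<open>k\<close> the difference itself on a compact interval shows that it is zero.\<close>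

lemma orthogonal_to_kernel:
  assumes Q: "locally_L2 Q"
    and orth: "\<And>k p r. square_integrable k \<Longrightarrow> (\<forall>x. x \<notin> {p..r} \<longrightarrow> k x = 0) \<Longrightarrow> 0 < p \<Longrightarrow> p \<le> r \<Longrightarrow>
      (LINT x|half_line. k x * cnj (u x)) = 0 \<Longrightarrow> (LINT x|half_line. k x * cnj (v x)) = 0 \<Longrightarrow>
      (LINT x|half_line. k x * cnj (Q x)) = 0"
  obtains c d where "AE x in half_line. Q x = c * u x + d * v x"
proof -
  have Lu: "locally_L2 u" and Lv: "locally_L2 v" by (intro locally_L2_continuous continuous_uv)+
  obtain k0 p0 r0 where k0: "square_integrable k0" "\<forall>x. x \<notin> {p0..r0} \<longrightarrow> k0 x = 0" "0 < p0" "p0 \<le> r0"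
    "integral {p0..r0} (\<lambda>x. k0 x * u x) = 1" "integral {p0..r0} (\<lambda>x. k0 x * v x) = 0" by (rule prescribed_moments)
  obtain k1 p1 r1 where k1: "square_integrable k1" "\<forall>x. x \<notin> {p1..r1} \<longrightarrow> k1 x = 0" "0 < p1" "p1 \<le> r1"
    "integral {p1..r1} (\<lambda>x. k1 x * u x) = 0" "integral {p1..r1} (\<lambda>x. k1 x * v x) = 1" by (rule prescribed_moments)
  have moments: "(LINT x|half_line. k0 x * cnj (u x)) = 1" "(LINT x|half_line. k0 x * cnj (v x)) = 0"
     "(LINT x|half_line. k1 x * cnj (u x)) = 0" "(LINT x|half_line. k1 x * cnj (v x)) = 1"
    using pairing_support[OF Lu k0(1-3)] pairing_support[OF Lv k0(1-3)] pairing_support[OF Lu k1(1-3)]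
      pairing_support[OF Lv k1(1-3)] k0(5,6) k1(5,6) by simp_all
  define C where "C = (LINT x|half_line. k0 x * cnj (Q x))"
  define D where "D = (LINT x|half_line. k1 x * cnj (Q x))"
  have rep: "(LINT x|half_line. k x * cnj (Q x)) = (LINT x|half_line. k x * cnj (u x)) * C + (LINT x|half_line. k x * cnj (v x)) * D"
    if k: "square_integrable k" "\<forall>x. x \<notin> {p..r} \<longrightarrow> k x = 0" "0 < p" "p \<le> r" for k p r
  proof -
    define A where "A = (LINT x|half_line. k x * cnj (u x))"
    define B where "B = (LINT x|half_line. k x * cnj (v x))"
    let ?k = "\<lambda>x. k x + (- A * k0 x + - B * k1 x)"
    have L: "(LINT x|half_line. ?k x * cnj (f x)) = (LINT x|half_line. k x * cnj (f x))
        - A * (LINT x|half_line. k0 x * cnj (f x)) - B * (LINT x|half_line. k1 x * cnj (f x))" if f: "locally_L2 f" for f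
    proof -
      note i = locally_L2_mult_integrable[OF f k(1) k(2)[rule_format] k(3)]
        locally_L2_mult_integrable[OF f k0(1) k0(2)[rule_format] k0(3)]
        locally_L2_mult_integrable[OF f k1(1) k1(2)[rule_format] k1(3)]
      have "(LINT x|half_line. ?k x * cnj (f x)) =
        (LINT x|half_line. k x * cnj (f x) + (- A * (k0 x * cnj (f x)) + - B * (k1 x * cnj (f x))))"
        by (intro Bochner_Integration.integral_cong) (auto simp: algebra_simps)
      then show ?thesis using i by simp
    qed
    have "(LINT x|half_line. ?k x * cnj (Q x)) = 0"
    proof (rule orth)
      show "square_integrable ?k" by (intro square_integrable_add square_integrable_scale k k0 k1)
      show "\<forall>x. x \<notin> {min p (min p0 p1)..max r (max r0 r1)} \<longrightarrow> ?k x = 0"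
      proof (intro allI impI)
        fix x assume "x \<notin> {min p (min p0 p1)..max r (max r0 r1)}"
        then have "x \<notin> {p..r}" "x \<notin> {p0..r0}" "x \<notin> {p1..r1}" by auto
        then show "?k x = 0" using k(2) k0(2) k1(2) by (simp del: atLeastAtMost_iff)
      qed
      show "0 < min p (min p0 p1)" "min p (min p0 p1) \<le> max r (max r0 r1)"
        using k k0 k1 by auto
      show "(LINT x|half_line. ?k x * cnj (u x)) = 0" unfolding L[OF Lu] moments A_def[symmetric] by simp
      show "(LINT x|half_line. ?k x * cnj (v x)) = 0" unfolding L[OF Lv] moments B_def[symmetric] by simp
    qed
    then show ?thesis unfolding L[OF Q] C_def[symmetric] D_def[symmetric] A_def[symmetric] B_def[symmetric]
      by (simp add: algebra_simps)
  qed
  define R where "R x = Q x + (- cnj C * u x + - cnj D * v x)" for x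
  have Lin: "locally_L2 (\<lambda>x. - cnj C * u x + - cnj D * v x)"
    by (intro locally_L2_continuous continuous_intros continuous_uv)
  have LR: "locally_L2 R" unfolding R_def by (intro locally_L2_add Q Lin)
  have zero: "AE x in half_line. (if x \<in> {p..r} then R x else 0) = 0" if pr: "0 < p" "p \<le> r" for p r
  proof -
    define k where "k x = (if x \<in> {p..r} then R x else 0)" for x
    have k: "square_integrable k" "\<forall>x. x \<notin> {p..r} \<longrightarrow> k x = 0"
      using LR pr unfolding k_def[abs_def] locally_L2_def by auto
    note i = locally_L2_mult_integrable[OF _ k(1) k(2)[rule_format] pr(1)]
    have "(LINT x|half_line. k x * cnj (k x)) =
      (LINT x|half_line. k x * cnj (Q x) + (- C * (k x * cnj (u x)) + - D * (k x * cnj (v x))))"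
      by (intro Bochner_Integration.integral_cong) (auto simp: k_def R_def algebra_simps)
    also have "\<dots> = 0"
      using i[OF Q] i[OF Lu] i[OF Lv] rep[OF k pr] by (simp add: algebra_simps)
    finally have z: "(LINT x|half_line. k x * cnj (k x)) = 0" .
    obtain f where f: "represents k f" using square_integrable_represents[OF k(1)] by blast
    have "inner f f = 0" unfolding inner_l2_def cinner_represents[OF f f] z by simp
    then have "f = 0" by simp
    then show ?thesis using represents_unique[OF f[unfolded \<open>f = 0\<close>] represents_zero] unfolding k_def by simp
  qed
  have "negligible (\<Union>n. {x. 0 < x \<and> (if x \<in> {1 / Suc n..real (Suc n)} then R x else 0) \<noteq> 0})"
  proof (intro negligible_countable_Union)
    fix S assume "S \<in> range (\<lambda>n. {x. 0 < x \<and> (if x \<in> {1 / Suc n..real (Suc n)} then R x else 0) \<noteq> 0})"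
    then obtain n where S: "S = {x. 0 < x \<and> (if x \<in> {1 / Suc n..real (Suc n)} then R x else 0) \<noteq> 0}" by blast
    have "1 / real (Suc n) \<le> 1" by (simp add: divide_le_eq)
    moreover have "1 \<le> real (Suc n)" by simp
    ultimately have "0 < 1 / real (Suc n)" "1 / Suc n \<le> real (Suc n)" by (simp, linarith)
    from zero[OF this, unfolded AE_half_line_iff] show "negligible S" unfolding S .
  qed auto
  then have "negligible {x. 0 < x \<and> Q x \<noteq> cnj C * u x + cnj D * v x}"
  proof (rule negligible_subset, intro subsetI)
    fix x assume x: "x \<in> {x. 0 < x \<and> Q x \<noteq> cnj C * u x + cnj D * v x}"
    obtain n1 where n1: "1 / Suc n1 < x" using x nat_approx_posE by blast
    obtain n2 where n2: "x < real n2" using reals_Archimedean2 by blast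
    have "1 / Suc (max n1 n2) \<le> 1 / Suc n1" by (simp add: frac_le)
    then have "x \<in> {1 / Suc (max n1 n2)..real (Suc (max n1 n2))}" using n1 n2 by auto
    moreover have "R x = Q x - (cnj C * u x + cnj D * v x)" by (simp add: R_def)
    then have "R x \<noteq> 0" using x by simp
    ultimately show "x \<in> (\<Union>n. {x. 0 < x \<and> (if x \<in> {1 / Suc n..real (Suc n)} then R x else 0) \<noteq> 0})" using x by auto
  qed
  then show ?thesis by (intro that[of "cnj C" "cnj D"]) (simp add: AE_half_line_iff)
qed

text \<open>Given \<open>(g, g')\<close> in the adjoint, solve \<open>\<tau> P = g'\<close>. Green's formula on a compact interval shows that \<open>g - P\<close> is
orthogonal to \<open>\<tau> \<phi>\<close> for each compactly supported \<open>\<phi>\<close>, that is, to all \<open>k\<close> with zero moments against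
\<open>u\<close> and \<open>v\<close>. So \<open>g\<close> equals \<open>P\<close> up to a combination of \<open>u\<close> and \<open>v\<close>, which is a regular function.\<close>

lemma adjoint_subset_maximal: "adjoint_op preminimal_op \<subseteq> maximal_op \<nu>"
proof clarify
  fix g g' assume adj: "(g, g') \<in> adjoint_op preminimal_op"
  obtain G where G: "represents G g" using represents_exists by blast
  obtain G' where G': "represents G' g'" using represents_exists by blast
  note sG = represents_square_integrable[OF G] and sG' = represents_square_integrable[OF G']
  obtain P where P: "regular P" "AE x in half_line. tau \<nu> P x = G' x"
    using solution_exists[OF square_integrable_imp_local[OF sG'] zero_less_one] by metis
  have cP: "continuous_on {0<..} P" by (rule regularD(2)[OF P(1)])
  define Q where "Q x = G x + (- 1 * P x)" for x
  have LQ: "locally_L2 Q" unfolding Q_def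
    by (intro locally_L2_add locally_L2_square_integrable sG locally_L2_continuous continuous_intros cP)
  have Lu: "locally_L2 u" and Lv: "locally_L2 v" and LP: "locally_L2 P"
    by (intro locally_L2_continuous continuous_uv cP)+
  obtain c d where cd: "AE x in half_line. Q x = c * u x + d * v x"
  proof (rule orthogonal_to_kernel[OF LQ])
    fix k p r assume k: "square_integrable k" "\<forall>x. x \<notin> {p..r} \<longrightarrow> k x = 0" and pr: "0 < p" "p \<le> r"
      and ku: "(LINT x|half_line. k x * cnj (u x)) = 0" and kv: "(LINT x|half_line. k x * cnj (v x)) = 0"
    note i = locally_L2_mult_integrable[OF _ k(1) k(2)[rule_format] pr(1)]
    have "integral {p..r} (\<lambda>x. k x * cnj (u x)) = 0" "integral {p..r} (\<lambda>x. k x * cnj (v x)) = 0"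
      using pairing_support[OF Lu k pr(1)] pairing_support[OF Lv k pr(1)] ku kv by simp_all
    then have m: "integral {p..r} (\<lambda>x. k x * u x) = complex_of_real (2 * \<nu>) * 0"
      "integral {p..r} (\<lambda>x. k x * v x) = - complex_of_real (2 * \<nu>) * 0" by simp_all
    obtain \<phi> where \<phi>: "maximal_function \<nu> \<phi>" "AE x in half_line. tau \<nu> \<phi> x = k x"
      "\<forall>x\<ge>r. \<phi> x = 0" "\<forall>x. 0 < x \<longrightarrow> x \<le> p \<longrightarrow> \<phi> x = 0 * u x + 0 * v x"
      by (rule cutoff_solution[OF k(1) k(2)[rule_format] pr m])
    note f\<phi> = maximal_functionD[OF \<phi>(1)]
    obtain f f' where f: "represents \<phi> f" "represents (tau \<nu> \<phi>) f'" by (rule maximal_function_represents[OF \<phi>(1)])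
    have z: "\<phi> x = 0" if "0 < x" "x \<notin> {p..r}" for x using \<phi>(3,4) that by auto
    have "f \<in> compactly_supported" unfolding compactly_supported_def using f(1) pr(1) z by blast
    then have "(f, f') \<in> preminimal_op" using maximal_opI[OF \<phi>(1) f] by (auto simp: restrict_op_def)
    then have eq: "cinner f' g = cinner f g'" using adj by (auto simp: adjoint_op_def)
    have op: "open ({0<..} - {p..r})" by (intro open_Diff) auto
    have br: "lagrange_bracket \<phi> P x = 0" if "x \<in> {0<..} - {p..r}" for x
    proof -
      have "D1 \<phi> x = D1 (\<lambda>x. 0) x" by (rule vector_derivative_eq_on[OF _ op that]) (auto intro: z)
      then show ?thesis using z[of x] that by (simp add: lagrange_bracket_def)
    qed
    have s\<phi>: "\<phi> x = 0" if "x \<notin> {p/2..r+1}" "0 < x" for x using z[of x] that pr by auto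
    have kf': "represents k f'" by (rule represents_cong[OF f(2) \<phi>(2)])
    have e1: "cinner f' g = (LINT x|half_line. k x * cnj (G x))" by (rule cinner_represents[OF kf' G])
    have e2: "cinner f g' = (LINT x|half_line. \<phi> x * cnj (G' x))" by (rule cinner_represents[OF f(1) G'])
    have ik: "integrable half_line (\<lambda>x. k x * cnj (P x))" by (rule i[OF LP])
    have ig: "integrable half_line (\<lambda>x. \<phi> x * cnj (G' x))" by (rule square_integrable_mult_cnj[OF f\<phi>(2) sG'])
    have "(LINT x|half_line. k x * cnj (P x)) - (LINT x|half_line. \<phi> x * cnj (G' x))
        = (LINT x|half_line. k x * cnj (P x) - \<phi> x * cnj (G' x))" using ik ig by simp
    also have "\<dots> = integral {p/2..r+1} (\<lambda>x. k x * cnj (P x) - \<phi> x * cnj (G' x))"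
      using ik ig pr k(2) s\<phi> by (intro integral_half_line_support) auto
    also have "\<dots> = integral {p/2..r+1} (\<lambda>x. tau \<nu> \<phi> x * cnj (P x) - \<phi> x * cnj (tau \<nu> P x))"
    proof (rule integral_spike)
      show "negligible ({x. 0 < x \<and> tau \<nu> \<phi> x \<noteq> k x} \<union> {x. 0 < x \<and> tau \<nu> P x \<noteq> G' x})"
        using \<phi>(2) P(2) by (simp add: AE_half_line_iff)
    qed (use pr in auto)
    also have "\<dots> = lagrange_bracket \<phi> P (r+1) - lagrange_bracket \<phi> P (p/2)"
      using pr by (intro integral_unique ac_derivative_ftc ac_derivative_lagrange_bracket f\<phi> P) auto
    also have "\<dots> = 0" using br[of "r+1"] br[of "p/2"] pr by simp
    finally have "(LINT x|half_line. k x * cnj (P x)) = (LINT x|half_line. k x * cnj (G x))" using eq e1 e2 by simp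
    moreover have "(LINT x|half_line. k x * cnj (Q x)) = (LINT x|half_line. k x * cnj (G x) - k x * cnj (P x))"
      by (intro Bochner_Integration.integral_cong) (auto simp: Q_def algebra_simps)
    ultimately show "(LINT x|half_line. k x * cnj (Q x)) = 0"
      using ik i[OF locally_L2_square_integrable[OF sG]] by simp
  qed
  define F where "F x = P x + (c * u x + d * v x)" for x
  define F1 where "F1 x = D1 P x + (c * u' x + d * v' x)" for x
  have "ac_derivative F F1" unfolding F_def F1_def
    by (intro ac_derivative_add ac_derivative_scale regularD(4) P ac_u ac_v)
  moreover have "ac_derivative F1 (\<lambda>x. (q x * P x - tau \<nu> P x) + (c * (q x * u x) + d * (q x * v x)))" unfolding F1_def
    by (intro ac_derivative_add ac_derivative_scale ac_D1 P ac_u' ac_v')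
  ultimately have R: "regular F"
    "AE x in half_line. tau \<nu> F x = q x * F x - ((q x * P x - tau \<nu> P x) + (c * (q x * u x) + d * (q x * v x)))"
    unfolding q_def by (rule regularI(1), rule regularI(3))
  have "AE x in half_line. G x = F x" using cd by eventually_elim (simp add: Q_def F_def algebra_simps)
  then have "represents F g" by (rule represents_cong[OF G])
  moreover have "AE x in half_line. G' x = tau \<nu> F x"
    using R(2) P(2) by eventually_elim (simp add: F_def algebra_simps)
  then have "represents (tau \<nu> F) g'" by (rule represents_cong[OF G'])
  ultimately show "(g, g') \<in> maximal_op \<nu>" using R(1) unfolding maximal_op_def by blast
qed

lemma adjoint_minimal: "adjoint_op (minimal_op \<nu>) = maximal_op \<nu>"
  unfolding minimal_op_def adjoint_op_closure
  using adjoint_subset_maximal maximal_subset_adjoint by blast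

section \<open>Self-adjoint extensions and their sign\<close>

lemma boundary_function_bracket:
  assumes "0 < x"
  shows "lagrange_bracket F (boundary_function \<nu> \<infinity>) x = complex_of_real (2 * \<nu>) * cu F x"
    and "lagrange_bracket F (boundary_function \<nu> (ereal t)) x =
      complex_of_real (2 * \<nu>) * (complex_of_real (2 * \<nu> * t) * cu F x - cv F x)"
proof -
  have W: "complex_of_real (2 * \<nu>) \<noteq> 0" using \<nu> by simp
  have inf: "boundary_function \<nu> \<infinity> = v" by (simp add: fun_eq_iff boundary_function_def v_def)
  have fin: "boundary_function \<nu> (ereal t) = (\<lambda>x. u x + complex_of_real (2 * \<nu> * t) * v x)"
    by (simp add: fun_eq_iff boundary_function_def u_def v_def)
  have du: "(u has_vector_derivative u' x) (at x)" and dv: "(v has_vector_derivative v' x) (at x)"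
    using assms ac_u ac_v continuous_uv by (auto intro: ac_derivative_imp_has_vector_derivative)
  have D: "D1 v x = v' x" "D1 (\<lambda>x. u x + complex_of_real (2 * \<nu> * t) * v x) x = u' x + complex_of_real (2 * \<nu> * t) * v' x"
    by (intro vector_derivative_at has_vector_derivative_add has_vector_derivative_mult_right du dv)+
  show "lagrange_bracket F (boundary_function \<nu> \<infinity>) x = complex_of_real (2 * \<nu>) * cu F x"
    unfolding inf lagrange_bracket_def D using W by (simp add: cu_def)
  show "lagrange_bracket F (boundary_function \<nu> (ereal t)) x =
      complex_of_real (2 * \<nu>) * (complex_of_real (2 * \<nu> * t) * cu F x - cv F x)"
    unfolding fin lagrange_bracket_def D cu_def cv_def using W by (simp add: field_simps)
qed

definition boundary_condition :: "ereal \<Rightarrow> complex \<Rightarrow> complex \<Rightarrow> bool"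
  where "boundary_condition h a b \<longleftrightarrow> (if h = \<infinity> then a = 0 else b = complex_of_real (2 * \<nu> * real_of_ereal h) * a)"

lemma boundary_bracket_tendsto_iff:
  assumes F: "maximal_function \<nu> F" and h: "h \<noteq> -\<infinity>"
  shows "(lagrange_bracket F (boundary_function \<nu> h) \<longlongrightarrow> 0) (at_right 0) \<longleftrightarrow> boundary_condition h (\<alpha> F) (\<beta> F)"
proof -
  have W: "complex_of_real (2 * \<nu>) \<noteq> 0" using \<nu> by simp
  have *: "(lagrange_bracket F (boundary_function \<nu> h) \<longlongrightarrow> 0) (at_right 0) \<longleftrightarrow> l = 0"
    if "(g \<longlongrightarrow> l) (at_right 0)" "\<And>x. 0 < x \<Longrightarrow> g x = lagrange_bracket F (boundary_function \<nu> h) x" for l g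
  proof -
    have "eventually (\<lambda>x. g x = lagrange_bracket F (boundary_function \<nu> h) x) (at_right 0)"
      using eventually_at_right_less[of 0] by (rule eventually_mono) (rule that(2))
    with that(1) have "(lagrange_bracket F (boundary_function \<nu> h) \<longlongrightarrow> l) (at_right 0)" by (rule Lim_transform_eventually)
    then show ?thesis using tendsto_unique[OF trivial_limit_at_right_real] by blast
  qed
  show ?thesis
  proof (cases h)
    case (real t)
    have "((\<lambda>x. complex_of_real (2 * \<nu>) * (complex_of_real (2 * \<nu> * t) * cu F x - cv F x)) \<longlongrightarrow>
      complex_of_real (2 * \<nu>) * (complex_of_real (2 * \<nu> * t) * \<alpha> F - \<beta> F)) (at_right 0)"
      by (intro tendsto_intros tendsto_\<alpha> tendsto_\<beta> F)
    from *[OF this] show ?thesis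
      using W boundary_function_bracket(2)[of _ F t] unfolding real by (auto simp: boundary_condition_def)
  next
    case PInf
    have "((\<lambda>x. complex_of_real (2 * \<nu>) * cu F x) \<longlongrightarrow> complex_of_real (2 * \<nu>) * \<alpha> F) (at_right 0)"
      by (intro tendsto_intros tendsto_\<alpha> F)
    from *[OF this] show ?thesis
      using W boundary_function_bracket(1)[of _ F] unfolding PInf by (auto simp: boundary_condition_def)
  next
    case MInf
    then show ?thesis using h by simp
  qed
qed

lemma extension_op_iff:
  assumes F: "maximal_function \<nu> F" "represents F f" "represents (tau \<nu> F) g" and h: "h \<noteq> -\<infinity>"
  shows "(f, g) \<in> extension_op \<nu> h \<longleftrightarrow> boundary_condition h (\<alpha> F) (\<beta> F)"
proof -
  have fg: "(f, g) \<in> maximal_op \<nu>" by (rule maximal_opI[OF F])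
  note rF = maximal_functionD(1)[OF F(1)]
  have "(f, g) \<in> extension_op \<nu> h \<longleftrightarrow>
    (\<exists>G. represents G f \<and> regular G \<and> (lagrange_bracket G (boundary_function \<nu> h) \<longlongrightarrow> 0) (at_right 0))"
    using fg unfolding extension_op_def restrict_op_def adjoint_minimal by auto
  also have "\<dots> \<longleftrightarrow> (lagrange_bracket F (boundary_function \<nu> h) \<longlongrightarrow> 0) (at_right 0)"
  proof
    assume "\<exists>G. represents G f \<and> regular G \<and> (lagrange_bracket G (boundary_function \<nu> h) \<longlongrightarrow> 0) (at_right 0)"
    then obtain G where G: "represents G f" "regular G" "(lagrange_bracket G (boundary_function \<nu> h) \<longlongrightarrow> 0) (at_right 0)" by blast
    note eq = regular_unique[OF G(2) rF represents_unique[OF G(1) F(2)]]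
    have "eventually (\<lambda>x. lagrange_bracket G (boundary_function \<nu> h) x = lagrange_bracket F (boundary_function \<nu> h) x) (at_right 0)"
      using eventually_at_right_less[of 0] by (rule eventually_mono) (simp add: lagrange_bracket_def eq(1,2))
    with G(3) show "(lagrange_bracket F (boundary_function \<nu> h) \<longlongrightarrow> 0) (at_right 0)" by (rule Lim_transform_eventually)
  next
    assume "(lagrange_bracket F (boundary_function \<nu> h) \<longlongrightarrow> 0) (at_right 0)"
    with F(2) rF show "\<exists>G. represents G f \<and> regular G \<and> (lagrange_bracket G (boundary_function \<nu> h) \<longlongrightarrow> 0) (at_right 0)"
      by (intro exI[of _ F] conjI)
  qed
  finally show ?thesis using boundary_bracket_tendsto_iff[OF F(1) h] by simp
qed

lemma extension_op_subset: "extension_op \<nu> h \<subseteq> maximal_op \<nu>"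
  unfolding extension_op_def restrict_op_def adjoint_minimal by auto

lemma preminimal_subset_extension:
  assumes h: "h \<noteq> -\<infinity>"
  shows "preminimal_op \<subseteq> extension_op \<nu> h"
proof clarify
  fix f g assume "(f, g) \<in> preminimal_op"
  then have "(f, g) \<in> maximal_op \<nu>" and fc: "f \<in> compactly_supported" by (auto simp: restrict_op_def)
  then obtain F where F: "maximal_function \<nu> F" "represents F f" "represents (tau \<nu> F) g" by (metis maximal_opE)
  show "(f, g) \<in> extension_op \<nu> h"
    unfolding extension_op_iff[OF F h] using preminimal_boundary_values[OF F(1,2) fc] by (simp add: boundary_condition_def)
qed

lemma boundary_condition_symmetric:
  "boundary_condition h a b \<Longrightarrow> boundary_condition h c d \<Longrightarrow> a * cnj d = b * cnj c"
  by (auto simp: boundary_condition_def split: if_splits)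

text \<open>The condition defines a plane on which the boundary form vanishes, so the operator is symmetric. Testing an
element of the adjoint against one function whose boundary values \<open>(a, b)\<close> span the plane returns the
condition.\<close>

lemma adjoint_extension:
  assumes h: "h \<noteq> -\<infinity>"
  shows "adjoint_op (extension_op \<nu> h) = extension_op \<nu> h"
proof (rule equalityI; rule subrelI)
  fix g g' assume adj: "(g, g') \<in> adjoint_op (extension_op \<nu> h)"
  then have "(g, g') \<in> maximal_op \<nu>"
    using adjoint_op_antimono[OF preminimal_subset_extension[OF h]] adjoint_subset_maximal by blast
  then obtain G where G: "maximal_function \<nu> G" "represents G g" "represents (tau \<nu> G) g'" by (rule maximal_opE)
  \<comment> \<open>a vector spanning the plane of admissible boundary values\<close>
  define a where "a = (if h = \<infinity> then 0 else 1 :: complex)"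
  define b where "b = (if h = \<infinity> then 1 else complex_of_real (2 * \<nu> * real_of_ereal h))"
  obtain F where F: "maximal_function \<nu> F" "\<alpha> F = a" "\<beta> F = b" by (rule boundary_values_surjective)
  obtain f f' where f: "represents F f" "represents (tau \<nu> F) f'" by (rule maximal_function_represents[OF F(1)])
  have "(f, f') \<in> extension_op \<nu> h"
    unfolding extension_op_iff[OF F(1) f h] F(2,3) by (simp add: boundary_condition_def a_def b_def)
  then have "cinner f' g = cinner f g'" using adj by (simp add: adjoint_op_iff)
  then have "a * cnj (\<beta> G) = b * cnj (\<alpha> G)" using operator_green[OF F(1) f G] F(2,3) by simp
  then have "cnj a * \<beta> G = cnj b * \<alpha> G" by (metis complex_cnj_cnj complex_cnj_mult)
  then show "(g, g') \<in> extension_op \<nu> h"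
    unfolding extension_op_iff[OF G h] by (auto simp: boundary_condition_def a_def b_def split: if_splits)
next
  fix g g' assume g: "(g, g') \<in> extension_op \<nu> h"
  then obtain G where G: "maximal_function \<nu> G" "represents G g" "represents (tau \<nu> G) g'"
    using extension_op_subset by (blast elim: maximal_opE)
  have "cinner f' g = cinner f g'" if f: "(f, f') \<in> extension_op \<nu> h" for f f'
  proof -
    obtain F where F: "maximal_function \<nu> F" "represents F f" "represents (tau \<nu> F) f'"
      using f extension_op_subset by (blast elim: maximal_opE)
    show ?thesis unfolding operator_green[OF F G]
      using f g unfolding extension_op_iff[OF F h] extension_op_iff[OF G h] by (rule boundary_condition_symmetric)
  qed
  then show "(g, g') \<in> adjoint_op (extension_op \<nu> h)" by (simp add: adjoint_op_iff)
qed

lemma self_adjoint_extension: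
  assumes h: "h \<noteq> -\<infinity>"
  shows "self_adjoint (extension_op \<nu> h)" "minimal_op \<nu> \<subseteq> extension_op \<nu> h"
proof -
  have "Domain preminimal_op \<subseteq> Domain (extension_op \<nu> h)"
    using preminimal_subset_extension[OF h] by (rule Domain_mono)
  then have "closure (Domain preminimal_op) \<subseteq> closure (Domain (extension_op \<nu> h))" by (rule closure_mono)
  then have dense: "closure (Domain (extension_op \<nu> h)) = UNIV" unfolding minimal_domain_dense by blast
  from linear_operator_adjoint_op[OF dense] dense show "self_adjoint (extension_op \<nu> h)"
    unfolding self_adjoint_def adjoint_extension[OF h] by simp
  have "closed (extension_op \<nu> h)" using closed_adjoint_op[of "extension_op \<nu> h"] unfolding adjoint_extension[OF h] .
  then show "minimal_op \<nu> \<subseteq> extension_op \<nu> h"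
    unfolding minimal_op_def by (rule closure_minimal[OF preminimal_subset_extension[OF h]])
qed

text \<open>The hypothesis says that \<open>L\<close> is its own orthogonal complement. An element \<open>(a, b)\<close> of \<open>L\<close> with \<open>a \<noteq> 0\<close> is
orthogonal to itself, so \<open>b / a\<close> is real; this slope then determines \<open>L\<close>.\<close>

lemma lagrangian_plane:
  fixes L :: "(complex \<times> complex) set"
  assumes L: "\<And>c d. (c, d) \<in> L \<longleftrightarrow> (\<forall>(a, b)\<in>L. a * cnj d = b * cnj c)"
  obtains h where "h \<noteq> -\<infinity>" "\<And>a b. (a, b) \<in> L \<longleftrightarrow> boundary_condition h a b"
proof (cases "\<exists>(a, b)\<in>L. a \<noteq> 0")
  case True
  then obtain a b where ab: "(a, b) \<in> L" "a \<noteq> 0" by blast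
  have "a * cnj b = b * cnj a" using L[of a b] ab(1) by blast
  then have "cnj (b / a) = b / a" using ab(2) by (simp add: field_simps)
  then obtain t where t: "b / a = complex_of_real t" by (metis Reals_cnj_iff Reals_cases)
  then have b: "b = complex_of_real t * a" using ab(2) by (simp add: field_simps)
  have sub: "d = complex_of_real t * c" if "(c, d) \<in> L" for c d
  proof -
    have "a * cnj d = b * cnj c" using L[of c d] that ab(1) by blast
    then have "cnj d = complex_of_real t * cnj c" unfolding b using ab(2) by simp
    then have "cnj (cnj d) = cnj (complex_of_real t * cnj c)" by (rule arg_cong)
    then show ?thesis by simp
  qed
  have "(c, complex_of_real t * c) \<in> L" for c
    unfolding L[of c]
  proof clarify
    fix a' b' assume "(a', b') \<in> L"
    then have "b' = complex_of_real t * a'" by (rule sub)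
    then show "a' * cnj (complex_of_real t * c) = b' * cnj c" by simp
  qed
  with sub have iff: "(c, d) \<in> L \<longleftrightarrow> d = complex_of_real t * c" for c d by auto
  show ?thesis
  proof (rule that[of "ereal (t / (2 * \<nu>))"])
    show "(c, d) \<in> L \<longleftrightarrow> boundary_condition (ereal (t / (2 * \<nu>))) c d" for c d
      unfolding iff using \<nu> by (simp add: boundary_condition_def)
  qed simp
next
  case False
  have "(c, d) \<in> L \<longleftrightarrow> c = 0" for c d
    using L[of c d] False by fastforce
  then show ?thesis by (intro that[of \<infinity>]) (auto simp: boundary_condition_def)
qed

text \<open>Let \<open>L\<close> be the set of boundary values of \<open>S\<close>. By Green's formula and \<open>S\<^sup>* = S\<close>, an element of the maximal
operator belongs to \<open>S\<close> if and only if its boundary values are orthogonal to \<open>L\<close>; since all boundary values occur,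
\<open>L\<close> is its own orthogonal complement.\<close>

lemma self_adjoint_is_extension:
  assumes S: "self_adjoint S" and min: "minimal_op \<nu> \<subseteq> S"
  shows "\<exists>h. h \<noteq> -\<infinity> \<and> S = extension_op \<nu> h"
proof -
  have adj: "adjoint_op S = S" using S by (simp add: self_adjoint_def)
  have sub: "S \<subseteq> maximal_op \<nu>" using adjoint_op_antimono[OF min] unfolding adj adjoint_minimal .
  define L where "L = {(\<alpha> F, \<beta> F) |F. maximal_function \<nu> F \<and> (\<exists>f g. represents F f \<and> represents (tau \<nu> F) g \<and> (f, g) \<in> S)}"
  have key: "(f, g) \<in> S \<longleftrightarrow> (\<forall>(a, b)\<in>L. a * cnj (\<beta> F) = b * cnj (\<alpha> F))"
    if F: "maximal_function \<nu> F" "represents F f" "represents (tau \<nu> F) g" for F f g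
  proof
    assume fg: "(f, g) \<in> S"
    show "\<forall>(a, b)\<in>L. a * cnj (\<beta> F) = b * cnj (\<alpha> F)"
    proof clarify
      fix a b assume "(a, b) \<in> L"
      then obtain P p p' where P: "maximal_function \<nu> P" "represents P p" "represents (tau \<nu> P) p'" "(p, p') \<in> S"
        "a = \<alpha> P" "b = \<beta> P" unfolding L_def by blast
      have "(f, g) \<in> adjoint_op S" using fg unfolding adj .
      then have "cinner p' f = cinner p g" using P(4) unfolding adjoint_op_iff by blast
      then show "a * cnj (\<beta> F) = b * cnj (\<alpha> F)" using operator_green[OF P(1-3) F] P(5,6) by simp
    qed
  next
    assume L: "\<forall>(a, b)\<in>L. a * cnj (\<beta> F) = b * cnj (\<alpha> F)"
    have "cinner p' f = cinner p g" if p: "(p, p') \<in> S" for p p'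
    proof -
      obtain P where P: "maximal_function \<nu> P" "represents P p" "represents (tau \<nu> P) p'"
        using p sub by (blast elim: maximal_opE)
      then have "(\<alpha> P, \<beta> P) \<in> L" unfolding L_def using p by blast
      then show ?thesis using L operator_green[OF P F] by blast
    qed
    then have "(f, g) \<in> adjoint_op S" by (simp add: adjoint_op_iff)
    then show "(f, g) \<in> S" unfolding adj .
  qed
  have "(c, d) \<in> L \<longleftrightarrow> (\<forall>(a, b)\<in>L. a * cnj d = b * cnj c)" for c d
  proof
    assume "(c, d) \<in> L"
    then obtain F f g where "maximal_function \<nu> F" "represents F f" "represents (tau \<nu> F) g" "(f, g) \<in> S"
        "c = \<alpha> F" "d = \<beta> F" unfolding L_def by blast
    with key show "\<forall>(a, b)\<in>L. a * cnj d = b * cnj c" by blast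
  next
    assume *: "\<forall>(a, b)\<in>L. a * cnj d = b * cnj c"
    obtain F where F: "maximal_function \<nu> F" "\<alpha> F = c" "\<beta> F = d" by (rule boundary_values_surjective)
    obtain f g where f: "represents F f" "represents (tau \<nu> F) g" by (rule maximal_function_represents[OF F(1)])
    have "(f, g) \<in> S" using key[OF F(1) f] * F(2,3) by simp
    then show "(c, d) \<in> L" unfolding L_def using F f by blast
  qed
  note Liff = this
  obtain h where h: "h \<noteq> -\<infinity>" "\<And>a b. (a, b) \<in> L \<longleftrightarrow> boundary_condition h a b" using lagrangian_plane[OF Liff] by metis
  have "(f, g) \<in> S \<longleftrightarrow> (f, g) \<in> extension_op \<nu> h" for f g
  proof (cases "(f, g) \<in> maximal_op \<nu>")
    case True
    then obtain F where F: "maximal_function \<nu> F" "represents F f" "represents (tau \<nu> F) g" by (rule maximal_opE)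
    show ?thesis unfolding key[OF F] extension_op_iff[OF F h(1)] Liff[symmetric] h(2) by simp
  next
    case False
    then show ?thesis using sub extension_op_subset by blast
  qed
  with h(1) show ?thesis by auto
qed

lemma nonneg_extension_iff:
  assumes h: "h \<noteq> -\<infinity>"
  shows "nonneg_operator (extension_op \<nu> h) \<longleftrightarrow> h \<ge> 0"
proof
  assume h0: "h \<ge> 0"
  show "nonneg_operator (extension_op \<nu> h)"
    unfolding nonneg_operator_def
  proof clarify
    fix f f' assume f: "(f, f') \<in> extension_op \<nu> h"
    then obtain F where F: "maximal_function \<nu> F" "represents F f" "represents (tau \<nu> F) f'"
      using extension_op_subset by (blast elim: maximal_opE)
    have bc: "boundary_condition h (\<alpha> F) (\<beta> F)" using f unfolding extension_op_iff[OF F h] .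
    have "cinner f' f = cinner f f'" using operator_green[OF F F] boundary_condition_symmetric[OF bc bc] by blast
    then have "cinner f' f = cnj (cinner f' f)" unfolding cinner_commute[of f f'] .
    then have im: "Im (cinner f' f) = 0" by (simp add: complex_eq_iff)
    have "0 \<le> Re (\<beta> F * cnj (\<alpha> F))"
    proof (cases h)
      case (real t)
      have "\<beta> F * cnj (\<alpha> F) = complex_of_real (2 * \<nu> * t * (cmod (\<alpha> F))\<^sup>2)"
        using bc unfolding real of_real_mult complex_norm_square by (simp add: boundary_condition_def)
      then show ?thesis using h0 \<nu> unfolding real by simp
    next
      case PInf
      then have "\<alpha> F = 0" using bc by (simp add: boundary_condition_def)
      then show ?thesis by simp
    next
      case MInf
      then show ?thesis using h by simp
    qed
    then have "0 \<le> Re (cinner f' f)"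
      unfolding cinner_represents[OF F(3,2)] using energy_lower_bound[OF F(1)] \<nu>
      by (meson mult_nonneg_nonneg order_trans less_imp_le zero_le_numeral)
    with im show "cinner f' f \<in> \<real>\<^sub>\<ge>\<^sub>0" by (simp add: complex_nonneg_Reals_iff)
  qed
next
  assume nn: "nonneg_operator (extension_op \<nu> h)"
  show "h \<ge> 0"
  proof (rule ccontr)
    assume "\<not> h \<ge> 0"
    with h obtain t where t: "h = ereal t" "t < 0" by (cases h) auto
    define m where "m = - (2 * \<nu> * t)"
    have m: "0 < m" using t \<nu> by (simp add: m_def mult_pos_neg)
    obtain F where F: "maximal_function \<nu> F" "\<alpha> F = 1" "\<beta> F = - complex_of_real m"
      "Re (LINT x|half_line. tau \<nu> F x * cnj (F x)) < 0" by (rule negative_energy[OF m])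
    obtain f f' where f: "represents F f" "represents (tau \<nu> F) f'" by (rule maximal_function_represents[OF F(1)])
    have "(f, f') \<in> extension_op \<nu> h"
      unfolding extension_op_iff[OF F(1) f h] F(2,3) by (simp add: boundary_condition_def m_def t)
    then have "cinner f' f \<in> \<real>\<^sub>\<ge>\<^sub>0" using nn unfolding nonneg_operator_def by blast
    then have "0 \<le> Re (cinner f' f)" by (simp add: complex_nonneg_Reals_iff)
    with F(4) show False unfolding cinner_represents[OF f(2,1)] by simp
  qed
qed

end

theorem corollary5p9:
  fixes \<nu> :: real
  assumes "0 < \<nu>" and "\<nu> < 1"
  shows "{S. self_adjoint S \<and> minimal_op \<nu> \<subseteq> S} = extension_op \<nu> ` {h. h \<noteq> -\<infinity>} \<and>
    (\<forall>h. h \<noteq> -\<infinity> \<longrightarrow> (nonneg_operator (extension_op \<nu> h) \<longleftrightarrow> h \<ge> 0))"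
proof -
  interpret bessel \<nu> by unfold_locales (fact assms)+
  have "S \<in> extension_op \<nu> ` {h. h \<noteq> -\<infinity>}" if "self_adjoint S" "minimal_op \<nu> \<subseteq> S" for S
    using self_adjoint_is_extension[OF that] by blast
  then have "{S. self_adjoint S \<and> minimal_op \<nu> \<subseteq> S} = extension_op \<nu> ` {h. h \<noteq> -\<infinity>}"
    using self_adjoint_extension by blast
  then show ?thesis using nonneg_extension_iff by blast
qed

end
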